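(* Let $n\ge1$ and let $f\colon(\mathbb C\setminus\mathbb R)^n\to\mathbb C$ be a holomorphic function for which there are numbers $d_1,\ldots,d_n\ge0$ such that, for every index $j\in\{1,\ldots,n\}$, $$\lim_{z_j\xrightarrow{\vee}\infty}\frac{f(\boldsymbol z)}{z_j}=\lim_{z_j\xrightarrow{\wedge}\infty}\frac{f(\boldsymbol z)}{z_j}=d_j ,$$ where, for fixed $j$, the limits are independent of the values in $\mathbb C\setminus\mathbb R$ of the components of $\boldsymbol z$ at the non-$j$-th positions. Then $f=h_{\mathrm{sym}}$ for some Herglotz-Nevanlinna function $h\colon(\mathbb C^+)^n\to\mathbb C$ if and only if the following three conditions hold: (i) $\operatorname{Im}[f(\boldsymbol z)]\ge0$ for all $\boldsymbol z\in(\mathbb C^+)^n$; (ii') the function $F(\boldsymbol z):=f(\boldsymbol z)-\sum_{j=1}^nd_jz_j$ satisfies the symmetry formula $$F(\boldsymbol z)=\sum_{\substack{B\subseteq\{1,\ldots,n\}\\ B\neq\emptyset}}(-1)^{|B|+1}\,\overline{F(\Psi_B(i\,\boldsymbol 1,\boldsymbol z))}\qquad\text{for all }\boldsymbol z\in(\mathbb C\setminus\mathbb R)^n;$$ (iii') the function $F(\boldsymbol z)=f(\boldsymbol z)-\sum_{j=1}^nd_jz_j$ satisfies the variable non-dependence property.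
   Context: Notation: $\mathbb C^{\pm}=\{z\in\mathbb C:\pm\operatorname{Im} z>0\}$; $\boldsymbol 1=(1,\ldots,1)$; $i$ is the imaginary unit. Non-tangential limits: for $\theta\in(0,\pi/2]$, the upper Stoltz domain with centre $0$ and angle $\theta$ is $\{z\in\mathbb C^+:\theta\le\arg z\le\pi-\theta\}$; $z\xrightarrow{\vee}\infty$ denotes the limit $|z|\to\infty$ within any upper Stoltz domain with centre $0$. Lower Stoltz domains (the analogous sectors in $\mathbb C^-$) and $z\xrightarrow{\wedge}\infty$ are defined analogously. The map $\Psi_B$: for $B\subseteq\{1,\ldots,n\}$ and $\boldsymbol z,\boldsymbol w\in\mathbb C^n$, $\Psi_B(\boldsymbol z,\boldsymbol w):=\boldsymbol\zeta$ with $\zeta_j:=z_j$ if $j\notin B$ and $\zeta_j:=\overline{w_j}$ if $j\in B$. Variable non-dependence property: a function $f\colon(\mathbb C\setminus\mathbb R)^n\to\mathbb C$ has this property if for every $\boldsymbol z\in(\mathbb C\setminus\mathbb R)^n$ with $z_j\in\mathbb C^-$ for some $j$, the value $f(\boldsymbol z)$ does not depend on the components of $\boldsymbol z$ lying in $\mathbb C^+$; that is, $f(\boldsymbol z)=f(\boldsymbol w)$ whenever $\boldsymbol z,\boldsymbol w\in(\mathbb C\setminus\mathbb R)^n$ have the same nonempty set of indices $j$ with $j$-th component in $\mathbb C^-$ and $z_j=w_j$ for all those $j$. Herglotz-Nevanlinna function: a holomorphic function $h\colon(\mathbb C^+)^n\to\mathbb C$ with non-negative imaginary part. Kernel: for $\boldsymbol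 z\in(\mathbb C\setminus\mathbb R)^n$, $\boldsymbol t\in\mathbb R^n$, $$K_n(\boldsymbol z,\boldsymbol t):=i\left(\frac{2}{(2i)^n}\prod_{\ell=1}^n\Big(\frac1{t_\ell-z_\ell}-\frac1{t_\ell+i}\Big)-\frac1{(2i)^n}\prod_{\ell=1}^n\Big(\frac1{t_\ell-i}-\frac1{t_\ell+i}\Big)\right).$$ Known integral representation (needed to define $h_{\mathrm{sym}}$): a function $h\colon(\mathbb C^+)^n\to\mathbb C$ is a Herglotz-Nevanlinna function if and only if $$h(\boldsymbol z)=a+\sum_{j=1}^n b_jz_j+\frac1{\pi^n}\int_{\mathbb R^n}K_n(\boldsymbol z,\boldsymbol t)\,d\mu(\boldsymbol t)\qquad(\boldsymbol z\in(\mathbb C^+)^n),$$ where $a\in\mathbb R$, $\boldsymbol b\in[0,\infty)^n$ and $\mu$ is a positive Borel measure on $\mathbb R^n$ with $\int_{\mathbb R^n}\prod_{\ell=1}^n\frac1{1+t_\ell^2}\,d\mu(\boldsymbol t)<\infty$ and $$\sum_{\substack{\boldsymbol\rho\in\{-1,0,1\}^n\\ -1\in\boldsymbol\rho\ \wedge\ 1\in\boldsymbol\rho}}\int_{\mathbb R^n}\prod_{j=1}^nN_{\rho_j}(z_j,t_j)\,d\mu(\boldsymbol t)=0\quad\text{for all }\boldsymbol z\in(\mathbb C^+)^n,$$ where the sum runs over those $\boldsymbol\rho$ having at least one entry $-1$ and at least one entry $1$, and $N_{-1}(z,t)=\frac1{2i}\big(\frac1{t-z}-\frac1{t-i}\big)$,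 $N_0(z,t)=\frac1{2i}\big(\frac1{t-i}-\frac1{t+i}\big)$, $N_1(z,t)=\frac1{2i}\big(\frac1{t+i}-\frac1{t-\bar z}\big)$. The triple $(a,\boldsymbol b,\mu)$ is unique for given $h$. Symmetric extension: for a Herglotz-Nevanlinna function $h$ with triple $(a,\boldsymbol b,\mu)$, $h_{\mathrm{sym}}\colon(\mathbb C\setminus\mathbb R)^n\to\mathbb C$ is given by $$h_{\mathrm{sym}}(\boldsymbol z):=a+\sum_{j=1}^n b_jz_j+\frac1{\pi^n}\int_{\mathbb R^n}K_n(\boldsymbol z,\boldsymbol t)\,d\mu(\boldsymbol t),$$ taken for all $\boldsymbol z\in(\mathbb C\setminus\mathbb R)^n$ (where it is well defined). *)

theory Defs
  imports "HOL-Complex_Analysis.Complex_Analysis"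
begin

text \<open>
  The index type \<open>'n\<close> has \<open>CARD('n) = n \<ge> 1\<close> elements.  Functions on \<open>(\<complex>\<^sup>+)\<^sup>n\<close> or
  \<open>(\<complex> \ \<real>)\<^sup>n\<close> are total functions on \<^typ>\<open>complex ^ 'n\<close>; their values outside the
  domain in question never matter.
\<close>

definition upper_poly :: "(complex ^ 'n) set" where
  "upper_poly = {z. \<forall>j. Im (z $ j) > 0}"

definition offreal_poly :: "(complex ^ 'n) set" where
  "offreal_poly = {z. \<forall>j. z $ j \<notin> \<real>}"

text \<open>Holomorphy in several variables: a complex linear Frechet derivative exists at every
  point (used for open sets only).\<close>

definition mv_holomorphic_on :: "(complex ^ 'n \<Rightarrow> complex) \<Rightarrow> (complex ^ 'n) set \<Rightarrow> bool" where
  "mv_holomorphic_on f S \<longleftrightarrow>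
     (\<forall>z\<in>S. \<exists>D. (f has_derivative D) (at z) \<and> (\<forall>c v. D (c *s v) = c * D v))"

definition upper_stoltz :: "real \<Rightarrow> complex set" where
  "upper_stoltz \<theta> = {z. Im z > 0 \<and> \<theta> \<le> Arg z \<and> Arg z \<le> pi - \<theta>}"

text \<open>\<^const>\<open>Arg\<close> takes values in \<open>(-\<pi>, \<pi>]\<close>; this is the complex conjugate of the upper domain.\<close>

definition lower_stoltz :: "real \<Rightarrow> complex set" where
  "lower_stoltz \<theta> = {z. Im z < 0 \<and> - (pi - \<theta>) \<le> Arg z \<and> Arg z \<le> - \<theta>}"

definition nontang_upper_lim :: "(complex \<Rightarrow> complex) \<Rightarrow> complex \<Rightarrow> bool" where
  "nontang_upper_lim g L \<longleftrightarrow>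
     (\<forall>\<theta>\<in>{0<..pi/2}. (g \<longlongrightarrow> L) (inf at_infinity (principal (upper_stoltz \<theta>))))"

definition nontang_lower_lim :: "(complex \<Rightarrow> complex) \<Rightarrow> complex \<Rightarrow> bool" where
  "nontang_lower_lim g L \<longleftrightarrow>
     (\<forall>\<theta>\<in>{0<..pi/2}. (g \<longlongrightarrow> L) (inf at_infinity (principal (lower_stoltz \<theta>))))"

definition set_comp :: "complex ^ 'n \<Rightarrow> 'n \<Rightarrow> complex \<Rightarrow> complex ^ 'n" where
  "set_comp z j w = (\<chi> k. if k = j then w else z $ k)"

definition Psi :: "'n set \<Rightarrow> complex ^ 'n \<Rightarrow> complex ^ 'n \<Rightarrow> complex ^ 'n" where
  "Psi B z w = (\<chi> j. if j \<in> B then cnj (w $ j) else z $ j)"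

definition lower_indices :: "complex ^ 'n \<Rightarrow> 'n set" where
  "lower_indices z = {j. Im (z $ j) < 0}"

definition var_nondep :: "(complex ^ 'n \<Rightarrow> complex) \<Rightarrow> bool" where
  "var_nondep f \<longleftrightarrow>
     (\<forall>z\<in>offreal_poly. \<forall>w\<in>offreal_poly.
        lower_indices z = lower_indices w \<longrightarrow> lower_indices z \<noteq> {} \<longrightarrow>
        (\<forall>j\<in>lower_indices z. z $ j = w $ j) \<longrightarrow> f z = f w)"

definition herglotz_nevanlinna :: "(complex ^ 'n \<Rightarrow> complex) \<Rightarrow> bool" where
  "herglotz_nevanlinna h \<longleftrightarrow>
     mv_holomorphic_on h upper_poly \<and> (\<forall>z\<in>upper_poly. Im (h z) \<ge> 0)"

definition kernel_K :: "complex ^ 'n \<Rightarrow> real ^ 'n \<Rightarrow> complex" where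
  "kernel_K z t = \<i> *
     (2 / (2 * \<i>) ^ CARD('n) *
        (\<Prod>l\<in>UNIV. 1 / (of_real (t $ l) - z $ l) - 1 / (of_real (t $ l) + \<i>))
      - 1 / (2 * \<i>) ^ CARD('n) *
        (\<Prod>l\<in>UNIV. 1 / (of_real (t $ l) - \<i>) - 1 / (of_real (t $ l) + \<i>)))"

text \<open>Only the indices \<open>-1\<close>, \<open>0\<close> and \<open>1\<close> are ever used.\<close>

definition factor_N :: "int \<Rightarrow> complex \<Rightarrow> real \<Rightarrow> complex" where
  "factor_N r z t =
     (if r = -1 then 1 / (2 * \<i>) * (1 / (of_real t - z) - 1 / (of_real t - \<i>))
      else if r = 0 then 1 / (2 * \<i>) * (1 / (of_real t - \<i>) - 1 / (of_real t + \<i>))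
      else 1 / (2 * \<i>) * (1 / (of_real t + \<i>) - 1 / (of_real t - cnj z)))"

definition herglotz_formula ::
    "real \<Rightarrow> real ^ 'n \<Rightarrow> (real ^ 'n) measure \<Rightarrow> complex ^ 'n \<Rightarrow> complex" where
  "herglotz_formula a b \<mu> z =
     of_real a + (\<Sum>j\<in>UNIV. of_real (b $ j) * z $ j)
     + 1 / of_real pi ^ CARD('n) * (\<integral>t. kernel_K z t \<partial>\<mu>)"

definition herglotz_triple ::
    "(complex ^ 'n \<Rightarrow> complex) \<Rightarrow> real \<Rightarrow> real ^ 'n \<Rightarrow> (real ^ 'n) measure \<Rightarrow> bool" where
  "herglotz_triple h a b \<mu> \<longleftrightarrow>
     (\<forall>j. b $ j \<ge> 0) \<and>
     sets \<mu> = sets borel \<and>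
     (\<integral>\<^sup>+t. ennreal (\<Prod>l\<in>UNIV. 1 / (1 + (t $ l)\<^sup>2)) \<partial>\<mu>) < \<infinity> \<and>
     (\<forall>z\<in>upper_poly.
        (\<Sum>\<rho> | range \<rho> \<subseteq> {-1, 0, 1} \<and> -1 \<in> range \<rho> \<and> 1 \<in> range \<rho>.
           \<integral>t. (\<Prod>j\<in>UNIV. factor_N (\<rho> j) (z $ j) (t $ j)) \<partial>\<mu>) = 0) \<and>
     (\<forall>z\<in>upper_poly. h z = herglotz_formula a b \<mu> z)"

text \<open>Every Herglotz-Nevanlinna function has exactly one representing triple, so the choice
  below picks that triple.\<close>

definition herglotz_sym :: "(complex ^ 'n \<Rightarrow> complex) \<Rightarrow> complex ^ 'n \<Rightarrow> complex" where
  "herglotz_sym h =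
     (case (SOME (a, b, \<mu>). herglotz_triple h a b \<mu>) of (a, b, \<mu>) \<Rightarrow> herglotz_formula a b \<mu>)"

end

theory Submission
  imports Defs "HOL-Probability.Probability"
begin

text \<open>
  Let \<open>h\<close> be a Herglotz--Nevanlinna function.  By Julia--Wolff its linear coefficients \<open>b\<^sub>j\<close> exist, and they do
  not depend on the other variables because real-valued holomorphic functions are constant; so the linear part can be
  subtracted.  The rest \<open>F\<close> is approximated by the functions \<open>F / (1 - \<i>\<epsilon>F)\<close>, shifted by \<open>\<i>\<epsilon>\<close>, which are bounded
  and holomorphic across the boundary and hence satisfy iterated Cauchy formulas.  Their boundary measures are tight
  since \<open>F\<close> has no linear growth, and a weak limit represents \<open>F\<close>; every mixed term of the Nevanlinna condition
  vanishes in the limit.  Conversely, for any representing triple the mixed terms vanish one by one, because they are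
  holomorphic or antiholomorphic in each variable.  This yields the variable non-dependence property, while the symmetry
  formula is an algebraic identity between the kernels.  Both properties together determine a function
  by its values on the upper poly-half-plane.
\<close>

section \<open>The Julia--Wolff lemma\<close>

text \<open>\<open>herglotz_sym\<close> takes its triple by \<open>SOME\<close>, so nothing can be
  said about it until some representing triple is known to exist; this is why the integral
  representation is built here. What follows is proved for an arbitrary triple and so covers the
  chosen one. The two ingredients of the approximation have different tasks: the shift makes the
  boundary values continuous and holomorphic across the real space, while
  \<open>u / (1 - \<i> * e * u)\<close> bounds the function by \<open>1 / e\<close> and keeps its
  imaginary part nonnegative, so that the boundary values define a positive measure. All measures
  carry the weight given by the product of the \<open>1 / (1 + t^2)\<close>. They become finite, and
  the matching kernels, multiplied by \<open>1 + t^2\<close>, become bounded continuous test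
  functions for weak convergence. The Herglotz kernel, its continuation to all of
  \<open>offreal_poly\<close> and the three factors \<open>factor_N\<close> are all built from
  differences \<open>1 / (t - a) - 1 / (t - b)\<close>. Only the half-planes containing
  \<open>a\<close> and \<open>b\<close> matter: this decides whether a Cauchy integral reproduces or
  vanishes, and splitting such a difference at an intermediate pole yields both non-dependence and
  symmetry.\<close>

lemma schwarz_pick_half_plane:
  fixes h :: "complex \<Rightarrow> complex"
  assumes hol: "h holomorphic_on {z. Im z > 0}" and im: "\<And>z. Im z > 0 \<Longrightarrow> Im (h z) > 0"
    and z: "Im z > 0" and w: "Im w > 0"
  shows "(cmod (h z - h w))\<^sup>2 * (Im z * Im w) \<le> (cmod (z - w))\<^sup>2 * (Im (h z) * Im (h w))"
proof -
  \<comment> \<open>This identity turns the contraction of the pseudo-hyperbolic distance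
    \<open>cmod ((a - b) / (a - cnj b))\<close> into an inequality without the conjugated
    differences.\<close>
  have cay: "(cmod (a - cnj b))\<^sup>2 = (cmod (a - b))\<^sup>2 + 4 * (Im a * Im b)" for a b
    unfolding cmod_power2 by (simp add: power2_eq_square algebra_simps)
  have ne: "a - cnj b \<noteq> 0" if "Im a > 0" "Im b > 0" for a b
    using that by (auto simp: complex_eq_iff)
  have lt1: "cmod ((a - b) / (a - cnj b)) < 1" if "Im a > 0" "Im b > 0" for a b
  proof -
    have "0 < Im a * Im b" using that by simp
    then have "(cmod (a - b))\<^sup>2 < (cmod (a - cnj b))\<^sup>2" using cay[of a b] by linarith
    then have "cmod (a - b) < cmod (a - cnj b)" by (simp add: power2_less_imp_less)
    then show ?thesis using ne[OF that] by (simp add: norm_divide divide_simps)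
  qed
  \<comment> \<open>Inverse Cayley transform from the unit disc to the upper half-plane, normalised
    by \<open>\<sigma> 0 = w\<close>.\<close>
  define \<sigma> where "\<sigma> u = (w - cnj w * u) / (1 - u)" for u
  have u1: "1 - u \<noteq> 0" if "cmod u < 1" for u :: complex using that by auto
  have \<sigma>im: "Im (\<sigma> u) > 0" if u: "cmod u < 1" for u
  proof -
    have "Im ((w - cnj w * u) * cnj (1 - u)) = Im w * (1 - (cmod u)\<^sup>2)"
      unfolding cmod_power2 by (simp add: algebra_simps power2_eq_square)
    moreover have "1 - (cmod u)\<^sup>2 > 0" using u by (simp add: power_less_one_iff)
    ultimately have "Im ((w - cnj w * u) * cnj (1 - u)) > 0" using w by simp
    then show ?thesis
      unfolding \<sigma>_def using u1[OF u] by (simp add: Im_complex_div_gt_0)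
  qed
  \<comment> \<open>\<open>h\<close> read in disc coordinates centred at \<open>w\<close> and
    \<open>h w\<close>: a self-map of the disc fixing \<open>0\<close>, as the Schwarz lemma
    requires.\<close>
  define \<phi> where "\<phi> u = (h (\<sigma> u) - h w) / (h (\<sigma> u) - cnj (h w))" for u
  have \<sigma>hol: "\<sigma> holomorphic_on ball 0 1"
    unfolding \<sigma>_def by (intro holomorphic_intros) (use u1 in auto)
  have "(h \<circ> \<sigma>) holomorphic_on ball 0 1"
    by (rule holomorphic_on_compose_gen[OF \<sigma>hol hol]) (auto simp: \<sigma>im)
  then have hs: "(\<lambda>u. h (\<sigma> u)) holomorphic_on ball 0 1" by (simp add: o_def)
  have \<phi>hol: "\<phi> holomorphic_on ball 0 1"
    unfolding \<phi>_def by (intro holomorphic_intros hs) (use ne im \<sigma>im w in auto)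
  have \<phi>0: "\<phi> 0 = 0" by (simp add: \<phi>_def \<sigma>_def)
  have \<phi>lt: "cmod (\<phi> u) < 1" if "cmod u < 1" for u
    unfolding \<phi>_def by (intro lt1 im \<sigma>im that w)
  define u where "u = (z - w) / (z - cnj w)"
  have cu: "cmod u < 1" unfolding u_def by (rule lt1[OF z w])
  have zn: "z - cnj w \<noteq> 0" by (rule ne[OF z w])
  have wn: "w - cnj w \<noteq> 0" by (rule ne[OF w w])
  have "\<sigma> u = z"
  proof -
    have "1 - u = (w - cnj w) / (z - cnj w)" using zn by (simp add: u_def divide_simps)
    moreover have "w - cnj w * u = z * (w - cnj w) / (z - cnj w)"
      using zn by (simp add: u_def divide_simps) (simp add: algebra_simps)
    ultimately show ?thesis unfolding \<sigma>_def using zn wn by simp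
  qed
  moreover have "h z - cnj (h w) \<noteq> 0" by (intro ne im z w)
  ultimately have "cmod (h z - h w) = cmod (\<phi> u) * cmod (h z - cnj (h w))"
    by (simp add: \<phi>_def norm_divide)
  moreover have "cmod (z - w) = cmod u * cmod (z - cnj w)" using zn by (simp add: u_def norm_divide)
  moreover have "cmod (\<phi> u) \<le> cmod u" by (rule Schwarz_Lemma(1)[OF \<phi>hol \<phi>0 \<phi>lt cu])
  then have "cmod (\<phi> u) * (cmod (h z - cnj (h w)) * cmod (z - cnj w))
      \<le> cmod u * (cmod (h z - cnj (h w)) * cmod (z - cnj w))"
    by (intro mult_right_mono) auto
  ultimately have "cmod (h z - h w) * cmod (z - cnj w) \<le> cmod (z - w) * cmod (h z - cnj (h w))"
    by (simp add: mult_ac)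
  then have "(cmod (h z - h w) * cmod (z - cnj w))\<^sup>2 \<le> (cmod (z - w) * cmod (h z - cnj (h w)))\<^sup>2"
    by (rule power_mono) simp
  \<comment> \<open>After \<open>cay\<close> the product of the two squared distances stands on both
    sides and cancels.\<close>
  then show ?thesis unfolding power_mult_distrib cay by (simp add: algebra_simps)
qed

text \<open>Adding \<open>\<i> * e\<close> to \<open>h\<close> gives the strict case, and both sides
  of the inequality are continuous as \<open>e\<close> tends to \<open>0\<close>.\<close>

lemma schwarz_pick_half_plane_nonneg:
  fixes h :: "complex \<Rightarrow> complex"
  assumes hol: "h holomorphic_on {z. Im z > 0}" and im: "\<And>z. Im z > 0 \<Longrightarrow> Im (h z) \<ge> 0"
    and z: "Im z > 0" and w: "Im w > 0"
  shows "(cmod (h z - h w))\<^sup>2 * (Im z * Im w) \<le> (cmod (z - w))\<^sup>2 * (Im (h z) * Im (h w))"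
proof -
  have "(cmod (h z - h w))\<^sup>2 * (Im z * Im w) \<le> (cmod (z - w))\<^sup>2 * ((Im (h z) + e) * (Im (h w) + e))"
    if "e > 0" for e :: real
  proof -
    have "(\<lambda>z. h z + \<i> * of_real e) holomorphic_on {z. Im z > 0}"
      by (intro holomorphic_intros hol)
    moreover have "Im (h z + \<i> * of_real e) > 0" if "Im z > 0" for z
      using im[OF that] \<open>e > 0\<close> by simp
    ultimately show ?thesis using schwarz_pick_half_plane[OF _ _ z w] by fastforce
  qed
  moreover have "((\<lambda>e. (cmod (z - w))\<^sup>2 * ((Im (h z) + e) * (Im (h w) + e))) \<longlongrightarrow>
     (cmod (z - w))\<^sup>2 * ((Im (h z) + 0) * (Im (h w) + 0))) (at_right 0)"
    by (intro tendsto_intros)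
  ultimately show ?thesis
    by (intro tendsto_lowerbound[where F = "at_right (0::real)"])
       (auto simp: eventually_at_right_field intro: exI[of _ 1])
qed

text \<open>The Julia--Wolff lemma at the boundary point \<open>\<infinity>\<close>: by Schwarz--Pick, \<open>Im h(iy) / y\<close> is decreasing in \<open>y\<close>.\<close>

lemma half_plane_linear_growth:
  fixes h :: "complex \<Rightarrow> complex"
  assumes hol: "h holomorphic_on {z. Im z > 0}" and im: "\<And>z. Im z > 0 \<Longrightarrow> Im (h z) \<ge> 0"
  obtains b :: real where "b \<ge> 0"
    "((\<lambda>y. h (\<i> * of_real y) / (\<i> * of_real y)) \<longlongrightarrow> of_real b) at_top"
    "\<And>z. Im z > 0 \<Longrightarrow> Im (h z) \<ge> b * Im z"
proof -
  note SP = schwarz_pick_half_plane_nonneg[OF hol im]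
  define q where "q y = Im (h (\<i> * of_real y)) / y" for y
  have q0: "q y \<ge> 0" if "y > 0" for y using im[of "\<i> * of_real y"] that by (simp add: q_def)
  have anti: "q y' \<le> q y" if y: "0 < y" "y \<le> y'" for y y'
  proof (rule ccontr)
    assume "\<not> q y' \<le> q y"
    then have lt: "q y < q y'" by simp
    have y': "y' > 0" using y by simp
    define u u' where "u = Im (h (\<i> * of_real y))" and "u' = Im (h (\<i> * of_real y'))"
    have u0: "u \<ge> 0" unfolding u_def using y by (intro im) auto
    have lt': "u * y' < u' * y" using lt y y' by (simp add: q_def u_def u'_def divide_simps mult.commute)
    have "(u - u')\<^sup>2 \<le> (cmod (h (\<i> * of_real y) - h (\<i> * of_real y')))\<^sup>2"
      unfolding u_def u'_def cmod_power2 by simp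
    moreover have "(cmod (\<i> * of_real y - \<i> * of_real y'))\<^sup>2 = (y - y')\<^sup>2"
      by (simp add: cmod_power2)
    ultimately have "(u - u')\<^sup>2 * (y * y') \<le> (y - y')\<^sup>2 * (u * u')"
      using SP[of "\<i> * of_real y" "\<i> * of_real y'"] y y' unfolding u_def u'_def
      by (smt (verit, best) Im_i_times Re_complex_of_real mult_pos_pos mult_right_mono)
    \<comment> \<open>On the imaginary axis Schwarz-Pick factors. If the quotient increased, both
      factors would be negative.\<close>
    then have "(u * y' - u' * y) * (u * y - u' * y') \<le> 0"
      by (simp add: power2_eq_square algebra_simps)
    moreover have "u * y - u' * y' < 0"
    proof -
      have "u * y * y' < u' * y * y" using lt' y by (simp add: algebra_simps)
      also have "\<dots> \<le> u' * y' * y'" 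
      proof -
        have "u' > 0" using lt' u0 y y' by (smt (verit) mult_nonneg_nonneg zero_less_mult_pos2)
        then show ?thesis using y by (intro mult_mono) auto
      qed
      finally show ?thesis using y' by (simp add: algebra_simps)
    qed
    ultimately show False using lt' by (smt (verit) mult_neg_neg)
  qed
  define b where "b = Inf (q ` {0<..})"
  have bdd: "bdd_below (q ` {0<..})" using q0 by (auto intro!: bdd_belowI[of _ 0])
  have bq: "b \<le> q y" if "y > 0" for y unfolding b_def using that by (intro cInf_lower bdd) auto
  have b0: "b \<ge> 0" unfolding b_def by (intro cInf_greatest) (auto intro: q0)
  have qlim: "(q \<longlongrightarrow> b) at_top"
  proof (rule tendstoI)
    fix e :: real assume "e > 0"
    then have "Inf (q ` {0<..}) < b + e" by (simp add: b_def)
    then obtain y where y: "y > 0" "q y < b + e" 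
      using cInf_lessD[of "q ` {0<..}" "b + e"] by auto
    show "\<forall>\<^sub>F x in at_top. dist (q x) b < e"
      unfolding eventually_at_top_linorder
    proof (intro exI allI impI)
      fix x assume "y \<le> x"
      then have "q x \<le> q y" "b \<le> q x" using anti bq y by auto
      then show "dist (q x) b < e" using y by (simp add: dist_real_def)
    qed
  qed
  \<comment> \<open>Schwarz-Pick for \<open>z\<close> and \<open>\<i> * Y\<close>, divided by
    \<open>Y^3\<close>, so that both sides can be followed as \<open>Y\<close> tends to
    infinity.\<close>
  have key: "(cmod (h z / of_real Y - h (\<i> * of_real Y) / of_real Y))\<^sup>2 * Im z
      \<le> (cmod (z / of_real Y - \<i>))\<^sup>2 * (Im (h z) * q Y)" if "Im z > 0" "Y > 0" for z Y
  proof -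
    have "(cmod (h z - h (\<i> * of_real Y)))\<^sup>2 * (Im z * Y) \<le>
       (cmod (z - \<i> * of_real Y))\<^sup>2 * (Im (h z) * Im (h (\<i> * of_real Y)))"
      using SP[of z "\<i> * of_real Y"] that by simp
    moreover have "h z / of_real Y - h (\<i> * of_real Y) / of_real Y = (h z - h (\<i> * of_real Y)) / of_real Y"
      "z / of_real Y - \<i> = (z - \<i> * of_real Y) / of_real Y"
      using that by (auto simp: field_simps)
    ultimately show ?thesis using that
      by (simp add: norm_divide power_divide q_def divide_simps power2_eq_square mult_ac)
  qed
  have zY: "((\<lambda>Y. z / of_real Y) \<longlongrightarrow> 0) at_top" for z :: complex
    by (intro tendsto_divide_0[OF tendsto_const] filterlim_of_real_at_infinity)
  have fac: "((\<lambda>Y. (cmod (z / of_real Y - \<i>))\<^sup>2 * (Im (h z) * q Y)) \<longlongrightarrow> (cmod (0 - \<i>))\<^sup>2 * (Im (h z) * b)) at_top" for z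
    by (intro tendsto_intros zY qlim)
  have imlim: "((\<lambda>Y. Im (h (\<i> * of_real Y) / of_real Y)) \<longlongrightarrow> b) at_top"
    using qlim by (simp add: q_def[abs_def])
  have bIm: "Im (h z) \<ge> b * Im z" if z: "Im z > 0" for z
  proof -
    have "((\<lambda>Y. (Im (h z / of_real Y) - Im (h (\<i> * of_real Y) / of_real Y))\<^sup>2 * Im z) \<longlongrightarrow> (0 - b)\<^sup>2 * Im z) at_top"
      by (intro tendsto_intros imlim) (use tendsto_Im[OF zY[of "h z"]] in simp)
    moreover have "\<forall>\<^sub>F Y in at_top. (Im (h z / of_real Y) - Im (h (\<i> * of_real Y) / of_real Y))\<^sup>2 * Im z
       \<le> (cmod (z / of_real Y - \<i>))\<^sup>2 * (Im (h z) * q Y)"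
      using eventually_gt_at_top[of 0]
    proof eventually_elim
      case (elim Y)
      have "(Im (h z / of_real Y) - Im (h (\<i> * of_real Y) / of_real Y))\<^sup>2 
        \<le> (cmod (h z / of_real Y - h (\<i> * of_real Y) / of_real Y))\<^sup>2"
        unfolding cmod_power2 by simp
      then show ?case using key[OF z elim] z by (smt (verit) mult_right_mono)
    qed
    ultimately have "(0 - b)\<^sup>2 * Im z \<le> (cmod (0 - \<i>))\<^sup>2 * (Im (h z) * b)"
      using fac by (intro tendsto_le[OF _ fac]) auto
    then have "b * (b * Im z) \<le> b * Im (h z)" by (simp add: power2_eq_square algebra_simps)
    then show ?thesis using b0 im[OF z] by (cases "b = 0") auto
  qed
  \<comment> \<open>In \<open>key\<close> with \<open>z = \<i> * y\<close>, the right side tends to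
    \<open>b * q y * y\<close>, and the imaginary parts alone already use up
    \<open>b * b * y\<close> of it. Choosing \<open>y\<close> with \<open>q y\<close> close to
    \<open>b\<close> leaves less than \<open>e^2 / 2 * y\<close> for the real parts.\<close>
  have relim: "((\<lambda>Y. Re (h (\<i> * of_real Y) / of_real Y)) \<longlongrightarrow> 0) at_top"
  proof (rule tendstoI)
    fix e :: real assume e: "e > 0"
    have "((\<lambda>y. b * q y) \<longlongrightarrow> b * b) at_top" by (intro tendsto_intros qlim)
    then have "\<forall>\<^sub>F y in at_top. b * q y < b * b + e\<^sup>2 / 2"
      using e by (intro order_tendstoD) auto
    then have "\<forall>\<^sub>F y in at_top. b * q y < b * b + e\<^sup>2 / 2 \<and> y > 0"
      using eventually_gt_at_top[of 0] by eventually_elim auto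
    then obtain y where y: "y > 0" "b * q y < b * b + e\<^sup>2 / 2"
      by (auto simp: eventually_at_top_linorder)
    define z where "z = \<i> * of_real y"
    have z: "Im z > 0" "Im z = y" using y by (auto simp: z_def)
    define H where "H Y = h (\<i> * of_real Y) / of_real Y" for Y :: real
    have "((\<lambda>Y. (cmod (z / of_real Y - \<i>))\<^sup>2 * (Im (h z) * q Y) - (Im (h z / of_real Y) - Im (H Y))\<^sup>2 * Im z)
       \<longlongrightarrow> (cmod (0 - \<i>))\<^sup>2 * (Im (h z) * b) - (0 - b)\<^sup>2 * Im z) at_top"
      unfolding H_def
      by (intro tendsto_diff[OF fac] tendsto_intros imlim) (use tendsto_Im[OF zY[of "h z"]] in simp)
    moreover have "(cmod (0 - \<i>))\<^sup>2 * (Im (h z) * b) - (0 - b)\<^sup>2 * Im z < e\<^sup>2 / 2 * Im z"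
    proof -
      have "Im (h z) = q y * y" using y by (simp add: q_def z_def)
      moreover have "b * q y * y < (b * b + e\<^sup>2 / 2) * y" using y by (intro mult_strict_right_mono) auto
      ultimately show ?thesis using z by (simp add: power2_eq_square algebra_simps)
    qed
    ultimately have "\<forall>\<^sub>F Y in at_top. (cmod (z / of_real Y - \<i>))\<^sup>2 * (Im (h z) * q Y) - (Im (h z / of_real Y) - Im (H Y))\<^sup>2 * Im z < e\<^sup>2 / 2 * Im z"
      by (rule order_tendstoD)
    moreover have "((\<lambda>Y. Re (h z / of_real Y)) \<longlongrightarrow> 0) at_top"
      using tendsto_Re[OF zY[of "h z"]] by simp
    then have "\<forall>\<^sub>F Y in at_top. \<bar>Re (h z / of_real Y)\<bar> < e / 4"
      using e by (auto dest!: tendstoD[where e = "e/4"] simp: dist_real_def)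
    ultimately show "\<forall>\<^sub>F Y in at_top. dist (Re (h (\<i> * of_real Y) / of_real Y)) 0 < e"
      using eventually_gt_at_top[of 0]
    proof eventually_elim
      case (elim Y)
      have "(Re (h z / of_real Y) - Re (H Y))\<^sup>2 * Im z + (Im (h z / of_real Y) - Im (H Y))\<^sup>2 * Im z
         = (cmod (h z / of_real Y - H Y))\<^sup>2 * Im z"
        unfolding cmod_power2 by (simp add: algebra_simps)
      also have "\<dots> \<le> (cmod (z / of_real Y - \<i>))\<^sup>2 * (Im (h z) * q Y)"
        unfolding H_def by (rule key[OF z(1) elim(3)])
      finally have "(Re (h z / of_real Y) - Re (H Y))\<^sup>2 * Im z < e\<^sup>2 / 2 * Im z" using elim by linarith
      then have "(Re (h z / of_real Y) - Re (H Y))\<^sup>2 < e\<^sup>2 / 2" using z by simp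
      also have "\<dots> \<le> (3 / 4 * e)\<^sup>2" using e by (simp add: power2_eq_square)
      finally have "\<bar>Re (h z / of_real Y) - Re (H Y)\<bar> < 3 / 4 * e"
        using e by (metis abs_of_nonneg less_eq_real_def mult_nonneg_nonneg power2_abs power2_less_imp_less zero_le_divide_iff zero_le_numeral)
      then show ?case using elim(2) unfolding H_def dist_real_def by linarith
    qed
  qed
  have "((\<lambda>Y. Complex (Re (h (\<i> * of_real Y) / of_real Y)) (Im (h (\<i> * of_real Y) / of_real Y))) \<longlongrightarrow> Complex 0 b) at_top"
    by (intro tendsto_Complex relim imlim)
  then have "((\<lambda>Y. h (\<i> * of_real Y) / of_real Y) \<longlongrightarrow> Complex 0 b) at_top"
    unfolding complex_surj .
  from tendsto_divide[OF this tendsto_const[of \<i>]]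
  have "((\<lambda>Y. h (\<i> * of_real Y) / of_real Y / \<i>) \<longlongrightarrow> Complex 0 b / \<i>) at_top" by simp
  moreover have "Complex 0 b / \<i> = of_real b" by (simp add: complex_eq_iff)
  moreover have "h (\<i> * of_real Y) / of_real Y / \<i> = h (\<i> * of_real Y) / (\<i> * of_real Y)" for Y
    by (simp only: divide_divide_eq_left mult.commute)
  ultimately have "((\<lambda>y. h (\<i> * of_real y) / (\<i> * of_real y)) \<longlongrightarrow> of_real b) at_top"
    by simp
  with b0 bIm show ?thesis using that by blast
qed

section \<open>Linear coefficients of Herglotz--Nevanlinna functions\<close>

lemma set_comp_nth [simp]: "set_comp z j u $ k = (if k = j then u else z $ k)"
  by (simp add: set_comp_def)

lemma set_comp_same [simp]: "set_comp z j (z $ j) = z" for z :: "complex ^ 'n"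
  by (simp add: vec_eq_iff)

lemma set_comp_upper: "z \<in> upper_poly \<Longrightarrow> Im u > 0 \<Longrightarrow> set_comp z j u \<in> upper_poly"
  by (simp add: upper_poly_def)

lemma mv_holomorphic_on_component:
  assumes f: "mv_holomorphic_on f S" and T: "open T" and sub: "\<And>u. u \<in> T \<Longrightarrow> set_comp z j u \<in> S"
  shows "(\<lambda>u. f (set_comp z j u)) holomorphic_on T"
  unfolding holomorphic_on_open[OF T]
proof
  fix u assume u: "u \<in> T"
  from f sub[OF u] obtain D where D: "(f has_derivative D) (at (set_comp z j u))"
    and lin: "\<And>c v. D (c *s v) = c * D v"
    unfolding mv_holomorphic_on_def by blast
  define c where "c = set_comp z j 0"
  have eq: "set_comp z j v = c + v *s axis j 1" for v
    by (simp add: vec_eq_iff axis_def c_def)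
  have "bounded_linear (\<lambda>v::complex. v *s (axis j 1 :: complex^'a))"
    by (intro linear_conv_bounded_linear[THEN iffD1] linearI) (auto simp: vec_eq_iff algebra_simps)
  then have "((\<lambda>v. set_comp z j v) has_derivative (\<lambda>v. v *s axis j 1)) (at u)"
    unfolding eq by (auto intro!: derivative_eq_intros bounded_linear_imp_has_derivative)
  from has_derivative_compose[OF this D]
  have "((\<lambda>v. f (set_comp z j v)) has_derivative (\<lambda>v. v * D (axis j 1))) (at u)"
    by (simp add: lin)
  then show "\<exists>f'. ((\<lambda>u. f (set_comp z j u)) has_field_derivative f') (at u)"
    unfolding has_field_derivative_def mult.commute[of _ "D (axis j 1)"] by blast
qed

lemma mv_holomorphic_on_component_upper:
  assumes "mv_holomorphic_on f upper_poly" "z \<in> upper_poly"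
  shows "(\<lambda>u. f (set_comp z j u)) holomorphic_on {u. Im u > 0}"
  using assms by (intro mv_holomorphic_on_component[OF assms(1)] open_halfspace_Im_gt set_comp_upper) auto

lemma mv_holomorphic_on_imp_continuous_on: "mv_holomorphic_on f S \<Longrightarrow> continuous_on S f"
  unfolding mv_holomorphic_on_def
  by (blast intro: continuous_at_imp_continuous_on has_derivative_continuous)

lemma mv_holomorphic_on_diff_linear:
  fixes f :: "complex ^ 'n \<Rightarrow> complex"
  assumes "mv_holomorphic_on f S"
  shows "mv_holomorphic_on (\<lambda>z. f z - (\<Sum>j\<in>J. c j * z $ j)) S"
  unfolding mv_holomorphic_on_def
proof
  fix z assume "z \<in> S"
  then obtain D where D: "(f has_derivative D) (at z)" and lin: "\<And>c v. D (c *s v) = c * D v"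
    using assms unfolding mv_holomorphic_on_def by blast
  have "((\<lambda>z. f z - (\<Sum>j\<in>J. c j * z $ j)) has_derivative (\<lambda>v. D v - (\<Sum>j\<in>J. c j * v $ j))) (at z)"
    by (intro has_derivative_diff D has_derivative_sum has_derivative_mult_right
        bounded_linear_imp_has_derivative bounded_linear_vec_nth)
  then show "\<exists>D. ((\<lambda>z. f z - (\<Sum>j\<in>J. c j * z $ j)) has_derivative D) (at z) \<and> (\<forall>c v. D (c *s v) = c * D v)"
    by (intro exI conjI) (auto simp: lin algebra_simps sum_distrib_left)
qed

text \<open>By the open mapping theorem a non-constant \<open>f\<close> would have an image
  containing a disc around \<open>f z\<close>, and hence a non-real value.\<close>

lemma real_valued_holomorphic_constant:
  assumes "f holomorphic_on S" "open S" "connected S" "\<And>z. z \<in> S \<Longrightarrow> f z \<in> \<real>" "z \<in> S" "w \<in> S"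
  shows "f z = f w"
proof (rule ccontr)
  assume "f z \<noteq> f w"
  then have "\<not> f constant_on S" using assms(5,6) unfolding constant_on_def by metis
  then have "open (f ` S)" using open_mapping_thm[OF assms(1-3,2) order.refl] by blast
  then obtain e where e: "e > 0" "ball (f z) e \<subseteq> f ` S" using \<open>z \<in> S\<close> by (meson imageI openE)
  have "f z + \<i> * of_real (e/2) \<in> ball (f z) e" using e by (simp add: dist_norm norm_mult)
  then have "f z + \<i> * of_real (e/2) \<in> \<real>" using e assms(4) by auto
  moreover have "f z \<in> \<real>" using assms by auto
  ultimately show False using e by (auto simp: complex_is_Real_iff)
qed

lemma connected_upper: "connected {u. Im u > 0}"
  by (intro convex_connected convex_halfspace_Im_gt)

text \<open>The limit is sampled along a sequence because Montel's theorem will be applied to these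
  quotients as functions of another variable; \<open>Suc m\<close> avoids the height zero.\<close>

definition lin_coeff :: "(complex ^ 'n \<Rightarrow> complex) \<Rightarrow> 'n \<Rightarrow> complex ^ 'n \<Rightarrow> complex" where
  "lin_coeff h j z = lim (\<lambda>m. h (set_comp z j (\<i> * of_nat (Suc m))) / (\<i> * of_nat (Suc m)))"

lemma herglotz_lin_coeff:
  fixes h :: "complex ^ 'n \<Rightarrow> complex"
  assumes h: "herglotz_nevanlinna h" and z: "z \<in> upper_poly"
  obtains b :: real where "b \<ge> 0" "lin_coeff h j z = of_real b"
    "((\<lambda>y. h (set_comp z j (\<i> * of_real y)) / (\<i> * of_real y)) \<longlongrightarrow> of_real b) at_top"
    "Im (h z) \<ge> b * Im (z $ j)"
proof -
  have "(\<lambda>u. h (set_comp z j u)) holomorphic_on {u. Im u > 0}"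
    using h z by (intro mv_holomorphic_on_component_upper) (auto simp: herglotz_nevanlinna_def)
  moreover have "Im u > 0 \<Longrightarrow> Im (h (set_comp z j u)) \<ge> 0" for u
    using h set_comp_upper[OF z] by (auto simp: herglotz_nevanlinna_def)
  ultimately obtain b where b: "b \<ge> 0" 
    "((\<lambda>y. h (set_comp z j (\<i> * of_real y)) / (\<i> * of_real y)) \<longlongrightarrow> of_real b) at_top"
    "\<And>u. Im u > 0 \<Longrightarrow> Im (h (set_comp z j u)) \<ge> b * Im u"
    using half_plane_linear_growth by blast
  have "filterlim (\<lambda>m. real (Suc m)) at_top sequentially"
    by (intro filterlim_compose[OF filterlim_real_sequentially filterlim_Suc])
  from filterlim_compose[OF b(2) this] 
  have "lin_coeff h j z = of_real b" unfolding lin_coeff_def by (intro limI) simp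
  moreover have "Im (h z) \<ge> b * Im (z $ j)" using b(3)[of "z $ j"] z by (simp add: upper_poly_def)
  ultimately show ?thesis using b that by blast
qed

text \<open>The coefficient is a limit of holomorphic functions of \<open>z $ k\<close> and is real, hence constant; passing to
  \<open>1 / (g + \<i>)\<close> makes the family bounded, so that Montel's theorem applies.\<close>

lemma lin_coeff_set_comp:
  fixes h :: "complex ^ 'n \<Rightarrow> complex"
  assumes h: "herglotz_nevanlinna h" and z: "z \<in> upper_poly" and kj: "k \<noteq> j" and u: "Im u > 0"
  shows "lin_coeff h j (set_comp z k u) = lin_coeff h j z"
proof -
  define Y where "Y m = \<i> * of_nat (Suc m)" for m
  \<comment> \<open>Dividing by the height alone, without the factor \<open>\<i>\<close>, keeps the
    imaginary part nonnegative; the limit is therefore \<open>\<i> * L v\<close>.\<close>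
  define g where "g m v = h (set_comp (set_comp z k v) j (Y m)) / of_nat (Suc m)" for m v
  have Yim: "Im (Y m) > 0" for m by (simp add: Y_def)
  have gim: "Im (g m v) \<ge> 0" if "Im v > 0" for m v
  proof -
    have "set_comp (set_comp z k v) j (Y m) \<in> upper_poly" by (intro set_comp_upper z that Yim)
    then show ?thesis using h unfolding g_def herglotz_nevanlinna_def by (simp del: of_nat_Suc)
  qed
  have comm: "set_comp (set_comp z k v) j (Y m) = set_comp (set_comp z j (Y m)) k v" for v m
    using kj by (auto simp: vec_eq_iff)
  have ghol: "g m holomorphic_on {v. Im v > 0}" for m
    unfolding g_def comm using h
    by (intro holomorphic_on_divide[OF mv_holomorphic_on_component_upper holomorphic_on_const] set_comp_upper z Yim)
       (auto simp: herglotz_nevanlinna_def simp del: of_nat_Suc)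
  have ne: "g m v + \<i> \<noteq> 0" if "Im v > 0" for m v using gim[OF that, of m] by (auto simp: complex_eq_iff)
  define p where "p m v = 1 / (g m v + \<i>)" for m v
  have phol: "p m holomorphic_on {v. Im v > 0}" for m
    unfolding p_def by (intro holomorphic_intros ghol) (use ne in auto)
  have pb: "cmod (p m v) \<le> 1" if "Im v > 0" for m v
  proof -
    have "1 \<le> Im (g m v + \<i>)" using gim[OF that] by simp
    also have "\<dots> \<le> cmod (g m v + \<i>)" using abs_Im_le_cmod by (metis abs_le_D1)
    finally show ?thesis by (simp add: p_def norm_divide divide_simps)
  qed
  define L where "L v = lin_coeff h j (set_comp z k v)" for v
  have plim: "(\<lambda>m. p m v) \<longlonglongrightarrow> 1 / (\<i> * L v + \<i>)" and Lr: "L v \<in> \<real>" "Re (L v) \<ge> 0" if v: "Im v > 0" for v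
  proof -
    obtain b where b: "b \<ge> 0" "L v = of_real b"
      "((\<lambda>y. h (set_comp (set_comp z k v) j (\<i> * of_real y)) / (\<i> * of_real y)) \<longlongrightarrow> of_real b) at_top"
      using herglotz_lin_coeff[OF h set_comp_upper[OF z v], of j k] unfolding L_def by metis
    show "L v \<in> \<real>" "Re (L v) \<ge> 0" using b by auto
    have "filterlim (\<lambda>m. real (Suc m)) at_top sequentially"
      by (intro filterlim_compose[OF filterlim_real_sequentially filterlim_Suc])
    from filterlim_compose[OF b(3) this] 
    have "(\<lambda>m. \<i> * (h (set_comp (set_comp z k v) j (Y m)) / Y m)) \<longlonglongrightarrow> \<i> * of_real b"
      by (intro tendsto_intros) (simp add: Y_def)
    moreover have "\<i> * (h (set_comp (set_comp z k v) j (Y m)) / Y m) = g m v" for m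
      by (simp add: Y_def g_def del: of_nat_Suc)
    ultimately have glim: "(\<lambda>m. g m v) \<longlonglongrightarrow> \<i> * L v" unfolding b(2) by simp
    show "(\<lambda>m. p m v) \<longlonglongrightarrow> 1 / (\<i> * L v + \<i>)"
      unfolding p_def by (intro tendsto_intros glim) (use b in \<open>auto simp: complex_eq_iff\<close>)
  qed
  have "\<exists>B. \<forall>f\<in>range p. \<forall>v\<in>K. cmod (f v) \<le> B" if "K \<subseteq> {v. Im v > 0}" for K
    using pb that by (intro exI[of _ 1]) auto
  note bd = this
  have "\<exists>q r. q holomorphic_on {v. Im v > 0} \<and> strict_mono (r :: nat \<Rightarrow> nat) \<and>
      (\<forall>v\<in>{v. Im v > 0}. (\<lambda>m. p (r m) v) \<longlonglongrightarrow> q v)"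
  proof (rule Montel[OF open_halfspace_Im_gt[of 0], of "range p" p])
    fix q r assume "q holomorphic_on {v. Im v > 0}" "strict_mono (r :: nat \<Rightarrow> nat)"
      and "\<And>v. v \<in> {v. Im v > 0} \<Longrightarrow> (\<lambda>m. p (r m) v) \<longlonglongrightarrow> q v"
    then show ?thesis by (intro exI[of _ q] exI[of _ r]) simp
  qed (use phol bd in auto)
  then obtain q and r :: "nat \<Rightarrow> nat" where q: "q holomorphic_on {v. Im v > 0}" and r: "strict_mono r"
    and qlim: "\<And>v. Im v > 0 \<Longrightarrow> (\<lambda>m. p (r m) v) \<longlonglongrightarrow> q v"
    by auto
  have qv: "q v = 1 / (\<i> * L v + \<i>)" if "Im v > 0" for v
    using LIMSEQ_unique[OF qlim[OF that]] LIMSEQ_subseq_LIMSEQ[OF plim[OF that] r] by (simp add: o_def)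
  \<comment> \<open>The factor \<open>\<i>\<close> turns the limit into
    \<open>1 / (L v + 1)\<close>, which is real and well defined because \<open>L v\<close> is real
    and nonnegative.\<close>
  have "\<i> * q u = \<i> * q (z $ k)"
  proof (rule real_valued_holomorphic_constant[of "\<lambda>v. \<i> * q v", OF _ open_halfspace_Im_gt connected_upper])
    show "(\<lambda>v. \<i> * q v) holomorphic_on {v. Im v > 0}" by (intro holomorphic_intros q)
    fix v assume "v \<in> {v. Im v > 0}"
    then have v: "Im v > 0" by simp
    have "\<i> * L v + \<i> = \<i> * (L v + 1)" by (simp add: algebra_simps)
    then have "\<i> * q v = 1 / (L v + 1)" unfolding qv[OF v] by simp
    then show "\<i> * q v \<in> \<real>" using Lr[OF v] by simp
  qed (use u z in \<open>auto simp: upper_poly_def\<close>)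
  moreover have "Im (z $ k) > 0" using z by (simp add: upper_poly_def)
  ultimately have "\<i> * L u + \<i> = \<i> * L (z $ k) + \<i>" using qv u by simp
  then show ?thesis by (simp add: L_def)
qed

text \<open>The components of \<open>z\<close> are exchanged for those of \<open>w\<close> one at a
  time. Exchanging the \<open>j\<close>-th one has no effect, since \<open>lin_coeff\<close>
  overwrites it.\<close>

lemma lin_coeff_const:
  fixes h :: "complex ^ 'n \<Rightarrow> complex"
  assumes h: "herglotz_nevanlinna h" and z: "z \<in> upper_poly" and w: "w \<in> upper_poly"
  shows "lin_coeff h j z = lin_coeff h j w"
proof -
  have "lin_coeff h j (\<chi> k. if k \<in> J then w $ k else z $ k) = lin_coeff h j z" for J :: "'n set"
  proof (induction J rule: finite_induct[OF finite])
    case 1 then show ?case by simp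
  next
    case (2 k J)
    define v where "v = (\<chi> k. if k \<in> J then w $ k else z $ k)"
    have v: "v \<in> upper_poly" using z w by (simp add: v_def upper_poly_def)
    have eq: "(\<chi> l. if l \<in> insert k J then w $ l else z $ l) = set_comp v k (w $ k)"
      by (auto simp: vec_eq_iff v_def)
    have "lin_coeff h j (set_comp v k (w $ k)) = lin_coeff h j v"
    proof (cases "k = j")
      case True
      have "set_comp (set_comp v j a) j b = set_comp v j b" for a b by (simp add: vec_eq_iff)
      then show ?thesis using True by (simp add: lin_coeff_def)
    next
      case False
      then show ?thesis using w by (intro lin_coeff_set_comp[OF h v]) (auto simp: upper_poly_def)
    qed
    then show ?case using 2 eq by (simp add: v_def)
  qed
  from this[of UNIV] show ?thesis by simp
qed

text \<open>Julia-Wolff bounds \<open>Im (h z)\<close> below by a single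
  \<open>b $ j * Im (z $ j)\<close>, not by the sum over all \<open>j\<close>. So the linear terms
  are removed one by one, the inequality being applied afresh to what is left.\<close>

lemma herglotz_subtract_linear:
  fixes h :: "complex ^ 'n \<Rightarrow> complex"
  assumes h: "herglotz_nevanlinna h"
  obtains b :: "real ^ 'n" where "\<And>j. b $ j \<ge> 0"
    "herglotz_nevanlinna (\<lambda>z. h z - (\<Sum>j\<in>UNIV. of_real (b $ j) * z $ j))"
    "\<And>j z. z \<in> upper_poly \<Longrightarrow>
      ((\<lambda>y. (h (set_comp z j (\<i> * of_real y)) - (\<Sum>k\<in>UNIV. of_real (b $ k) * set_comp z j (\<i> * of_real y) $ k))
        / (\<i> * of_real y)) \<longlongrightarrow> 0) at_top"
proof -
  define one :: "complex ^ 'n" where "one = (\<chi> j. \<i>)"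
  have one: "one \<in> upper_poly" by (simp add: one_def upper_poly_def)
  define b where "b = (\<chi> j. Re (lin_coeff h j one))"
  have b: "b $ j \<ge> 0" 
    "((\<lambda>y. h (set_comp z j (\<i> * of_real y)) / (\<i> * of_real y)) \<longlongrightarrow> of_real (b $ j)) at_top"
    if "z \<in> upper_poly" for z j
    using herglotz_lin_coeff[OF h that, of j] lin_coeff_const[OF h that one, of j] unfolding b_def
    by (metis Re_complex_of_real vec_lambda_beta)+
  have sumlim: "((\<lambda>y. (\<Sum>k\<in>J. of_real (b $ k) * set_comp z j (\<i> * of_real y) $ k) / (\<i> * of_real y)) \<longlongrightarrow>
      (if j \<in> J then of_real (b $ j) else 0)) at_top" for J z j
  proof -
    have "((\<lambda>y. of_real (b $ k) * set_comp z j (\<i> * of_real y) $ k / (\<i> * of_real y)) \<longlongrightarrow>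
      (if k = j then of_real (b $ j) else 0)) at_top" for k
    proof (cases "k = j")
      case True
      have "\<forall>\<^sub>F y in at_top. of_real (b $ k) * set_comp z j (\<i> * of_real y) $ k / (\<i> * of_real y) = of_real (b $ j)"
        using eventually_gt_at_top[of 0] by eventually_elim (use True in simp)
      then show ?thesis using True by (simp add: tendsto_eventually)
    next
      case False
      have "((\<lambda>y. of_real (b $ k) * z $ k / \<i> / of_real y) \<longlongrightarrow> 0) at_top"
        by (intro tendsto_divide_0[OF tendsto_const] filterlim_of_real_at_infinity)
      moreover have "of_real (b $ k) * z $ k / \<i> / of_real y = of_real (b $ k) * z $ k / (\<i> * of_real y)" for y
        by (simp only: divide_divide_eq_left)
      ultimately show ?thesis using False by simp
    qed
    then have "((\<lambda>y. \<Sum>k\<in>J. of_real (b $ k) * set_comp z j (\<i> * of_real y) $ k / (\<i> * of_real y)) \<longlongrightarrow>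
      (\<Sum>k\<in>J. if k = j then of_real (b $ j) else 0)) at_top"
      by (intro tendsto_sum)
    then show ?thesis by (simp add: sum_divide_distrib)
  qed
  have HN: "herglotz_nevanlinna (\<lambda>z. h z - (\<Sum>j\<in>J. of_real (b $ j) * z $ j))" for J :: "'n set"
  proof (induction J rule: finite_induct[OF finite])
    case 1 then show ?case using h by simp
  next
    case (2 j J)
    define hJ where "hJ z = h z - (\<Sum>j\<in>J. of_real (b $ j) * z $ j)" for z
    have hJ: "herglotz_nevanlinna hJ" using 2 by (simp add: hJ_def[abs_def])
    have "Im (hJ z) \<ge> b $ j * Im (z $ j)" if z: "z \<in> upper_poly" for z
    proof -
      obtain c :: real where c: "((\<lambda>y. hJ (set_comp z j (\<i> * of_real y)) / (\<i> * of_real y)) \<longlongrightarrow> of_real c) at_top"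
        "Im (hJ z) \<ge> c * Im (z $ j)"
        using herglotz_lin_coeff[OF hJ z, of j] by metis
      \<comment> \<open>The terms removed so far have indices different from \<open>j\<close> and do
        not affect growth in the \<open>j\<close>-th variable, so the coefficient of
        \<open>hJ\<close> is still \<open>b $ j\<close>.\<close>
      have "((\<lambda>y. hJ (set_comp z j (\<i> * of_real y)) / (\<i> * of_real y)) \<longlongrightarrow> of_real (b $ j) - 0) at_top"
        unfolding hJ_def diff_divide_distrib using sumlim[where J = J and j = j and z = z] 2
        by (intro tendsto_diff b z) auto
      from tendsto_unique[OF _ this c(1)] have "c = b $ j" by simp
      then show ?thesis using c by simp
    qed
    then have "Im (hJ z - of_real (b $ j) * z $ j) \<ge> 0" if "z \<in> upper_poly" for z
      using that by simp
    moreover have "hJ z - of_real (b $ j) * z $ j = h z - (\<Sum>j\<in>insert j J. of_real (b $ j) * z $ j)" for z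
      using 2 by (simp add: hJ_def algebra_simps)
    ultimately show ?case using h mv_holomorphic_on_diff_linear[of h upper_poly _ "insert j J"]
      unfolding herglotz_nevanlinna_def by simp
  qed
  show ?thesis
  proof (rule that[of b])
    show "((\<lambda>y. (h (set_comp z j (\<i> * of_real y)) - (\<Sum>k\<in>UNIV. of_real (b $ k) * set_comp z j (\<i> * of_real y) $ k))
        / (\<i> * of_real y)) \<longlongrightarrow> 0) at_top" if "z \<in> upper_poly" for j z
      unfolding diff_divide_distrib using tendsto_diff[OF b(2)[OF that, of j] sumlim[of z j UNIV]] by simp
  qed (use b one HN in auto)
qed

section \<open>Cauchy formulas on the real line\<close>

lemma integrable_inverse_square: "integrable lborel (\<lambda>t::real. 1 / (1 + t\<^sup>2))"
  using integrable_inverse_1_plus_square by (simp add: set_integrable_def inverse_eq_divide)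

lemma integral_inverse_square: "(\<integral>t. 1 / (1 + t\<^sup>2) \<partial>lborel) = pi"
  using LBINT_inverse_1_plus_square
  by (simp add: interval_lebesgue_integral_def set_lebesgue_integral_def inverse_eq_divide)

lemma has_bochner_integral_poisson:
  assumes "y > 0"
  shows "has_bochner_integral lborel (\<lambda>t. y / ((t - x)\<^sup>2 + y\<^sup>2)) pi"
proof -
  have "has_bochner_integral lborel (\<lambda>t::real. 1 / (1 + t\<^sup>2)) pi"
    using integrable_inverse_square integral_inverse_square by (simp add: has_bochner_integral_iff)
  then have "has_bochner_integral lborel (\<lambda>t. 1 / (1 + (-x/y + (1/y) * t)\<^sup>2)) (pi /\<^sub>R \<bar>1/y\<bar>)"
    using assms by (intro lborel_has_bochner_integral_real_affine_iff[THEN iffD1]) auto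
  then have "has_bochner_integral lborel (\<lambda>t. (1/y) * (1 / (1 + (-x/y + (1/y) * t)\<^sup>2))) ((1/y) * (pi /\<^sub>R \<bar>1/y\<bar>))"
    by (intro has_bochner_integral_mult_right) auto
  moreover have "(1/y) * (1 / (1 + (-x/y + (1/y) * t)\<^sup>2)) = y / ((t - x)\<^sup>2 + y\<^sup>2)" for t
  proof -
    have "-x/y + (1/y) * t = (t - x) / y" by (simp add: diff_divide_distrib)
    then have "(1/y) * (1 / (1 + (-x/y + (1/y) * t)\<^sup>2)) = (1/y) * (1 / (1 + (t-x)\<^sup>2/y\<^sup>2))"
      by (simp add: power_divide)
    also have "\<dots> = y / ((t - x)\<^sup>2 + y\<^sup>2)"
    proof -
      have "1 + (t-x)\<^sup>2/y\<^sup>2 = ((t - x)\<^sup>2 + y\<^sup>2) / y\<^sup>2" using assms by (simp add: field_simps)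
      then show ?thesis using assms by (simp add: power2_eq_square)
    qed
    finally show ?thesis .
  qed
  ultimately show ?thesis using assms by simp
qed

text \<open>A primitive on the convex half-plane makes the integral over \<open>[-R, R]\<close>
  depend on its endpoints only. Computed along the upper semicircle instead, it is at most
  \<open>C * pi / R\<close>. The strip below the real line places the segment in the open
  domain.\<close>

lemma has_bochner_integral_line_zero:
  fixes H :: "complex \<Rightarrow> complex"
  assumes e: "e > 0" and hol: "H holomorphic_on {z. Im z > -e}" and rad: "rad \<ge> 1"
    and bound: "\<And>z. Im z \<ge> 0 \<Longrightarrow> cmod z \<ge> rad \<Longrightarrow> cmod (H z) \<le> C / (cmod z)\<^sup>2"
  shows "has_bochner_integral lborel (\<lambda>t. H (of_real t)) 0"
proof -
  have C: "C \<ge> 0" using bound[of "of_real rad"] rad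
    by (smt (verit, best) Im_complex_of_real divide_neg_pos norm_ge_zero norm_of_real zero_less_power)
  have cont: "continuous_on UNIV (\<lambda>t. H (of_real t))"
    by (intro continuous_on_compose2[OF holomorphic_on_imp_continuous_on[OF hol]] continuous_intros)
       (use e in auto)
  then have meas: "(\<lambda>t. H (of_real t)) \<in> borel_measurable lborel"
    using borel_measurable_continuous_onI by auto
  have "compact ((\<lambda>t. H (of_real t)) ` {-rad..rad})"
    by (intro compact_continuous_image continuous_on_subset[OF cont]) auto
  then obtain M where "\<forall>t\<in>{-rad..rad}. cmod (H (of_real t)) \<le> M"
    by (auto simp: bounded_iff dest!: compact_imp_bounded)
  then have M: "cmod (H (of_real t)) \<le> M" if "\<bar>t\<bar> \<le> rad" for t
    using that by (simp add: abs_le_iff)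
  have M0: "M \<ge> 0" using M[of 0] rad by (smt (verit) norm_ge_zero)
  \<comment> \<open>Continuity supplies \<open>M\<close> near the origin. Outside,
    \<open>rad \<ge> 1\<close> gives \<open>1 + t^2 \<le> 2 * t^2\<close>, whence the summand
    \<open>2 * C\<close>.\<close>
  have b2: "cmod (H (of_real t)) \<le> (M * (1 + rad\<^sup>2) + 2 * C) * (1 / (1 + t\<^sup>2))" for t
  proof (cases "\<bar>t\<bar> \<le> rad")
    case True
    then have "t\<^sup>2 \<le> rad\<^sup>2" by (metis rad abs_ge_zero power2_abs power_mono)
    then have "M * (1 + t\<^sup>2) \<le> M * (1 + rad\<^sup>2)" using M0 by (intro mult_left_mono) auto
    then have "cmod (H (of_real t)) * (1 + t\<^sup>2) \<le> M * (1 + rad\<^sup>2) + 2 * C"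
      using mult_right_mono[OF M[OF True], of "1 + t\<^sup>2"] C by simp
    then show ?thesis by (simp add: pos_le_divide_eq add_pos_nonneg)
  next
    case False
    then have t1: "t\<^sup>2 \<ge> 1" using rad 
      by (metis abs_ge_zero abs_one le_less_trans less_eq_real_def linorder_not_le one_le_power power2_abs)
    have "cmod (H (of_real t)) \<le> C / t\<^sup>2" using bound[of "of_real t"] False by simp
    also have "\<dots> \<le> 2 * C / (1 + t\<^sup>2)"
    proof -
      have "C * (1 + t\<^sup>2) \<le> C * (2 * t\<^sup>2)" using t1 C by (intro mult_left_mono) auto
      then show ?thesis using t1 C by (auto simp: divide_simps algebra_simps)
    qed
    also have "\<dots> \<le> (M * (1 + rad\<^sup>2) + 2 * C) / (1 + t\<^sup>2)"
      using M0 by (intro divide_right_mono) auto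
    finally show ?thesis by simp
  qed
  have dom: "integrable lborel (\<lambda>t. (M * (1 + rad\<^sup>2) + 2 * C) * (1 / (1 + t\<^sup>2)))"
    by (intro integrable_mult_right integrable_inverse_square)
  have int: "integrable lborel (\<lambda>t. H (of_real t))"
    by (rule Bochner_Integration.integrable_bound[OF dom meas]) (auto intro!: AE_I2 order.trans[OF b2] divide_right_mono)
  have half: "convex {z. Im z > -e}" "open {z. Im z > -e}"
    by (auto simp: convex_halfspace_Im_gt open_halfspace_Im_gt)
  have "\<exists>\<Phi>. \<forall>z\<in>{z. Im z > -e}. (\<Phi> has_field_derivative H z) (at z within {z. Im z > -e})"
    by (rule holomorphic_convex_primitive'[OF half hol]) (intro exI ballI)
  then obtain \<Phi> where \<Phi>: "\<And>z. z \<in> {z. Im z > -e} \<Longrightarrow> (\<Phi> has_field_derivative H z) (at z within {z. Im z > -e})"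
    by auto
  have \<Phi>': "(\<Phi> has_field_derivative H z) (at z)" if "Im z > -e" for z
    using \<Phi>[of z] that at_within_open[OF _ half(2), of z] by simp
  have val: "(\<integral>t. indicator {-R..R} t *\<^sub>R H (of_real t) \<partial>lborel) = \<Phi> (of_real R) - \<Phi> (of_real (-R))"
    if "R \<ge> 0" for R :: real
  proof (rule integral_FTC_Icc)
    show "((\<lambda>t. \<Phi> (of_real t)) has_vector_derivative H (of_real x)) (at x within {-R..R})" for x
    proof -
      have "(\<Phi> has_field_derivative H (of_real x)) (at (of_real x))" using e by (intro \<Phi>') auto
      then show ?thesis by (rule has_vector_derivative_real_field)
    qed
  qed (use that cont in \<open>auto intro: continuous_on_subset\<close>)
  have arc: "cmod (\<Phi> (of_real R) - \<Phi> (of_real (-R))) \<le> C * pi / R" if R: "R \<ge> rad" for R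
  proof -
    have im: "Im x \<ge> 0" "cmod x = R" if "x \<in> path_image (part_circlepath 0 R 0 pi)" for x
      using that R rad unfolding path_image_part_circlepath[OF pi_ge_zero]
      by (auto simp: Im_exp norm_mult sin_ge_zero)
    have "(H has_contour_integral (\<Phi> (pathfinish (part_circlepath 0 R 0 pi)) - \<Phi> (pathstart (part_circlepath 0 R 0 pi))))
      (part_circlepath 0 R 0 pi)"
      by (rule contour_integral_primitive[of "{z. Im z > -e}"]) (use \<Phi> im e in force)+
    then have "cmod (\<Phi> (pathfinish (part_circlepath 0 R 0 pi)) - \<Phi> (pathstart (part_circlepath 0 R 0 pi)))
      \<le> C / R\<^sup>2 * R * (pi - 0)"
      by (rule has_contour_integral_bound_part_circlepath) (use bound im R rad C in force)+
    then show ?thesis using R rad by (simp add: norm_minus_commute power2_eq_square)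
  qed
  have "(\<lambda>n. \<integral>t. indicator {-real n..real n} t *\<^sub>R H (of_real t) \<partial>lborel) \<longlonglongrightarrow> (\<integral>t. H (of_real t) \<partial>lborel)"
  proof (rule integral_dominated_convergence[where w = "\<lambda>t. cmod (H (of_real t))"])
    show "AE t in lborel. (\<lambda>n. indicator {-real n..real n} t *\<^sub>R H (of_real t)) \<longlonglongrightarrow> H (of_real t)"
    proof (intro AE_I2 tendsto_eventually)
      fix t :: real
      show "\<forall>\<^sub>F n in sequentially. indicator {-real n..real n} t *\<^sub>R H (of_real t) = H (of_real t)"
        using eventually_ge_at_top[of "nat \<lceil>\<bar>t\<bar>\<rceil>"] by eventually_elim (auto simp: indicator_def)
    qed
  qed (use int meas in \<open>auto simp: indicator_def\<close>)
  moreover have "(\<lambda>n. \<integral>t. indicator {-real n..real n} t *\<^sub>R H (of_real t) \<partial>lborel) \<longlonglongrightarrow> 0"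
  proof (rule Lim_null_comparison)
    show "\<forall>\<^sub>F n in sequentially. cmod (\<integral>t. indicator {-real n..real n} t *\<^sub>R H (of_real t) \<partial>lborel) \<le> C * pi / real n"
      using eventually_ge_at_top[of "nat \<lceil>rad\<rceil>"]
      by eventually_elim (subst val, simp, rule arc, linarith)
    show "(\<lambda>n. C * pi / real n) \<longlonglongrightarrow> 0" by real_asymp
  qed
  ultimately have "(\<integral>t. H (of_real t) \<partial>lborel) = 0" using LIMSEQ_unique by blast
  then show ?thesis using int by (simp add: has_bochner_integral_iff)
qed

definition bounded_hol_above :: "real \<Rightarrow> (complex \<Rightarrow> complex) \<Rightarrow> bool" where
  "bounded_hol_above e g \<longleftrightarrow> g holomorphic_on {z. Im z > -e} \<and> bounded (g ` {z. Im z > -e})"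

lemma norm_diff_ge_half:
  fixes z w :: complex
  assumes "cmod z \<ge> 2 * cmod w" shows "cmod (z - w) \<ge> cmod z / 2"
  using assms norm_triangle_ineq2[of z w] by linarith

text \<open>Both poles lie below the line, so the integrand is holomorphic on and above it once the
  strip is narrowed to \<open>e'\<close>. Taking the difference of two resolvents provides the
  quadratic decay.\<close>

lemma cauchy_lower_lower:
  assumes e: "e > 0" and g: "bounded_hol_above e g" and w1: "Im w1 < 0" and w2: "Im w2 < 0"
  shows "has_bochner_integral lborel (\<lambda>t. g (of_real t) * (1 / (of_real t - w1) - 1 / (of_real t - w2))) 0"
proof -
  obtain B where B: "\<And>z. Im z > -e \<Longrightarrow> cmod (g z) \<le> B"
    using g by (auto simp: bounded_hol_above_def bounded_iff)
  have B0: "B \<ge> 0" using B[of 0] e by (smt (verit) norm_ge_zero zero_complex.simps)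
  define e' where "e' = Min {e, - Im w1, -Im w2}"
  have e': "e' > 0" "e' \<le> e" "e' \<le> -Im w1" "e' \<le> - Im w2" using e w1 w2 by (auto simp: e'_def)
  define H where "H z = g z * (1 / (z - w1) - 1 / (z - w2))" for z
  have gh: "g holomorphic_on {z. Im z > -e'}" 
    using g e' by (auto simp: bounded_hol_above_def elim!: holomorphic_on_subset)
  have "has_bochner_integral lborel (\<lambda>t. H (of_real t)) 0"
  \<comment> \<open>Beyond this radius \<open>norm_diff_ge_half\<close> makes each denominator at
    least \<open>cmod z / 2\<close>, which produces the factor \<open>4\<close>.\<close>
  proof (rule has_bochner_integral_line_zero[OF e'(1), where rad = "1 + 2 * cmod w1 + 2 * cmod w2" and C = "4 * B * cmod (w1 - w2)"])
    show "H holomorphic_on {z. - e' < Im z}"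
      unfolding H_def by (intro holomorphic_intros gh) (use e' in auto)
    fix z assume z: "Im z \<ge> 0" "1 + 2 * cmod w1 + 2 * cmod w2 \<le> cmod z"
    have n: "cmod (z - w1) \<ge> cmod z / 2" "cmod (z - w2) \<ge> cmod z / 2" "cmod z > 0"
      using z(2) norm_ge_zero[of w1] norm_ge_zero[of w2]
        norm_diff_ge_half[of w1 z] norm_diff_ge_half[of w2 z] by linarith+
    then have ne: "z - w1 \<noteq> 0" "z - w2 \<noteq> 0" by auto
    have "cmod (H z) = cmod (g z) * cmod (w1 - w2) / (cmod (z - w1) * cmod (z - w2))"
      using ne unfolding H_def by (simp add: norm_mult norm_divide diff_frac_eq norm_minus_commute)
    also have "\<dots> \<le> B * cmod (w1 - w2) / (cmod z / 2 * (cmod z / 2))"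
      using n z e B0 B[of z] by (intro frac_le mult_mono mult_right_mono mult_nonneg_nonneg) auto
    also have "\<dots> = 4 * B * cmod (w1 - w2) / (cmod z)\<^sup>2" by (simp add: power2_eq_square)
    finally show "cmod (H z) \<le> 4 * B * cmod (w1 - w2) / (cmod z)\<^sup>2" .
  qed auto
  then show ?thesis by (simp add: H_def)
qed

text \<open>Split \<open>g u\<close> into \<open>g u - g z\<close> and the constant
  \<open>g z\<close>. The first part cancels the pole at \<open>z\<close> and integrates to
  \<open>0\<close>, as in the case of lower poles; the second leaves the integral of the kernel
  itself.\<close>

lemma cauchy_upper_lower:
  assumes e: "e > 0" and g: "bounded_hol_above e g" and w: "Im w < 0" and z: "Im z > 0"
  shows "has_bochner_integral lborel (\<lambda>t. g (of_real t) * (1 / (of_real t - z) - 1 / (of_real t - w)))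
    (2 * of_real pi * \<i> * g z)"
proof -
  obtain B where B: "\<And>z. Im z > -e \<Longrightarrow> cmod (g z) \<le> B"
    using g by (auto simp: bounded_hol_above_def bounded_iff)
  have B0: "B \<ge> 0" using B[of 0] e by (smt (verit) norm_ge_zero zero_complex.simps)
  define e' where "e' = min e (-Im w)"
  have e': "e' > 0" "e' \<le> e" "e' \<le> -Im w" using e w by (auto simp: e'_def)
  have gh: "g holomorphic_on {z. Im z > -e'}" 
    using g e' by (auto simp: bounded_hol_above_def elim!: holomorphic_on_subset)
  define Q where "Q u = (if u = z then deriv g z else (g u - g z) / (u - z))" for u
  have Qh: "Q holomorphic_on {z. Im z > -e'}"
    unfolding Q_def by (intro pole_lemma_open gh open_halfspace_Im_gt)
  define H where "H u = Q u * ((z - w) / (u - w))" for u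
  have 1: "has_bochner_integral lborel (\<lambda>t. H (of_real t)) 0"
  proof (rule has_bochner_integral_line_zero[OF e'(1), where rad = "1 + 2 * cmod z + 2 * cmod w" and C = "8 * B * cmod (z - w)"])
    show "H holomorphic_on {z. - e' < Im z}"
      unfolding H_def by (intro holomorphic_intros Qh) (use e' in auto)
    fix u assume u: "Im u \<ge> 0" "1 + 2 * cmod z + 2 * cmod w \<le> cmod u"
    have n: "cmod (u - z) \<ge> cmod u / 2" "cmod (u - w) \<ge> cmod u / 2" "cmod u > 0"
      using u(2) norm_ge_zero[of w] norm_ge_zero[of z]
        norm_diff_ge_half[of w u] norm_diff_ge_half[of z u] by linarith+
    then have ne: "u \<noteq> z" "u - w \<noteq> 0" by auto
    have "cmod (g u - g z) \<le> 2 * B" using B[of u] B[of z] u z e norm_triangle_ineq4[of "g u" "g z"] by simp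
    then have "cmod (g u - g z) * cmod (z - w) / (cmod (u - z) * cmod (u - w)) \<le> 2 * B * cmod (z - w) / (cmod u / 2 * (cmod u / 2))"
      using n B0 by (intro frac_le mult_mono mult_right_mono mult_nonneg_nonneg) auto
    moreover have "cmod (H u) = cmod (g u - g z) * cmod (z - w) / (cmod (u - z) * cmod (u - w))"
      using ne unfolding H_def Q_def by (simp add: norm_mult norm_divide)
    ultimately show "cmod (H u) \<le> 8 * B * cmod (z - w) / (cmod u)\<^sup>2" by (simp add: power2_eq_square)
  qed auto
  have one: "bounded_hol_above e (\<lambda>_. 1)" by (auto simp: bounded_hol_above_def bounded_iff)
  \<comment> \<open>The integral of the kernel is split at the pole \<open>cnj z\<close>: from
    \<open>cnj z\<close> to \<open>w\<close> both poles are lower, and from \<open>z\<close> to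
    \<open>cnj z\<close> the difference is a Poisson kernel times \<open>2 * \<i>\<close>.\<close>
  have 2: "has_bochner_integral lborel (\<lambda>t. 1 / (of_real t - cnj z) - 1 / (of_real t - w)) 0"
    using cauchy_lower_lower[OF e one, of "cnj z" w] z w by simp
  have "has_bochner_integral lborel (\<lambda>t. 2 * \<i> * of_real (Im z / ((t - Re z)\<^sup>2 + (Im z)\<^sup>2))) (2 * \<i> * of_real pi)"
    by (intro has_bochner_integral_mult_right has_bochner_integral_of_real has_bochner_integral_poisson z)
  moreover have "2 * \<i> * of_real (Im z / ((t - Re z)\<^sup>2 + (Im z)\<^sup>2)) = 1 / (of_real t - z) - 1 / (of_real t - cnj z)" for t
  proof -
    have ne: "of_real t - z \<noteq> 0" "of_real t - cnj z \<noteq> 0" using z by (auto simp: complex_eq_iff)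
    then have "1 / (of_real t - z) - 1 / (of_real t - cnj z) = (z - cnj z) / ((of_real t - z) * (of_real t - cnj z))"
      by (simp add: diff_frac_eq)
    also have "(of_real t - z) * (of_real t - cnj z) = of_real ((t - Re z)\<^sup>2 + (Im z)\<^sup>2)"
      by (auto simp: complex_eq_iff power2_eq_square algebra_simps)
    also have "z - cnj z = 2 * \<i> * of_real (Im z)" by (auto simp: complex_eq_iff)
    finally show ?thesis by simp
  qed
  ultimately have 3: "has_bochner_integral lborel (\<lambda>t. 1 / (of_real t - z) - 1 / (of_real t - cnj z)) (2 * \<i> * of_real pi)"
    by simp
  have "has_bochner_integral lborel (\<lambda>t. H (of_real t) + g z * ((1 / (of_real t - z) - 1 / (of_real t - cnj z)) +
       (1 / (of_real t - cnj z) - 1 / (of_real t - w)))) (0 + g z * (2 * \<i> * of_real pi + 0))"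
    by (intro has_bochner_integral_add has_bochner_integral_mult_right 1 2 3)
  moreover have "H (of_real t) + g z * ((1 / (of_real t - z) - 1 / (of_real t - cnj z)) +
       (1 / (of_real t - cnj z) - 1 / (of_real t - w))) = g (of_real t) * (1 / (of_real t - z) - 1 / (of_real t - w))" for t
  proof -
    have ne: "of_real t \<noteq> z" "of_real t - z \<noteq> 0" "of_real t - w \<noteq> 0" using z w by (auto simp: complex_eq_iff)
    have "(1 / (of_real t - z) - 1 / (of_real t - w)) = (z - w) / ((of_real t - z) * (of_real t - w))"
      using ne by (simp add: diff_frac_eq)
    moreover have "H (of_real t) = (g (of_real t) - g z) * ((z - w) / ((of_real t - z) * (of_real t - w)))"
      using ne by (simp add: H_def Q_def)
    moreover have "(1 / (of_real t - z) - 1 / (of_real t - cnj z)) + (1 / (of_real t - cnj z) - 1 / (of_real t - w))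
        = 1 / (of_real t - z) - 1 / (of_real t - w)"
      by simp
    moreover have "(a - b) * k + b * k = a * k" for a b k :: complex by (simp add: algebra_simps)
    ultimately show ?thesis by metis
  qed
  ultimately show ?thesis by (simp add: mult_ac)
qed

section \<open>Iterated Cauchy integrals in several variables\<close>

lemma borel_measurable_vec_lambda:
  fixes f :: "'a \<Rightarrow> 'n::finite \<Rightarrow> 'b::euclidean_space"
  assumes "\<And>i. (\<lambda>x. f x i) \<in> borel_measurable M"
  shows "(\<lambda>x. \<chi> i. f x i) \<in> borel_measurable M"
proof -
  have "(\<lambda>x. \<chi> i. f x i) = (\<lambda>x. \<Sum>i\<in>UNIV. axis i (f x i))"
    by (auto simp: vec_eq_iff axis_def)
  moreover have "continuous_on UNIV (\<lambda>y::'b. axis i y :: 'b ^ 'n)" for i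
    unfolding axis_def
  proof (intro continuous_on_vec_lambda)
    show "continuous_on UNIV (\<lambda>y::'b. if l = i then y else 0)" for l
      by (cases "l = i") auto
  qed
  then have "(\<lambda>x. axis i (f x i) :: 'b ^ 'n) \<in> borel_measurable M" for i
    by (rule borel_measurable_continuous_on[OF _ assms])
  ultimately show ?thesis by simp
qed

definition halfs :: "real \<Rightarrow> (complex ^ 'n) set" where
  "halfs e = {z. \<forall>j. Im (z $ j) > -e}"

lemma open_halfs: "open (halfs e :: (complex ^ 'n) set)"
proof -
  have "(halfs e :: (complex ^ 'n) set) = (\<Inter>j. {z. Im (z $ j) > -e})" by (auto simp: halfs_def)
  moreover have "open {z :: complex ^ 'n. Im (z $ j) > -e}" for j
    by (intro open_Collect_less continuous_intros)
  ultimately show ?thesis by (simp add: open_INT)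
qed

text \<open>Kernels of the Cauchy type: for \<open>c = 0\<close> the integral vanishes and the point \<open>w\<close> is irrelevant.\<close>

definition reproduces :: "(real \<Rightarrow> complex) \<Rightarrow> complex \<Rightarrow> complex \<Rightarrow> bool" where
  "reproduces K c w \<longleftrightarrow> Im w > 0 \<and> (\<forall>e g. e > 0 \<longrightarrow> bounded_hol_above e g \<longrightarrow>
     has_bochner_integral lborel (\<lambda>t. g (of_real t) * K t) (c * g w))"

lemma reproduces_integrable: "reproduces K c w \<Longrightarrow> integrable lborel K"
  unfolding reproduces_def
  by (drule conjunct2, drule spec[of _ 1], drule spec[of _ "\<lambda>_. 1"])
     (auto simp: bounded_hol_above_def bounded_iff has_bochner_integral_iff)

lemma reproduces_cauchy:
  assumes "Im z > 0" "Im w < 0"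
  shows "reproduces (\<lambda>t. 1 / (of_real t - z) - 1 / (of_real t - w)) (2 * of_real pi * \<i>) z"
  unfolding reproduces_def using assms cauchy_upper_lower by blast

lemma reproduces_zero:
  assumes "Im v < 0" "Im w < 0"
  shows "reproduces (\<lambda>t. 1 / (of_real t - v) - 1 / (of_real t - w)) 0 \<i>"
  unfolding reproduces_def using assms cauchy_lower_lower by simp

lemma reproduces_scale:
  assumes "reproduces K c w" shows "reproduces (\<lambda>t. a * K t) (a * c) w"
  unfolding reproduces_def
proof (intro conjI allI impI)
  fix e g assume "e > (0::real)" "bounded_hol_above e g"
  then have "has_bochner_integral lborel (\<lambda>t. a * (g (of_real t) * K t)) (a * (c * g w))"
    using assms unfolding reproduces_def by (intro has_bochner_integral_mult_right) auto
  then show "has_bochner_integral lborel (\<lambda>t. g (of_real t) * (a * K t)) (a * c * g w)"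
    by (simp add: mult_ac)
qed (use assms in \<open>auto simp: reproduces_def\<close>)

lemma poisson_kernel_eq:
  assumes "r > 0"
  shows "1 / (2 * \<i>) * (1 / (of_real t - \<i> * of_real r) - 1 / (of_real t + \<i> * of_real r)) = of_real (r / (t\<^sup>2 + r\<^sup>2))"
proof -
  have ne: "of_real t - \<i> * of_real r \<noteq> 0" "of_real t + \<i> * of_real r \<noteq> 0"
    using assms by (auto simp: complex_eq_iff)
  have "(of_real t - \<i> * of_real r) * (of_real t + \<i> * of_real r) = of_real (t\<^sup>2 + r\<^sup>2)"
    by (simp add: algebra_simps power2_eq_square)
  moreover have "1 / (of_real t - \<i> * of_real r) - 1 / (of_real t + \<i> * of_real r)
    = 2 * \<i> * of_real r / ((of_real t - \<i> * of_real r) * (of_real t + \<i> * of_real r))"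
    using ne by (simp add: diff_frac_eq)
  ultimately show ?thesis by simp
qed

lemma reproduces_poisson:
  assumes "r > 0"
  shows "reproduces (\<lambda>t. of_real (r / (t\<^sup>2 + r\<^sup>2))) (of_real pi) (\<i> * of_real r)"
proof -
  have "reproduces (\<lambda>t. 1 / (2 * \<i>) * (1 / (of_real t - \<i> * of_real r) - 1 / (of_real t - - (\<i> * of_real r))))
     (1 / (2 * \<i>) * (2 * of_real pi * \<i>)) (\<i> * of_real r)"
    using assms by (intro reproduces_scale reproduces_cauchy) auto
  moreover have "1 / (2 * \<i>) * (2 * of_real pi * \<i>) = of_real pi" by (simp add: field_simps)
  ultimately show ?thesis unfolding diff_minus_eq_add poisson_kernel_eq[OF assms] by simp
qed

text \<open>The state of an iterated integration: coordinates in \<open>I\<close> are replaced by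
  those of \<open>x\<close>, while the others remain complex parameters.\<close>

definition mix :: "'n set \<Rightarrow> ('n \<Rightarrow> complex) \<Rightarrow> complex ^ 'n \<Rightarrow> complex ^ 'n" where
  "mix I x z = (\<chi> i. if i \<in> I then x i else z $ i)"

lemma mix_halfs: "z \<in> halfs e \<Longrightarrow> (\<And>i. i \<in> I \<Longrightarrow> Im (x i) > -e) \<Longrightarrow> mix I x z \<in> halfs e"
  by (simp add: halfs_def mix_def)

lemma integrable_product_kernel:
  fixes G :: "complex ^ 'n \<Rightarrow> complex"
  assumes e: "e > 0" and G: "mv_holomorphic_on G (halfs e)" "bounded (G ` halfs e)"
    and K: "\<And>i. integrable lborel (K i)" and z: "z \<in> halfs e"
  shows "integrable (PiM I (\<lambda>_. lborel)) (\<lambda>x. G (mix I (\<lambda>i. of_real (x i)) z) * (\<Prod>i\<in>I. K i (x i)))"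
proof -
  interpret product_sigma_finite "\<lambda>_::'n. lborel :: real measure" ..
  have int: "integrable (PiM I (\<lambda>_. lborel)) (\<lambda>x. \<Prod>i\<in>I. K i (x i))"
    by (intro product_integrable_prod K) auto
  have mixm: "(\<lambda>x. mix I (\<lambda>i. of_real (x i)) z) \<in> borel_measurable (PiM I (\<lambda>_. lborel))"
    unfolding mix_def
  proof (intro borel_measurable_vec_lambda)
    fix i show "(\<lambda>x. if i \<in> I then complex_of_real (x i) else z $ i) \<in> borel_measurable (PiM I (\<lambda>_. lborel))"
      by (cases "i \<in> I") (auto intro!: borel_measurable_of_real measurable_component_singleton)
  qed
  \<comment> \<open>\<open>G\<close> is known to be continuous only on \<open>halfs e\<close>.
    Cutting it off there gives a Borel function that agrees with \<open>G\<close> at every point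
    \<open>mix I x z\<close> with real \<open>x\<close>.\<close>
  have "(\<lambda>u. indicator (halfs e) u *\<^sub>R G u) \<in> borel_measurable borel"
    by (intro borel_measurable_continuous_on_indicator mv_holomorphic_on_imp_continuous_on[OF G(1)] borel_open open_halfs)
  from measurable_compose[OF mixm this]
  have Gm: "(\<lambda>x. G (mix I (\<lambda>i. of_real (x i)) z)) \<in> borel_measurable (PiM I (\<lambda>_. lborel))"
    using mix_halfs[OF z, of I] e by (simp add: indicator_def)
  obtain B where B: "\<And>u. u \<in> halfs e \<Longrightarrow> cmod (G u) \<le> B"
    using G(2) by (auto simp: bounded_iff)
  show ?thesis
  proof (rule Bochner_Integration.integrable_bound)
    show "integrable (PiM I (\<lambda>_. lborel)) (\<lambda>x. B * norm (\<Prod>i\<in>I. K i (x i)))"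
      by (intro integrable_mult_right integrable_norm int)
    show "AE x in PiM I (\<lambda>_. lborel). norm (G (mix I (\<lambda>i. of_real (x i)) z) * (\<Prod>i\<in>I. K i (x i)))
      \<le> norm (B * norm (\<Prod>i\<in>I. K i (x i)))"
    proof (rule AE_I2)
      fix x :: "'n \<Rightarrow> real"
      have "cmod (G (mix I (\<lambda>i. of_real (x i)) z)) \<le> B" using e by (intro B mix_halfs z) auto
      then show "norm (G (mix I (\<lambda>i. of_real (x i)) z) * (\<Prod>i\<in>I. K i (x i))) \<le> norm (B * norm (\<Prod>i\<in>I. K i (x i)))"
        unfolding norm_mult by (intro mult_mono) auto
    qed
  qed (intro borel_measurable_times Gm borel_measurable_integrable[OF int])
qed

text \<open>Fubini makes the \<open>k\<close>-th integral the innermost one, where \<open>G\<close>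
  is a bounded holomorphic function of one variable. Only \<open>K k\<close> has to reproduce; the
  other kernels are merely integrable, so that mixed products can be treated too.\<close>

lemma integral_product_kernel_insert:
  fixes G :: "complex ^ 'n \<Rightarrow> complex"
  assumes e: "e > 0" and G: "mv_holomorphic_on G (halfs e)" "bounded (G ` halfs e)"
    and K: "\<And>i. integrable lborel (K i)" and z: "z \<in> halfs e" and k: "k \<notin> I" "reproduces (K k) c w"
  shows "(\<integral>x. G (mix (insert k I) (\<lambda>i. of_real (x i)) z) * (\<Prod>i\<in>insert k I. K i (x i)) \<partial>PiM (insert k I) (\<lambda>_. lborel))
    = c * (\<integral>x. G (mix I (\<lambda>i. of_real (x i)) (set_comp z k w)) * (\<Prod>i\<in>I. K i (x i)) \<partial>PiM I (\<lambda>_. lborel))"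
proof -
  interpret product_sigma_finite "\<lambda>_::'n. lborel :: real measure" ..
  have "(\<integral>y. G (mix (insert k I) (\<lambda>i. of_real ((x(k := y)) i)) z) * (\<Prod>i\<in>insert k I. K i ((x(k := y)) i)) \<partial>lborel)
    = c * (G (mix I (\<lambda>i. of_real (x i)) (set_comp z k w)) * (\<Prod>i\<in>I. K i (x i)))" for x :: "'n \<Rightarrow> real"
  proof -
    define v where "v = mix I (\<lambda>i. of_real (x i)) z"
    have v: "v \<in> halfs e" unfolding v_def using e by (intro mix_halfs z) auto
    have sub: "set_comp v k u \<in> halfs e" if "Im u > -e" for u using v that by (simp add: halfs_def)
    have "bounded_hol_above e (\<lambda>u. G (set_comp v k u))"
      unfolding bounded_hol_above_def
      by (intro conjI mv_holomorphic_on_component[OF G(1)] open_halfspace_Im_gt sub bounded_subset[OF G(2)])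
         (auto intro: sub)
    then have "has_bochner_integral lborel (\<lambda>y. G (set_comp v k (of_real y)) * K k y) (c * G (set_comp v k w))"
      using k(2) e unfolding reproduces_def by blast
    then have "has_bochner_integral lborel (\<lambda>y. G (set_comp v k (of_real y)) * K k y * (\<Prod>i\<in>I. K i (x i)))
       (c * G (set_comp v k w) * (\<Prod>i\<in>I. K i (x i)))"
      by (intro has_bochner_integral_mult_left)
    moreover have "set_comp v k w = mix I (\<lambda>i. of_real (x i)) (set_comp z k w)"
      using k by (auto simp: v_def mix_def vec_eq_iff)
    moreover have "mix (insert k I) (\<lambda>i. of_real ((x(k := y)) i)) z = set_comp v k (of_real y)" for y
      using k by (auto simp: v_def mix_def vec_eq_iff)
    moreover have "(\<Prod>i\<in>insert k I. K i ((x(k := y)) i)) = K k y * (\<Prod>i\<in>I. K i (x i))" for y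
    proof -
      have "(\<Prod>i\<in>I. K i ((x(k := y)) i)) = (\<Prod>i\<in>I. K i (x i))" using k by (intro prod.cong) auto
      then show ?thesis using k by simp
    qed
    ultimately show ?thesis by (simp add: has_bochner_integral_iff mult.assoc)
  qed
  then show ?thesis
    using k by (subst product_integral_insert[OF _ _ integrable_product_kernel[OF e G K z]]) auto
qed

lemma integral_product_kernel:
  fixes G :: "complex ^ 'n \<Rightarrow> complex"
  assumes e: "e > 0" and G: "mv_holomorphic_on G (halfs e)" "bounded (G ` halfs e)"
    and K: "\<And>i. reproduces (K i) (c i) (w i)" and z: "z \<in> halfs e"
  shows "(\<integral>x. G (mix I (\<lambda>i. of_real (x i)) z) * (\<Prod>i\<in>I. K i (x i)) \<partial>PiM I (\<lambda>_. lborel))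
    = (\<Prod>i\<in>I. c i) * G (mix I w z)"
  using finite[of I] z
\<comment> \<open>Every integrated coordinate leaves its evaluation point \<open>w k\<close> behind
  in \<open>z\<close>, so the claim is needed for all \<open>z\<close>.\<close>
proof (induction I arbitrary: z rule: finite_induct)
  case empty
  have "mix {} x z = z" for x by (simp add: mix_def)
  then show ?case by (simp add: lebesgue_integral_count_space_finite PiM_empty)
next
  case (insert k I)
  have w: "set_comp z k (w k) \<in> halfs e"
    using insert.prems K[of k] e by (auto simp: halfs_def reproduces_def)
  have "mix I w (set_comp z k (w k)) = mix (insert k I) w z"
    using insert.hyps by (auto simp: mix_def vec_eq_iff)
  then show ?case
    using insert.IH[OF w] insert.hyps
      integral_product_kernel_insert[where K = K, OF e G reproduces_integrable[OF K] insert.prems insert.hyps(2) K]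
    by simp
qed

section \<open>Weak compactness\<close>

text \<open>The cosine makes the function continuous and 2-periodic. Since
  \<open>cos (pi / 3) = 1/2\<close> and \<open>cos (2 * pi / 3) = -1/2\<close>, clamping gives
  \<open>0\<close> on \<open>[0, 1/3]\<close> and \<open>1\<close> on \<open>[2/3, 1]\<close>, the
  intervals that recognise a leading ternary digit \<open>0\<close> or \<open>2\<close>.\<close>

definition tooth :: "real \<Rightarrow> real" where
  "tooth t = min 1 (max 0 (1/2 - cos (pi * t)))"

lemma continuous_tooth: "continuous_on A tooth"
  unfolding tooth_def[abs_def] by (intro continuous_intros)

lemma tooth_bounds: "0 \<le> tooth t" "tooth t \<le> 1"
  by (auto simp: tooth_def)

lemma tooth_periodic: "tooth (t + 2 * of_int m) = tooth t"
proof -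
  have "cos (pi * (t + 2 * of_int m)) = cos (pi * t + 2 * pi * of_int m)"
    by (simp add: algebra_simps)
  also have "\<dots> = cos (pi * t)"
    by (simp only: cos_add cos_int_2pin sin_int_2pin)
  finally show ?thesis by (simp add: tooth_def)
qed

lemma tooth_low: "0 \<le> t \<Longrightarrow> t \<le> 1/3 \<Longrightarrow> tooth t = 0"
  using cos_monotone_0_pi_le[of "pi * t" "pi / 3"] by (simp add: tooth_def cos_60 field_simps)

lemma tooth_high: "2/3 \<le> t \<Longrightarrow> t \<le> 1 \<Longrightarrow> tooth t = 1"
  using cos_monotone_0_pi_le[of "2 * pi / 3" "pi * t"] cos_120 by (simp add: tooth_def field_simps)

text \<open>Schoenberg's space-filling curve: at points with ternary digits in \<open>{0, 2}\<close> the summands are binary digits.\<close>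

definition schoenberg :: "nat \<Rightarrow> nat \<Rightarrow> real \<Rightarrow> real" where
  "schoenberg N j t = (\<Sum>k. (1/2) ^ Suc k * tooth (3 ^ (N * k + j) * t))"

lemma continuous_schoenberg: "continuous_on UNIV (schoenberg N j)"
proof (rule uniform_limit_theorem)
  show "uniform_limit UNIV (\<lambda>n t. \<Sum>k<n. (1/2) ^ Suc k * tooth (3 ^ (N * k + j) * t)) (schoenberg N j) sequentially"
    unfolding schoenberg_def[abs_def]
    by (rule Weierstrass_m_test[where M = "\<lambda>k. (1/2) ^ Suc k"])
       (use tooth_bounds power_half_series in \<open>auto simp: sums_iff abs_mult mult_left_le\<close>)
  show "\<forall>\<^sub>F n in sequentially. continuous_on UNIV (\<lambda>t. \<Sum>k<n. (1/2) ^ Suc k * tooth (3 ^ (N * k + j) * t))"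
    by (intro always_eventually allI continuous_intros continuous_on_compose2[OF continuous_tooth[of UNIV]]) auto
qed auto

lemma schoenberg_periodic: "schoenberg N j (t + 2 * of_nat m) = schoenberg N j t"
proof -
  have "tooth (3 ^ l * (t + 2 * of_nat m)) = tooth (3 ^ l * t)" for l :: nat
    using tooth_periodic[of "3 ^ l * t" "3 ^ l * int m"] by (simp add: algebra_simps)
  then show ?thesis by (simp add: schoenberg_def)
qed

lemma binary_digits:
  fixes y :: real assumes "0 \<le> y" "y \<le> 1"
  obtains a :: "nat \<Rightarrow> bool" where "(\<lambda>k. (1/2) ^ Suc k * of_bool (a k)) sums y"
proof -
  \<comment> \<open>Greedy expansion: \<open>r k\<close> is the remainder after \<open>k\<close>
    digits, rescaled by \<open>2 ^ k\<close>. It never leaves \<open>[0, 1]\<close>; for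
    \<open>y = 1\<close> all digits are 1.\<close>
  define r where "r = rec_nat y (\<lambda>_ x. 2 * x - of_bool (x \<ge> 1/2))"
  define a where "a k = (r k \<ge> 1/2)" for k
  have r0: "r 0 = y" and rS: "r (Suc k) = 2 * r k - of_bool (a k)" for k
    by (simp_all add: r_def a_def)
  have rb: "0 \<le> r k \<and> r k \<le> 1" for k
    by (induction k) (use assms in \<open>auto simp: r0 rS a_def\<close>)
  have part: "(\<Sum>k<n. (1/2) ^ Suc k * of_bool (a k)) = y - (1/2) ^ n * r n" for n
  proof (induction n)
    case (Suc n)
    show ?case unfolding sum.lessThan_Suc Suc by (simp add: rS field_simps)
  qed (simp add: r0)
  have "(\<lambda>n. (1/2) ^ n * r n) \<longlonglongrightarrow> 0"
    by (rule Lim_null_comparison[of _ "\<lambda>n. (1/2) ^ n"])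
       (use rb in \<open>auto intro!: always_eventually LIMSEQ_power_zero simp: abs_mult mult_left_le\<close>)
  from tendsto_diff[OF tendsto_const this, of y]
  have "(\<lambda>k. (1/2) ^ Suc k * of_bool (a k)) sums y" unfolding sums_def part by simp
  then show ?thesis by (rule that)
qed

text \<open>Take the number with ternary digits \<open>2 * b m\<close>. Multiplication by
  \<open>3 ^ m\<close> shifts the expansion up to an even integer, because all digits are even and
  powers of 3 are integers; periodicity hides that integer, and \<open>tooth\<close> reads off the
  new leading digit.\<close>

lemma tooth_ternary:
  fixes b :: "nat \<Rightarrow> bool"
  obtains s where "0 \<le> s" "s \<le> 1" "\<And>m. tooth (3 ^ m * s) = of_bool (b m)"
proof -
  define x :: "nat \<Rightarrow> real" where "x m = (\<Sum>p. 2 * of_bool (b (m + p)) * (1/3) ^ Suc p)" for m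
  have geo: "(\<lambda>p. 2 * (1/3::real) ^ Suc p) sums 1"
    using sums_mult[OF geometric_sums[of "1/3::real"], of "2/3"] by simp
  have sm: "summable (\<lambda>p. 2 * of_bool (b (m + p)) * (1/3::real) ^ Suc p)" for m
    by (rule summable_comparison_test'[of "\<lambda>p. 2 * (1/3::real) ^ Suc p"]) (use geo in \<open>auto simp: sums_iff\<close>)
  have x0: "0 \<le> x m" for m unfolding x_def by (intro suminf_nonneg sm) auto
  have x1: "x m \<le> 1" for m
  proof -
    have "x m \<le> (\<Sum>p. 2 * (1/3::real) ^ Suc p)" unfolding x_def
      by (intro suminf_le sm) (use geo in \<open>auto simp: sums_iff\<close>)
    then show ?thesis using geo by (simp add: sums_iff)
  qed
  have rec: "x m = (2 * of_bool (b m) + x (Suc m)) / 3" for m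
  proof -
    have "x m = 2 * of_bool (b m) * (1/3) + (\<Sum>p. 2 * of_bool (b (m + Suc p)) * (1/3) ^ Suc (Suc p))"
      unfolding x_def using suminf_split_head[OF sm[of m]] by simp
    also have "(\<Sum>p. 2 * of_bool (b (m + Suc p)) * (1/3::real) ^ Suc (Suc p)) = (\<Sum>p. (1/3) * (2 * of_bool (b (Suc m + p)) * (1/3) ^ Suc p))"
      by (simp add: mult_ac)
    also have "\<dots> = (1/3) * x (Suc m)" unfolding x_def by (intro suminf_mult sm)
    finally show ?thesis by simp
  qed
  have "\<exists>i::int. 3 ^ m * x 0 = x m + 2 * of_int i" for m
  proof (induction m)
    case (Suc m)
    then obtain i :: int where i: "3 ^ m * x 0 = x m + 2 * of_int i" by blast
    have "3 ^ Suc m * x 0 = 3 * (x m + 2 * of_int i)" by (simp flip: i)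
    also have "\<dots> = x (Suc m) + 2 * of_int (of_bool (b m) + 3 * i)"
      by (subst rec) simp
    finally show ?case by blast
  qed auto
  then have "tooth (3 ^ m * x 0) = tooth (x m)" for m using tooth_periodic by metis
  moreover have "tooth (x m) = of_bool (b m)" for m
  proof (cases "b m")
    case True
    then have "2/3 \<le> x m" using rec[of m] x0[of "Suc m"] by simp
    then show ?thesis using True tooth_high x1 by simp
  next
    case False
    then have "x m \<le> 1/3" using rec[of m] x1[of "Suc m"] by simp
    then show ?thesis using False tooth_low x0 by simp
  qed
  ultimately show ?thesis using that[of "x 0"] x0 x1 by simp
qed

text \<open>The binary digits of the \<open>N\<close> coordinates are interleaved: position
  \<open>m\<close> stores digit \<open>m div N\<close> of coordinate \<open>m mod N\<close>,
  matching the exponents \<open>N * k + j\<close>.\<close>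

lemma schoenberg_surj:
  fixes y :: "nat \<Rightarrow> real"
  assumes y: "\<And>j. j < N \<Longrightarrow> 0 \<le> y j \<and> y j \<le> 1"
  obtains s where "0 \<le> s" "s \<le> 1" "\<And>j. j < N \<Longrightarrow> schoenberg N j s = y j"
proof -
  have "\<exists>a :: nat \<Rightarrow> bool. (\<lambda>k. (1/2) ^ Suc k * of_bool (a k)) sums y j" if "j < N" for j
    using binary_digits y[OF that] by metis
  then obtain a where a: "\<And>j. j < N \<Longrightarrow> (\<lambda>k. (1/2) ^ Suc k * of_bool (a j k)) sums y j"
    by metis
  obtain s where s: "0 \<le> s" "s \<le> 1" "\<And>m. tooth (3 ^ m * s) = of_bool (a (m mod N) (m div N))"
    using tooth_ternary[of "\<lambda>m. a (m mod N) (m div N)"] by blast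
  have "schoenberg N j s = y j" if "j < N" for j
    using a[OF that] that unfolding schoenberg_def s(3) by (simp add: sums_iff)
  then show ?thesis using that s by blast
qed

text \<open>The subtracted term is the distance from \<open>t\<close> to the nearest even integer.
  Hence the function stays at \<open>2 * k\<close> on \<open>[2 * k, 2 * k + 1]\<close> and climbs
  linearly to the next step in the following unit interval.\<close>

definition stairs :: "real \<Rightarrow> real" where
  "stairs t = t - arccos (cos (pi * t)) / pi"

lemma continuous_stairs: "continuous_on UNIV stairs"
  unfolding stairs_def[abs_def] by (intro continuous_intros) auto

lemma stairs_plateau:
  assumes "0 \<le> s" "s \<le> 1" shows "stairs (s + 2 * of_nat k) = 2 * of_nat k"
proof -
  have "cos (pi * (s + 2 * of_nat k)) = cos (pi * s + 2 * pi * of_int (int k))"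
    by (simp add: algebra_simps)
  also have "\<dots> = cos (pi * s)"
    by (simp only: cos_add cos_int_2pin sin_int_2pin)
  finally show ?thesis using assms by (simp add: stairs_def arccos_cos)
qed

text \<open>On the plateau starting at \<open>2 * k\<close> the scaling factor is constant, and by
  periodicity the Schoenberg coordinates repeat their values from \<open>[0, 1]\<close>, so the
  whole cube of half-width \<open>2 * k\<close> is covered. The explicit time bound later transfers
  tightness to the line.\<close>

lemma continuous_exhausting_curve:
  obtains c :: "real \<Rightarrow> real ^ 'n" where "continuous_on UNIV c"
    "\<And>k (x :: real ^ 'n). (\<And>j. \<bar>x $ j\<bar> \<le> 2 * real k) \<Longrightarrow> k \<ge> 1 \<Longrightarrow> \<exists>t\<in>{0..2 * real k + 1}. c t = x"
proof -
  define N where "N = CARD('n)"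
  obtain ix :: "'n \<Rightarrow> nat" where ix: "bij_betw ix UNIV {0..<N}"
    unfolding N_def using ex_bij_betw_finite_nat[of "UNIV :: 'n set"] by auto
  define c :: "real \<Rightarrow> real ^ 'n" where "c t = (\<chi> j. stairs t * (2 * schoenberg N (ix j) t - 1))" for t
  have "continuous_on UNIV c" unfolding c_def
    by (intro continuous_intros continuous_stairs continuous_schoenberg)
  moreover have "\<exists>t\<in>{0..2 * real k + 1}. c t = x" if x: "\<And>j. \<bar>x $ j\<bar> \<le> 2 * real k" and k: "k \<ge> 1" for k and x :: "real ^ 'n"
  proof -
    define y where "y l = (x $ (inv_into UNIV ix l) / (2 * real k) + 1) / 2" for l
    have "0 \<le> y l \<and> y l \<le> 1" for l
      using x[of "inv_into UNIV ix l"] k by (simp add: y_def divide_simps abs_le_iff)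
    then obtain s where s: "0 \<le> s" "s \<le> 1" "\<And>l. l < N \<Longrightarrow> schoenberg N l s = y l"
      using schoenberg_surj[of N y] by blast
    have "c (s + 2 * of_nat k) $ j = x $ j" for j
    proof -
      have "ix j < N" using ix by (auto simp: bij_betw_def)
      then have "schoenberg N (ix j) s = y (ix j)" by (rule s)
      moreover have "inv_into UNIV ix (ix j) = j" using ix by (simp add: bij_betw_def)
      ultimately have y_eq: "2 * schoenberg N (ix j) s - 1 = x $ j / (2 * real k)" by (simp add: y_def)
      then show ?thesis using k s stairs_plateau[of s k] schoenberg_periodic[of N "ix j" s k]
        by (simp add: c_def y_eq)
    qed
    then have "c (s + 2 * of_nat k) = x" by (simp add: vec_eq_iff)
    then show ?thesis using s by (intro bexI[of _ "s + 2 * of_nat k"]) auto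
  qed
  ultimately show ?thesis by (rule that)
qed

text \<open>The exhausting curve \<open>c\<close> has a Borel right inverse \<open>\<phi>\<close>, the first hitting time.  Transporting the measures
  to the line by \<open>\<phi>\<close> preserves tightness, so Helly's theorem applies there; the limit is pushed forward by \<open>c\<close>.\<close>

lemma tight_imp_weakly_convergent_subsequence:
  fixes X :: "nat \<Rightarrow> (real ^ 'n) measure"
  assumes X: "\<And>n. prob_space (X n)" "\<And>n. sets (X n) = sets borel"
    and tight: "\<And>e. e > 0 \<Longrightarrow> \<exists>r. \<forall>n. measure (X n) {x :: real ^ 'n. \<forall>j. \<bar>x $ j\<bar> \<le> r} > 1 - e"
  obtains s M where "strict_mono (s :: nat \<Rightarrow> nat)" "prob_space M" "sets M = sets borel"
    "\<And>g :: real ^ 'n \<Rightarrow> complex. continuous_on UNIV g \<Longrightarrow> bounded (range g) \<Longrightarrow>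
       (\<lambda>n. \<integral>x. g x \<partial>X (s n)) \<longlonglongrightarrow> (\<integral>x. g x \<partial>M)"
proof -
  obtain c :: "real \<Rightarrow> real ^ 'n" where c: "continuous_on UNIV c"
    and surj: "\<And>k (x :: real ^ 'n). (\<And>j. \<bar>x $ j\<bar> \<le> 2 * real k) \<Longrightarrow> k \<ge> 1 \<Longrightarrow> \<exists>t\<in>{0..2 * real k + 1}. c t = x"
    using continuous_exhausting_curve by metis
  define P where "P x = {0..} \<inter> c -` {x}" for x
  define \<phi> where "\<phi> x = Inf (P x)" for x
  have closedP: "closed (P x)" for x
    unfolding P_def using c by (intro closed_Int closed_vimage continuous_on_subset[OF c]) auto
  have bddP: "bdd_below (P x)" for x by (auto simp: P_def intro: bdd_belowI[of _ 0])
  have nonempty: "P x \<noteq> {}" for x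
  proof -
    define k where "k = Suc (nat \<lceil>norm x\<rceil>)"
    have "\<bar>x $ j\<bar> \<le> 2 * real k" for j
    proof -
      have "\<bar>x $ j\<bar> \<le> norm x" by (rule component_le_norm_cart)
      also have "\<dots> \<le> real k" unfolding k_def by linarith
      finally show ?thesis by simp
    qed
    from surj[OF this] show ?thesis by (auto simp: P_def k_def)
  qed
  have \<phi>P: "\<phi> x \<in> P x" for x
    unfolding \<phi>_def using closed_contains_Inf[OF nonempty bddP closedP] .
  have c\<phi>: "c (\<phi> x) = x" and \<phi>0: "\<phi> x \<ge> 0" for x using \<phi>P[of x] by (auto simp: P_def)
  have \<phi>le: "\<phi> x \<le> t" if "t \<ge> 0" "c t = x" for x t
    unfolding \<phi>_def using that by (intro cInf_lower bddP) (auto simp: P_def)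
  have "{x. \<phi> x \<le> a} \<in> sets borel" for a
  proof (cases "a \<ge> 0")
    case True
    \<comment> \<open>A point is hit by time \<open>a\<close> exactly if it lies on the initial arc,
      which is compact; this is why the first hitting time is Borel.\<close>
    have "{x. \<phi> x \<le> a} = c ` {0..a}"
    proof (intro set_eqI iffI)
      fix x assume "x \<in> {x. \<phi> x \<le> a}"
      then show "x \<in> c ` {0..a}" using c\<phi>[of x] \<phi>0[of x] by (auto intro!: image_eqI[of _ _ "\<phi> x"])
    qed (use \<phi>le in fastforce)
    also have "compact (c ` {0..a})" by (intro compact_continuous_image continuous_on_subset[OF c]) auto
    then have "c ` {0..a} \<in> sets borel" by (intro borel_closed compact_imp_closed)
    finally show ?thesis .
  next
    case False
    then have "\<not> \<phi> x \<le> a" for x using \<phi>0[of x] by linarith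
    then show ?thesis by simp
  qed
  then have \<phi>m: "\<phi> \<in> borel_measurable borel" by (simp add: borel_measurable_iff_le)
  have \<phi>mX: "\<phi> \<in> X n \<rightarrow>\<^sub>M borel" for n using \<phi>m measurable_cong_sets[OF X(2) refl] by blast
  have cm: "c \<in> borel_measurable borel" by (rule borel_measurable_continuous_onI[OF c])
  define Y where "Y n = distr (X n) borel \<phi>" for n
  have Y: "real_distribution (Y n)" for n
  proof -
    have "prob_space (Y n)" unfolding Y_def by (rule prob_space.prob_space_distr[OF X(1) \<phi>mX])
    then show ?thesis by (simp add: real_distribution_def real_distribution_axioms_def Y_def)
  qed
  have "tight Y" unfolding tight_def
  proof (intro conjI allI impI Y)
    fix e :: real assume "e > 0"
    then obtain r where r: "\<And>n. measure (X n) {x :: real ^ 'n. \<forall>j. \<bar>x $ j\<bar> \<le> r} > 1 - e" using tight by blast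
    define k where "k = Suc (nat \<lceil>r\<rceil>)"
    \<comment> \<open>Points of a box are reached by an explicit time. The left end is
      \<open>-1\<close> because the interval is half-open and the hitting time may be
      \<open>0\<close>.\<close>
    have sub: "{x :: real ^ 'n. \<forall>j. \<bar>x $ j\<bar> \<le> r} \<subseteq> \<phi> -` {-1<..2 * real k + 1}"
    proof
      fix x :: "real ^ 'n" assume "x \<in> {x :: real ^ 'n. \<forall>j. \<bar>x $ j\<bar> \<le> r}"
      then have "\<bar>x $ j\<bar> \<le> 2 * real k" for j
        by (rule CollectE) (drule spec[of _ j], simp add: k_def, linarith)
      from surj[OF this] obtain t where "t \<in> {0..2 * real k + 1}" "c t = x" by (auto simp: k_def)
      then show "x \<in> \<phi> -` {-1<..2 * real k + 1}" using \<phi>le[of t x] \<phi>0[of x] by auto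
    qed
    have "1 - e < measure (Y n) {-1<..2 * real k + 1}" for n
    proof -
      interpret prob_space "X n" by fact
      have sp: "space (X n) = UNIV" using sets_eq_imp_space_eq[OF X(2)] by simp
      have "measure (X n) {x :: real ^ 'n. \<forall>j. \<bar>x $ j\<bar> \<le> r} \<le> measure (X n) (\<phi> -` {-1<..2 * real k + 1} \<inter> space (X n))"
        using sub by (intro finite_measure_mono measurable_sets[OF \<phi>mX]) (auto simp: sp)
      then show ?thesis using r[of n] by (simp add: Y_def measure_distr[OF \<phi>mX])
    qed
    then show "\<exists>a b. a < b \<and> (\<forall>n. 1 - e < measure (Y n) {a<..b})"
      by (intro exI[of _ "-1"] exI[of _ "2 * real k + 1"]) auto
  qed
  then obtain s M where s: "strict_mono (s :: nat \<Rightarrow> nat)" and M: "real_distribution M" and wc: "weak_conv_m (Y \<circ> id \<circ> s) M"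
    using tight_imp_convergent_subsubsequence[of Y id] strict_mono_id by blast
  interpret M: real_distribution M by fact
  have cM: "c \<in> M \<rightarrow>\<^sub>M borel" using cm by simp
  show ?thesis
  proof (rule that[OF s])
    show "prob_space (distr M borel c)" by (rule M.prob_space_distr[OF cM])
    fix g :: "real ^ 'n \<Rightarrow> complex" assume g: "continuous_on UNIV g" "bounded (range g)"
    then obtain B where B: "\<And>x. norm (g x) \<le> B" by (auto simp: bounded_iff)
    have gc: "continuous_on UNIV (\<lambda>t. g (c t))" using continuous_on_compose2[OF g(1) c] by simp
    have gm: "g \<in> borel_measurable borel" by (rule borel_measurable_continuous_onI[OF g(1)])
    have "(\<lambda>n. integral\<^sup>L ((Y \<circ> id \<circ> s) n) (\<lambda>t. g (c t))) \<longlonglongrightarrow> integral\<^sup>L M (\<lambda>t. g (c t))"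
      using gc B Y M wc
      by (intro weak_conv_imp_integral_bdd_continuous_conv[where B = B]) (auto simp: continuous_on_eq_continuous_at o_def)
    \<comment> \<open>Composition with \<open>c\<close> undoes the transport by
      \<open>\<phi>\<close>, since \<open>c (\<phi> x) = x\<close>.\<close>
    moreover have "integral\<^sup>L ((Y \<circ> id \<circ> s) n) (\<lambda>t. g (c t)) = integral\<^sup>L (X (s n)) g" for n
      using measurable_compose[OF cm gm] by (simp add: Y_def integral_distr[OF \<phi>mX] c\<phi>)
    moreover have "integral\<^sup>L M (\<lambda>t. g (c t)) = integral\<^sup>L (distr M borel c) g"
      by (simp add: integral_distr[OF cM gm])
    ultimately show "(\<lambda>n. \<integral>x. g x \<partial>X (s n)) \<longlonglongrightarrow> (\<integral>x. g x \<partial>distr M borel c)" by simp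
  qed simp
qed

section \<open>Boundary measures\<close>

lemma mix_UNIV: "mix UNIV x z = (\<chi> i. x i)"
  by (simp add: mix_def)

text \<open>Lebesgue measure is taken as a product over functions, where Fubini works coordinate by
  coordinate, and moved to vectors afterwards. The Poisson weight at height 1 makes the total mass
  finite.\<close>

definition boundary_measure :: "(complex ^ 'n \<Rightarrow> complex) \<Rightarrow> (real ^ 'n) measure" where
  "boundary_measure G = distr (density (PiM UNIV (\<lambda>_. lborel))
     (\<lambda>x. ennreal (Im (G (\<chi> i. of_real (x i))) * (\<Prod>i\<in>UNIV. 1 / (1 + (x i)\<^sup>2))))) borel (\<lambda>x. \<chi> i. x i)"

lemma reproduces_poisson_1: "reproduces (\<lambda>t. of_real (1 / (1 + t\<^sup>2))) (of_real pi) \<i>"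
  using reproduces_poisson[of 1] by (simp add: add.commute)

locale bounded_herglotz =
  fixes G :: "complex ^ 'n \<Rightarrow> complex" and e :: real
  assumes e: "e > 0" and G: "mv_holomorphic_on G (halfs e)" "bounded (G ` halfs e)"
    and ImG: "\<And>z. z \<in> halfs e \<Longrightarrow> Im (G z) \<ge> 0"
begin

abbreviation "PL \<equiv> PiM (UNIV :: 'n set) (\<lambda>_. lborel :: real measure)"
abbreviation "Gr x \<equiv> G (\<chi> i. of_real (x i))"

lemma integrable_kernel:
  assumes "\<And>i. integrable lborel (K i)"
  shows "integrable PL (\<lambda>x. Gr x * (\<Prod>i\<in>UNIV. K i (x i)))"
  using integrable_product_kernel[where I = UNIV and K = K and z = 0, OF e G assms] e
  by (simp add: mix_UNIV halfs_def)

lemma integral_kernel: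
  assumes "\<And>i. reproduces (K i) (c i) (w i)"
  shows "(\<integral>x. Gr x * (\<Prod>i\<in>UNIV. K i (x i)) \<partial>PL) = (\<Prod>i\<in>UNIV. c i) * G (\<chi> i. w i)"
  using integral_product_kernel[where I = UNIV and K = K and z = 0, OF e G assms] e
  by (simp add: mix_UNIV halfs_def)

text \<open>Integrating first over the coordinate \<open>k\<close>, whose kernel annihilates, leaves
  nothing for the other coordinates.\<close>

lemma integral_kernel_zero:
  assumes "\<And>i. integrable lborel (K i)" "reproduces (K k) 0 w"
  shows "(\<integral>x. Gr x * (\<Prod>i\<in>UNIV. K i (x i)) \<partial>PL) = 0"
proof -
  have "insert k (UNIV - {k}) = UNIV" by auto
  then show ?thesis
    using integral_product_kernel_insert[where I = "UNIV - {k}" and K = K and z = 0, OF e G assms(1) _ _ assms(2)] e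
    by (simp add: mix_UNIV halfs_def)
qed

text \<open>Write \<open>Im G\<close> as \<open>(G - cnj G) / (2 * \<i>)\<close> and move the
  conjugation in the second term onto the kernels. Both integrals then involve the holomorphic
  \<open>G\<close>, so the Cauchy formulas apply.\<close>

lemma integral_Im_kernel:
  assumes K: "\<And>i. integrable lborel (K i)"
  shows "(\<integral>x. of_real (Im (Gr x)) * (\<Prod>i\<in>UNIV. K i (x i)) \<partial>PL)
    = ((\<integral>x. Gr x * (\<Prod>i\<in>UNIV. K i (x i)) \<partial>PL) - cnj (\<integral>x. Gr x * (\<Prod>i\<in>UNIV. cnj (K i (x i))) \<partial>PL)) / (2 * \<i>)"
proof -
  have Kc: "integrable lborel (\<lambda>t. cnj (K i t))" for i using K by simp
  have "(\<integral>x. of_real (Im (Gr x)) * (\<Prod>i\<in>UNIV. K i (x i)) \<partial>PL) =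
    (\<integral>x. (Gr x * (\<Prod>i\<in>UNIV. K i (x i)) - cnj (Gr x * (\<Prod>i\<in>UNIV. cnj (K i (x i))))) / (2 * \<i>) \<partial>PL)"
  proof (rule Bochner_Integration.integral_cong[OF refl])
    fix x :: "'n \<Rightarrow> real"
    have "of_real (Im u) * p = (u * p - cnj u * p) / (2 * \<i>)" for u p
      unfolding left_diff_distrib[symmetric] complex_diff_cnj by (simp add: complex_eq_iff)
    then show "of_real (Im (Gr x)) * (\<Prod>i\<in>UNIV. K i (x i)) =
      (Gr x * (\<Prod>i\<in>UNIV. K i (x i)) - cnj (Gr x * (\<Prod>i\<in>UNIV. cnj (K i (x i))))) / (2 * \<i>)"
      by simp
  qed
  also have "\<dots> = ((\<integral>x. Gr x * (\<Prod>i\<in>UNIV. K i (x i)) \<partial>PL) - (\<integral>x. cnj (Gr x * (\<Prod>i\<in>UNIV. cnj (K i (x i)))) \<partial>PL)) / (2 * \<i>)"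
    using integrable_kernel[of K, OF K] integrable_kernel[of "\<lambda>i t. cnj (K i t)", OF Kc]
    by (simp del: complex_cnj_mult)
  also have "(\<integral>x. cnj (Gr x * (\<Prod>i\<in>UNIV. cnj (K i (x i)))) \<partial>PL) = cnj (\<integral>x. Gr x * (\<Prod>i\<in>UNIV. cnj (K i (x i))) \<partial>PL)"
    by (rule Bochner_Integration.integral_cnj)
  finally show ?thesis .
qed

lemma Im_nonneg: "Im (Gr x) \<ge> 0"
  by (rule ImG) (use e in \<open>simp add: halfs_def\<close>)

abbreviation "W x \<equiv> Im (Gr x) * (\<Prod>i\<in>UNIV. 1 / (1 + (x i)\<^sup>2))"

lemma W_nonneg: "W x \<ge> 0"
  by (intro mult_nonneg_nonneg Im_nonneg prod_nonneg) auto

lemma integrable_real_kernel: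
  fixes K :: "'n \<Rightarrow> real \<Rightarrow> real"
  assumes "\<And>i. reproduces (\<lambda>t. of_real (K i t)) (of_real (c i)) (w i)"
  shows "has_bochner_integral PL (\<lambda>x. Im (Gr x) * (\<Prod>i\<in>UNIV. K i (x i))) ((\<Prod>i\<in>UNIV. c i) * Im (G (\<chi> i. w i)))"
proof -
  have "integrable PL (\<lambda>x. Gr x * (\<Prod>i\<in>UNIV. of_real (K i (x i))))"
    by (rule integrable_kernel) (rule reproduces_integrable[OF assms])
  then have "has_bochner_integral PL (\<lambda>x. Im (Gr x * (\<Prod>i\<in>UNIV. of_real (K i (x i)))))
      (Im ((\<Prod>i\<in>UNIV. of_real (c i)) * G (\<chi> i. w i)))"
    using integral_kernel[of "\<lambda>i t. of_real (K i t)", OF assms]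
    by (intro has_bochner_integral_Im) (simp add: has_bochner_integral_iff)
  then show ?thesis by (simp flip: of_real_prod add: mult.commute)
qed

lemma W_integral: "has_bochner_integral PL W (pi ^ CARD('n) * Im (G (\<chi> i. \<i>)))"
  using integrable_real_kernel[of "\<lambda>_ t. 1 / (1 + t\<^sup>2)" "\<lambda>_. pi" "\<lambda>_. \<i>", OF reproduces_poisson_1] by simp

lemma W_measurable: "W \<in> borel_measurable PL"
  by (rule borel_measurable_integrable) (use W_integral in \<open>simp add: has_bochner_integral_iff\<close>)

lemma vec_measurable: "(\<lambda>x. \<chi> i. x i) \<in> PL \<rightarrow>\<^sub>M borel"
  by (intro borel_measurable_vec_lambda measurable_component_singleton) auto

lemma sets_boundary_measure: "sets (boundary_measure G) = sets borel"
  by (simp add: boundary_measure_def)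

lemma integral_boundary_measure:
  fixes g :: "real ^ 'n \<Rightarrow> complex"
  assumes "g \<in> borel_measurable borel"
  shows "(\<integral>t. g t \<partial>boundary_measure G) = (\<integral>x. of_real (W x) * g (\<chi> i. x i) \<partial>PL)"
proof -
  have m: "(\<lambda>x. \<chi> i. x i) \<in> density PL (\<lambda>x. ennreal (W x)) \<rightarrow>\<^sub>M borel" using vec_measurable by simp
  have "(\<integral>t. g t \<partial>boundary_measure G) = (\<integral>x. g (\<chi> i. x i) \<partial>density PL (\<lambda>x. ennreal (W x)))"
    unfolding boundary_measure_def by (rule integral_distr[OF m assms])
  also have "\<dots> = (\<integral>x. W x *\<^sub>R g (\<chi> i. x i) \<partial>PL)"
    using measurable_compose[OF vec_measurable assms] W_nonneg W_measurable by (intro integral_density) auto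
  finally show ?thesis by (simp add: scaleR_conv_of_real)
qed

lemma emeasure_boundary_measure:
  assumes "A \<in> sets borel"
  shows "emeasure (boundary_measure G) A = (\<integral>\<^sup>+x. ennreal (W x) * indicator A (\<chi> i. x i) \<partial>PL)"
proof -
  have m: "(\<lambda>x. \<chi> i. x i) \<in> density PL (\<lambda>x. ennreal (W x)) \<rightarrow>\<^sub>M borel" using vec_measurable by simp
  have "emeasure (boundary_measure G) A = emeasure (density PL (\<lambda>x. ennreal (W x))) ((\<lambda>x. \<chi> i. x i) -` A \<inter> space PL)"
    unfolding boundary_measure_def using emeasure_distr[OF m assms] by simp
  also have "\<dots> = (\<integral>\<^sup>+x. ennreal (W x) * indicator ((\<lambda>x. \<chi> i. x i) -` A \<inter> space PL) x \<partial>PL)"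
    using W_measurable vec_measurable assms by (intro emeasure_density) auto
  also have "\<dots> = (\<integral>\<^sup>+x. ennreal (W x) * indicator A (\<chi> i. x i) \<partial>PL)"
    by (intro nn_integral_cong) (auto simp: indicator_def)
  finally show ?thesis .
qed

lemma emeasure_boundary_measure_space:
  "emeasure (boundary_measure G) UNIV = ennreal (pi ^ CARD('n) * Im (G (\<chi> i. \<i>)))"
  using W_integral W_nonneg
  by (subst emeasure_boundary_measure) (auto simp: has_bochner_integral_iff nn_integral_eq_integral)

lemma finite_boundary_measure: "finite_measure (boundary_measure G)"
proof (rule finite_measureI)
  have "space (boundary_measure G) = UNIV" by (simp add: boundary_measure_def)
  then show "emeasure (boundary_measure G) (space (boundary_measure G)) \<noteq> \<infinity>"
    by (simp add: emeasure_boundary_measure_space)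
qed

lemma measure_boundary_measure_space:
  "measure (boundary_measure G) UNIV = pi ^ CARD('n) * Im (G (\<chi> i. \<i>))"
  using emeasure_boundary_measure_space ImG[of "\<chi> i. \<i>"] e
  by (intro measure_eq_emeasure_eq_ennreal) (auto simp: halfs_def)

lemma integral_boundary_measure_kernel:
  fixes \<kappa> :: "'n \<Rightarrow> real \<Rightarrow> complex"
  assumes \<kappa>: "\<And>i. \<kappa> i \<in> borel_measurable borel"
  shows "(\<integral>t. (\<Prod>i\<in>UNIV. \<kappa> i (t $ i)) \<partial>boundary_measure G)
    = (\<integral>x. of_real (Im (Gr x)) * (\<Prod>i\<in>UNIV. \<kappa> i (x i) / of_real (1 + (x i)\<^sup>2)) \<partial>PL)"
proof -
  have "(\<lambda>t :: real ^ 'n. \<kappa> i (t $ i)) \<in> borel_measurable borel" for i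
    by (rule measurable_compose[OF _ \<kappa>]) (auto intro!: borel_measurable_continuous_onI continuous_intros)
  then have "(\<lambda>t :: real ^ 'n. \<Prod>i\<in>UNIV. \<kappa> i (t $ i)) \<in> borel_measurable borel" by auto
  then have "(\<integral>t. (\<Prod>i\<in>UNIV. \<kappa> i (t $ i)) \<partial>boundary_measure G) = (\<integral>x. of_real (W x) * (\<Prod>i\<in>UNIV. \<kappa> i (x i)) \<partial>PL)"
    by (subst integral_boundary_measure) auto
  moreover have "of_real (W x) * (\<Prod>i\<in>UNIV. \<kappa> i (x i)) = of_real (Im (Gr x)) * (\<Prod>i\<in>UNIV. \<kappa> i (x i) / of_real (1 + (x i)\<^sup>2))" for x
  proof -
    have "(\<Prod>i\<in>UNIV. \<kappa> i (x i) / of_real (1 + (x i)\<^sup>2)) = (\<Prod>i\<in>UNIV. of_real (1 / (1 + (x i)\<^sup>2)) * \<kappa> i (x i))"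
      by (intro prod.cong) auto
    also have "\<dots> = of_real (\<Prod>i\<in>UNIV. 1 / (1 + (x i)\<^sup>2)) * (\<Prod>i\<in>UNIV. \<kappa> i (x i))"
      by (simp only: prod.distrib of_real_prod)
    finally show ?thesis by (simp only: of_real_mult mult.assoc)
  qed
  ultimately show ?thesis by (simp only:)
qed

text \<open>Where \<open>\<bar>x j\<bar> > r\<close>, the weight \<open>1 / (1 + (x j)^2)\<close> is
  at most \<open>2 / r\<close> times the Poisson kernel of height \<open>r\<close>. Integrating that
  kernel in the \<open>j\<close>-th coordinate and the kernels of height 1 in the others evaluates
  \<open>Im G\<close> with \<open>\<i> * r\<close> in position \<open>j\<close>.\<close>

lemma tail_boundary_measure:
  assumes r: "r \<ge> 1"
  shows "measure (boundary_measure G) {t. \<bar>t $ j\<bar> > r}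
     \<le> 2 * pi ^ CARD('n) * (Im (G (set_comp (\<chi> i. \<i>) j (\<i> * of_real r))) / r)"
proof -
  define K where "K i t = (if i = j then r / (t\<^sup>2 + r\<^sup>2) else 1 / (1 + t\<^sup>2))" for i and t :: real
  define w where "w i = (if i = j then \<i> * of_real r else \<i>)" for i
  have rep: "reproduces (\<lambda>t. of_real (K i t)) (of_real pi) (w i)" for i
    using reproduces_poisson_1 reproduces_poisson[of r] r by (simp add: K_def w_def)
  have "(\<chi> i. w i) = set_comp (\<chi> i. \<i>) j (\<i> * of_real r)" by (auto simp: vec_eq_iff w_def)
  with integrable_real_kernel[of K "\<lambda>_. pi" w, OF rep]
  have I: "has_bochner_integral PL (\<lambda>x. Im (Gr x) * (\<Prod>i\<in>UNIV. K i (x i)))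
     (pi ^ CARD('n) * Im (G (set_comp (\<chi> i. \<i>) j (\<i> * of_real r))))" by simp
  have pw: "W x * indicator {t. \<bar>t $ j\<bar> > r} (\<chi> i. x i) \<le> 2 / r * (Im (Gr x) * (\<Prod>i\<in>UNIV. K i (x i)))" for x
  proof (cases "\<bar>x j\<bar> > r")
    case True
    then have sq: "r\<^sup>2 \<le> (x j)\<^sup>2" using r abs_le_square_iff[of r "x j"] by simp
    have "(x j)\<^sup>2 + r\<^sup>2 > 0" using r by (simp add: add_nonneg_pos)
    then have le: "1 / (1 + (x j)\<^sup>2) \<le> 2 / r * K j (x j)"
      using sq r by (simp add: K_def divide_simps add_pos_nonneg)
    have "W x = Im (Gr x) * (1 / (1 + (x j)\<^sup>2) * (\<Prod>i\<in>UNIV - {j}. 1 / (1 + (x i)\<^sup>2)))"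
      by (subst prod.remove[of UNIV j]) auto
    also have "(\<Prod>i\<in>UNIV - {j}. 1 / (1 + (x i)\<^sup>2)) = (\<Prod>i\<in>UNIV - {j}. K i (x i))"
      by (intro prod.cong) (auto simp: K_def)
    also have "Im (Gr x) * (1 / (1 + (x j)\<^sup>2) * (\<Prod>i\<in>UNIV - {j}. K i (x i)))
      \<le> Im (Gr x) * (2 / r * K j (x j) * (\<Prod>i\<in>UNIV - {j}. K i (x i)))"
      by (intro mult_left_mono mult_right_mono le Im_nonneg prod_nonneg) (auto simp: K_def)
    also have "\<dots> = 2 / r * (Im (Gr x) * (\<Prod>i\<in>UNIV. K i (x i)))"
      using prod.remove[of UNIV j "\<lambda>i. K i (x i)"] by simp
    finally show ?thesis using True by simp
  next
    case False
    have "0 \<le> 2 / r * (Im (Gr x) * (\<Prod>i\<in>UNIV. K i (x i)))"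
      using r by (intro mult_nonneg_nonneg Im_nonneg prod_nonneg) (auto simp: K_def)
    then show ?thesis using False by simp
  qed
  have "{t :: real ^ 'n. \<bar>t $ j\<bar> > r} \<in> sets borel"
    by (intro borel_open open_Collect_less continuous_intros)
  then have "emeasure (boundary_measure G) {t. \<bar>t $ j\<bar> > r} = (\<integral>\<^sup>+x. ennreal (W x * indicator {t. \<bar>t $ j\<bar> > r} (\<chi> i. x i)) \<partial>PL)"
    by (subst emeasure_boundary_measure) (auto intro!: nn_integral_cong simp: indicator_def)
  also have "\<dots> \<le> (\<integral>\<^sup>+x. ennreal (2 / r * (Im (Gr x) * (\<Prod>i\<in>UNIV. K i (x i)))) \<partial>PL)"
    by (intro nn_integral_mono ennreal_leI pw)
  also have "\<dots> = ennreal (2 / r * (pi ^ CARD('n) * Im (G (set_comp (\<chi> i. \<i>) j (\<i> * of_real r)))))"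
  proof -
    have hb: "has_bochner_integral PL (\<lambda>x. 2 / r * (Im (Gr x) * (\<Prod>i\<in>UNIV. K i (x i))))
      (2 / r * (pi ^ CARD('n) * Im (G (set_comp (\<chi> i. \<i>) j (\<i> * of_real r)))))"
      by (intro has_bochner_integral_mult_right I)
    moreover have "0 \<le> 2 / r * (Im (Gr x) * (\<Prod>i\<in>UNIV. K i (x i)))" for x
      using r by (intro mult_nonneg_nonneg Im_nonneg prod_nonneg) (auto simp: K_def)
    ultimately have "(\<integral>\<^sup>+x. ennreal (2 / r * (Im (Gr x) * (\<Prod>i\<in>UNIV. K i (x i)))) \<partial>PL)
      = ennreal (\<integral>x. 2 / r * (Im (Gr x) * (\<Prod>i\<in>UNIV. K i (x i))) \<partial>PL)"
      by (intro nn_integral_eq_integral) (auto simp only: has_bochner_integral_iff intro!: AE_I2)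
    then show ?thesis by (simp only: has_bochner_integral_integral_eq[OF hb])
  qed
  finally have "measure (boundary_measure G) {t. \<bar>t $ j\<bar> > r} \<le> 2 / r * (pi ^ CARD('n) * Im (G (set_comp (\<chi> i. \<i>) j (\<i> * of_real r))))"
    unfolding measure_def
    by (intro enn2real_leI mult_nonneg_nonneg ImG) (use r e in \<open>auto simp: halfs_def\<close>)
  then show ?thesis by (simp add: mult_ac)
qed

end

section \<open>Weak limits of finite measures with convergent mass\<close>

lemma finite_measure_box_tight:
  fixes M :: "(real ^ 'n) measure"
  assumes "finite_measure M" "sets M = sets borel" "e > 0"
  obtains r where "\<And>r'. r' \<ge> r \<Longrightarrow> measure M {x. \<forall>j. \<bar>x $ j\<bar> \<le> r'} > measure M UNIV - e"
proof -
  interpret finite_measure M by fact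
  have meas: "{x :: real ^ 'n. \<forall>j. \<bar>x $ j\<bar> \<le> r} \<in> sets M" for r
    unfolding assms(2) by (intro borel_closed closed_Collect_all closed_Collect_le continuous_intros)
  have "(\<lambda>i. measure M {x :: real ^ 'n. \<forall>j. \<bar>x $ j\<bar> \<le> real i}) \<longlonglongrightarrow> measure M (\<Union>i. {x :: real ^ 'n. \<forall>j. \<bar>x $ j\<bar> \<le> real i})"
  proof (rule finite_Lim_measure_incseq)
    show "incseq (\<lambda>i. {x :: real ^ 'n. \<forall>j. \<bar>x $ j\<bar> \<le> real i})"
      unfolding incseq_def by (auto intro: order_trans)
  qed (use meas in auto)
  moreover have "(\<Union>i. {x :: real ^ 'n. \<forall>j. \<bar>x $ j\<bar> \<le> real i}) = UNIV"
  proof -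
    have "x \<in> {x. \<forall>j. \<bar>x $ j\<bar> \<le> real (nat \<lceil>norm x\<rceil>)}" for x :: "real ^ 'n"
    proof (rule CollectI, rule allI)
      fix j show "\<bar>x $ j\<bar> \<le> real (nat \<lceil>norm x\<rceil>)" using component_le_norm_cart[of x j] by linarith
    qed
    then show ?thesis by blast
  qed
  ultimately have "\<forall>\<^sub>F i in sequentially. measure M UNIV - e < measure M {x :: real ^ 'n. \<forall>j. \<bar>x $ j\<bar> \<le> real i}"
    using assms(3) by (intro order_tendstoD(1)) auto
  then obtain i where i: "measure M UNIV - e < measure M {x :: real ^ 'n. \<forall>j. \<bar>x $ j\<bar> \<le> real i}"
    by (auto simp: eventually_sequentially)
  show ?thesis
  proof (rule that[of "real i"])
    fix r' assume "r' \<ge> real i"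
    then have "measure M {x :: real ^ 'n. \<forall>j. \<bar>x $ j\<bar> \<le> real i} \<le> measure M {x :: real ^ 'n. \<forall>j. \<bar>x $ j\<bar> \<le> r'}"
      by (intro finite_measure_mono meas) (auto intro: order_trans)
    then show "measure M {x. \<forall>j. \<bar>x $ j\<bar> \<le> r'} > measure M UNIV - e" using i by simp
  qed
qed

text \<open>The measures are normalised to probability measures, and the limit is rescaled by
  \<open>m\<close>. This breaks down for \<open>m = 0\<close>, where the null measure is the limit
  because all integrals of bounded functions tend to \<open>0\<close>.\<close>

lemma tight_finite_measures_weakly_convergent_subsequence:
  fixes X :: "nat \<Rightarrow> (real ^ 'n) measure"
  assumes X: "\<And>n. finite_measure (X n)" "\<And>n. sets (X n) = sets borel"
    and mass: "(\<lambda>n. measure (X n) UNIV) \<longlonglongrightarrow> m"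
    and tight: "\<And>e j. e > 0 \<Longrightarrow> \<exists>r. \<forall>\<^sub>F n in sequentially. measure (X n) {x. \<bar>x $ j\<bar> > r} < e"
  obtains s M where "strict_mono (s :: nat \<Rightarrow> nat)" "finite_measure M" "sets M = sets borel"
    "\<And>g :: real ^ 'n \<Rightarrow> complex. continuous_on UNIV g \<Longrightarrow> bounded (range g) \<Longrightarrow>
       (\<lambda>n. \<integral>x. g x \<partial>X (s n)) \<longlonglongrightarrow> (\<integral>x. g x \<partial>M)"
proof -
  have sp: "space (X n) = UNIV" for n using sets_eq_imp_space_eq[OF X(2)] by simp
  have m0: "m \<ge> 0" by (rule LIMSEQ_le_const[OF mass]) auto
  show ?thesis
  proof (cases "m = 0")
    case True
    define M where "M = (null_measure borel :: (real ^ 'n) measure)"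
    show ?thesis
    proof (rule that[of id M])
      show "strict_mono (id :: nat \<Rightarrow> nat)" by (rule strict_mono_id)
      show "finite_measure M" by (rule finite_measureI) (simp add: M_def)
      show "sets M = sets borel" by (simp add: M_def)
      fix g :: "real ^ 'n \<Rightarrow> complex" assume g: "continuous_on UNIV g" "bounded (range g)"
      then obtain B where B: "\<And>x. norm (g x) \<le> B" by (auto simp: bounded_iff)
      have "norm (\<integral>x. g x \<partial>X n) \<le> B * measure (X n) UNIV" for n
      proof -
        interpret finite_measure "X n" by (rule X)
        have gm: "g \<in> borel_measurable (X n)"
          using borel_measurable_continuous_onI[OF g(1)] measurable_cong_sets[OF X(2) refl] by blast
        have "integrable (X n) g" by (rule integrable_const_bound[where B = B]) (use B gm in auto)
        then have "norm (\<integral>x. g x \<partial>X n) \<le> (\<integral>x. B \<partial>X n)"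
          using B by (intro order.trans[OF integral_norm_bound] integral_mono) auto
        then show ?thesis by (simp add: sp mult.commute)
      qed
      moreover have "(\<lambda>n. B * measure (X n) UNIV) \<longlonglongrightarrow> B * 0"
        using mass True by (intro tendsto_intros) auto
      ultimately have "(\<lambda>n. \<integral>x. g x \<partial>X n) \<longlonglongrightarrow> 0"
        using Lim_null_comparison[OF always_eventually[OF allI],
            of "\<lambda>n. \<integral>x. g x \<partial>X n" "\<lambda>n. B * measure (X n) UNIV" sequentially] by simp
      then show "(\<lambda>n. \<integral>x. g x \<partial>X (id n)) \<longlonglongrightarrow> (\<integral>x. g x \<partial>M)" by (simp add: M_def)
    qed
  next
    case False
    with m0 have m: "m > 0" by simp
    \<comment> \<open>Discarding the first \<open>k\<close> measures keeps all masses above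
      \<open>m / 2\<close>, so division by them is safe.\<close>
    then obtain k where k: "\<And>n. n \<ge> k \<Longrightarrow> measure (X n) UNIV > m / 2"
      using order_tendstoD(1)[OF mass, of "m / 2"] by (auto simp: eventually_sequentially)
    define mm where "mm n = measure (X (n + k)) UNIV" for n
    have mm: "mm n > m / 2" for n using k[of "n + k"] by (simp add: mm_def)
    then have mm0: "mm n > 0" for n using m by (meson half_gt_zero order.strict_trans)
    define Y where "Y n = density (X (n + k)) (\<lambda>_. ennreal (1 / mm n))" for n
    have emY: "emeasure (Y n) A = ennreal (measure (X (n + k)) A / mm n)" if "A \<in> sets borel" for A n
    proof -
      interpret finite_measure "X (n + k)" by (rule X)
      have "emeasure (Y n) A = ennreal (1 / mm n) * ennreal (measure (X (n + k)) A)"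
        unfolding Y_def using that by (subst emeasure_density_const) (auto simp: X emeasure_eq_measure)
      then show ?thesis using mm0[of n] by (simp flip: ennreal_mult)
    qed
    have sY: "sets (Y n) = sets borel" for n by (simp add: Y_def X)
    have mY: "measure (Y n) A = measure (X (n + k)) A / mm n" if "A \<in> sets borel" for A n
      using emY[OF that, of n] mm0[of n] by (intro measure_eq_emeasure_eq_ennreal) auto
    have pY: "prob_space (Y n)" for n
      by (rule prob_spaceI) (use emY[of UNIV n] mm0[of n] in \<open>simp add: Y_def sp mm_def\<close>)
    have bm: "{x :: real ^ 'n. \<bar>x $ j\<bar> > r} \<in> sets borel" for r j
      by (intro borel_open open_Collect_less continuous_intros)
    have bm': "{x :: real ^ 'n. \<forall>j. \<bar>x $ j\<bar> \<le> r} \<in> sets borel" for r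
      by (intro borel_closed closed_Collect_all closed_Collect_le continuous_intros)
    have tightY: "\<exists>r. \<forall>n. measure (Y n) {x. \<forall>j. \<bar>x $ j\<bar> \<le> r} > 1 - e" if e: "e > 0" for e
    proof -
      \<comment> \<open>An equal share for each coordinate of \<open>e * (m / 2)\<close>; since the
        masses exceed \<open>m / 2\<close>, the union of the tails has normalised mass below
        \<open>e\<close>.\<close>
      define d where "d = e * (m / 2) / real CARD('n)"
      have d: "d > 0" using e m by (simp add: d_def)
      obtain \<rho> where \<rho>: "\<And>j. \<forall>\<^sub>F n in sequentially. measure (X n) {x. \<bar>x $ j\<bar> > \<rho> j} < d"
        using tight[OF d] by metis
      define r0 where "r0 = Max (range \<rho>)"
      have r0: "\<rho> j \<le> r0" for j by (simp add: r0_def)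
      have "\<forall>\<^sub>F n in sequentially. \<forall>j. measure (X n) {x. \<bar>x $ j\<bar> > \<rho> j} < d"
        by (intro eventually_all_finite allI \<rho>)
      then obtain l where l: "\<And>n j. n \<ge> l \<Longrightarrow> measure (X n) {x. \<bar>x $ j\<bar> > \<rho> j} < d"
        by (auto simp: eventually_sequentially)
      have big: "measure (Y n) {x. \<forall>j. \<bar>x $ j\<bar> \<le> r} > 1 - e" if n: "n \<ge> l" and r: "r \<ge> r0" for n r
      proof -
        interpret Xn: finite_measure "X (n + k)" by (rule X)
        interpret Y: prob_space "Y n" by (rule pY)
        have "measure (X (n + k)) (- {x. \<forall>j. \<bar>x $ j\<bar> \<le> r}) \<le> measure (X (n + k)) (\<Union>j. {x. \<bar>x $ j\<bar> > \<rho> j})"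
        proof (intro Xn.finite_measure_mono subsetI)
          fix x :: "real ^ 'n" assume "x \<in> - {x. \<forall>j. \<bar>x $ j\<bar> \<le> r}"
          then obtain j where "\<bar>x $ j\<bar> > r" by (auto simp: not_le)
          then have "\<bar>x $ j\<bar> > \<rho> j" using r r0[of j] by linarith
          then show "x \<in> (\<Union>j. {x. \<bar>x $ j\<bar> > \<rho> j})" by blast
        qed (use bm in \<open>auto simp: X\<close>)
        also have "\<dots> \<le> (\<Sum>j\<in>UNIV. measure (X (n + k)) {x. \<bar>x $ j\<bar> > \<rho> j})"
          using bm by (intro Xn.finite_measure_subadditive_finite) (auto simp: X)
        also have "\<dots> < (\<Sum>j\<in>(UNIV :: 'n set). d)"
          using l[of "n + k"] n by (intro sum_strict_mono) auto
        also have "\<dots> = e * (m / 2)" by (simp add: d_def)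
        also have "\<dots> < e * mm n" using mm e by (intro mult_strict_left_mono) auto
        finally have "measure (Y n) (- {x. \<forall>j. \<bar>x $ j\<bar> \<le> r}) < e"
          using mm0[of n] bm'[of r] by (subst mY) (auto simp: divide_less_eq)
        moreover have "measure (Y n) (space (Y n) - {x. \<forall>j. \<bar>x $ j\<bar> \<le> r}) = 1 - measure (Y n) {x. \<forall>j. \<bar>x $ j\<bar> \<le> r}"
          using bm' by (intro Y.prob_compl) (simp add: sY)
        ultimately show ?thesis by (simp add: Y_def sp Compl_eq_Diff_UNIV)
      qed
      \<comment> \<open>The tail bounds hold only eventually. The finitely many earlier measures are
        each tight, and a maximum of radii serves all of them.\<close>
      have "\<exists>r. \<forall>r'\<ge>r. measure (Y n) {x. \<forall>j. \<bar>x $ j\<bar> \<le> r'} > 1 - e" for n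
      proof -
        interpret Y: prob_space "Y n" by (rule pY)
        have "measure (Y n) UNIV = 1" using Y.prob_space by (simp add: Y_def sp)
        then show ?thesis
          using finite_measure_box_tight[OF Y.finite_measure_axioms sY e] by metis
      qed
      then obtain R where R: "\<And>n r'. r' \<ge> R n \<Longrightarrow> measure (Y n) {x. \<forall>j. \<bar>x $ j\<bar> \<le> r'} > 1 - e"
        by metis
      define r where "r = Max (insert r0 (R ` {..<l}))"
      have "r \<ge> r0" "\<And>n. n < l \<Longrightarrow> r \<ge> R n" by (auto simp: r_def)
      then have "measure (Y n) {x. \<forall>j. \<bar>x $ j\<bar> \<le> r} > 1 - e" for n
        using big[of n r] R[of n r] by (cases "n < l") auto
      then show ?thesis by blast
    qed
    obtain s M where s: "strict_mono (s :: nat \<Rightarrow> nat)" and M: "prob_space M" "sets M = sets borel"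
      and conv: "\<And>g :: real ^ 'n \<Rightarrow> complex. continuous_on UNIV g \<Longrightarrow> bounded (range g) \<Longrightarrow>
       (\<lambda>n. \<integral>x. g x \<partial>Y (s n)) \<longlonglongrightarrow> (\<integral>x. g x \<partial>M)"
      using tight_imp_weakly_convergent_subsequence[OF pY sY tightY] by metis
    interpret M: prob_space M by fact
    define M' where "M' = density M (\<lambda>_. ennreal m)"
    show ?thesis
    proof (rule that[of "\<lambda>n. s n + k" M'])
      show "strict_mono (\<lambda>n. s n + k)" using s by (simp add: strict_mono_def)
      show "finite_measure M'"
        by (rule finite_measureI) (simp add: M'_def emeasure_density_const M.emeasure_space_1)
      show "sets M' = sets borel" by (simp add: M'_def M)
      fix g :: "real ^ 'n \<Rightarrow> complex" assume g: "continuous_on UNIV g" "bounded (range g)"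
      have gm: "g \<in> borel_measurable N" if "sets N = sets borel" for N :: "(real ^ 'n) measure"
        using borel_measurable_continuous_onI[OF g(1)] measurable_cong_sets[OF that refl] by blast
      have "(\<integral>x. g x \<partial>Y n) = (\<integral>x. (1 / mm n) *\<^sub>R g x \<partial>X (n + k))" for n
        unfolding Y_def using mm0[of n] by (intro integral_density gm X) auto
      then have "(\<integral>x. g x \<partial>X (n + k)) = mm n *\<^sub>R (\<integral>x. g x \<partial>Y n)" for n
        using mm0[of n] by simp
      moreover have "(\<lambda>n. mm (s n)) \<longlonglongrightarrow> m"
        using LIMSEQ_subseq_LIMSEQ[OF LIMSEQ_ignore_initial_segment[OF mass, of k] s]
        by (simp add: mm_def o_def)
      then have "(\<lambda>n. mm (s n) *\<^sub>R (\<integral>x. g x \<partial>Y (s n))) \<longlonglongrightarrow> m *\<^sub>R (\<integral>x. g x \<partial>M)"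
        by (intro tendsto_intros conv g)
      moreover have "(\<integral>x. g x \<partial>M') = (\<integral>x. m *\<^sub>R g x \<partial>M)"
        unfolding M'_def using m by (intro integral_density gm M) auto
      ultimately show "(\<lambda>n. \<integral>x. g x \<partial>X (s n + k)) \<longlonglongrightarrow> (\<integral>x. g x \<partial>M')" by simp
    qed
  qed
qed

text \<open>The factor \<open>1 + t\<^sup>2\<close> makes the kernels bounded, at the price of replacing a measure \<open>\<mu>\<close> by the
  finite measure \<open>\<Prod> 1 / (1 + t\<^sup>2) \<mu>\<close>.\<close>

definition weighted :: "complex \<Rightarrow> complex \<Rightarrow> real \<Rightarrow> complex" where
  "weighted a b t = of_real (1 + t\<^sup>2) * (1 / (of_real t - a) - 1 / (of_real t - b))"

lemma of_real_one_plus_square_nonzero: "complex_of_real (1 + t\<^sup>2) \<noteq> 0"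
proof -
  have "1 + t\<^sup>2 > 0" by (simp add: add_pos_nonneg)
  then show ?thesis by (metis of_real_eq_0_iff less_irrefl)
qed

lemma weighted_divide: "weighted a b t / of_real (1 + t\<^sup>2) = 1 / (of_real t - a) - 1 / (of_real t - b)"
  using of_real_one_plus_square_nonzero[of t] by (simp add: weighted_def)

lemma not_real_diff: "(a :: complex) \<notin> \<real> \<Longrightarrow> of_real t - a \<noteq> 0"
  by auto

text \<open>The factors \<open>t - \<i>\<close> and \<open>t + \<i>\<close> of
  \<open>1 + t^2\<close> are shared out to the two resolvents. Each quotient is then 1 plus a
  bounded term, and as a function of \<open>a\<close> the product is an explicit Cauchy
  kernel.\<close>

lemma weighted_eq:
  assumes "a \<notin> \<real>" "b \<notin> \<real>"
  shows "weighted a b t = (a - b) * (1 + (a - \<i>) / (of_real t - a)) * (1 + (b + \<i>) / (of_real t - b))"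
proof -
  have ne: "of_real t - a \<noteq> 0" "of_real t - b \<noteq> 0" using assms not_real_diff by auto
  have "1 + (a - \<i>) / (of_real t - a) = (of_real t - \<i>) / (of_real t - a)"
    "1 + (b + \<i>) / (of_real t - b) = (of_real t + \<i>) / (of_real t - b)" 
    using ne by (auto simp: field_simps)
  moreover have "1 / (of_real t - a) - 1 / (of_real t - b) = (a - b) / ((of_real t - a) * (of_real t - b))"
    using ne by (simp add: diff_frac_eq)
  moreover have "complex_of_real (1 + t\<^sup>2) = (of_real t - \<i>) * (of_real t + \<i>)"
    by (simp add: algebra_simps power2_eq_square)
  ultimately show ?thesis unfolding weighted_def by (simp add: divide_divide_eq_left mult_ac)
qed

lemma Im_le_norm_diff: "\<bar>Im a\<bar> \<le> cmod (of_real t - a)"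
  using abs_Im_le_cmod[of "of_real t - a"] by simp

lemma weighted_bounded:
  assumes "a \<notin> \<real>" "b \<notin> \<real>"
  obtains B where "\<And>t. cmod (weighted a b t) \<le> B"
proof
  fix t
  have im: "\<bar>Im a\<bar> > 0" "\<bar>Im b\<bar> > 0" using assms by (auto simp: complex_is_Real_iff)
  have *: "cmod (1 + u / (of_real t - v)) \<le> 1 + cmod u / \<bar>Im v\<bar>" if "\<bar>Im v\<bar> > 0" for u v
  proof -
    have "cmod (u / (of_real t - v)) \<le> cmod u / \<bar>Im v\<bar>"
      unfolding norm_divide using that Im_le_norm_diff[of v t]
      by (intro divide_left_mono mult_pos_pos) (linarith | simp)+
    then show ?thesis using norm_triangle_ineq[of 1 "u / (of_real t - v)"] by simp
  qed
  show "cmod (weighted a b t) \<le> cmod (a - b) * (1 + cmod (a - \<i>) / \<bar>Im a\<bar>) * (1 + cmod (b + \<i>) / \<bar>Im b\<bar>)"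
    unfolding weighted_eq[OF assms] norm_mult using im
    by (intro mult_mono mult_left_mono * mult_nonneg_nonneg add_nonneg_nonneg divide_nonneg_nonneg) auto
qed

lemma weighted_continuous: "a \<notin> \<real> \<Longrightarrow> b \<notin> \<real> \<Longrightarrow> continuous_on UNIV (weighted a b)"
  unfolding weighted_def[abs_def] by (intro continuous_intros) (use not_real_diff in auto)

lemma weighted_prod:
  fixes a b :: "'n::finite \<Rightarrow> complex"
  assumes "\<And>i. a i \<notin> \<real>" "\<And>i. b i \<notin> \<real>"
  shows "continuous_on UNIV (\<lambda>t :: real ^ 'n. \<Prod>i\<in>I. weighted (a i) (b i) (t $ i))"
    and "bounded (range (\<lambda>t :: real ^ 'n. \<Prod>i\<in>I. weighted (a i) (b i) (t $ i)))"
proof -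
  show "continuous_on UNIV (\<lambda>t :: real ^ 'n. \<Prod>i\<in>I. weighted (a i) (b i) (t $ i))"
    by (intro continuous_on_prod continuous_on_compose2[OF weighted_continuous[OF assms]] continuous_intros) auto
  have "\<exists>B. \<forall>t. cmod (weighted (a i) (b i) t) \<le> B" for i
    using weighted_bounded[OF assms(1)[of i] assms(2)[of i]] by metis
  then obtain B where B: "\<And>i t. cmod (weighted (a i) (b i) t) \<le> B i" by metis
  have "cmod (\<Prod>i\<in>I. weighted (a i) (b i) (t $ i)) \<le> (\<Prod>i\<in>I. B i)" for t :: "real ^ 'n"
    unfolding prod_norm[symmetric] by (intro prod_mono conjI B norm_ge_zero)
  then show "bounded (range (\<lambda>t :: real ^ 'n. \<Prod>i\<in>I. weighted (a i) (b i) (t $ i)))"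
    by (auto simp: bounded_iff)
qed

lemma integrable_weighted_prod:
  fixes a b :: "'n::finite \<Rightarrow> complex" and \<nu> :: "(real ^ 'n) measure"
  assumes "\<And>i. a i \<notin> \<real>" "\<And>i. b i \<notin> \<real>" "finite_measure \<nu>" "sets \<nu> = sets borel"
  shows "integrable \<nu> (\<lambda>t. \<Prod>i\<in>I. weighted (a i) (b i) (t $ i))"
proof -
  interpret finite_measure \<nu> by fact
  have "\<exists>B. \<forall>u\<in>range (\<lambda>t :: real ^ 'n. \<Prod>i\<in>I. weighted (a i) (b i) (t $ i)). cmod u \<le> B"
    using weighted_prod(2)[where a = a and b = b and I = I, OF assms(1,2)] by (simp only: bounded_iff)
  then obtain B where B: "\<forall>u\<in>range (\<lambda>t :: real ^ 'n. \<Prod>i\<in>I. weighted (a i) (b i) (t $ i)). cmod u \<le> B" ..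
  then have "cmod (\<Prod>i\<in>I. weighted (a i) (b i) (t $ i)) \<le> B" for t :: "real ^ 'n"
    by (rule bspec) (rule rangeI)
  moreover have "(\<lambda>t :: real ^ 'n. \<Prod>i\<in>I. weighted (a i) (b i) (t $ i)) \<in> borel_measurable \<nu>"
    unfolding measurable_cong_sets[OF assms(4) refl]
    by (intro borel_measurable_continuous_onI weighted_prod(1) assms(1,2))
  ultimately show ?thesis by (intro integrable_const_bound[where B = B] AE_I2)
qed

lemma integrable_resolvent_diff:
  fixes a b :: complex
  assumes "a \<notin> \<real>" "b \<notin> \<real>"
  shows "integrable lborel (\<lambda>t. 1 / (of_real t - a) - 1 / (of_real t - b))"
proof -
  obtain B where B: "\<And>t. cmod (weighted a b t) \<le> B" using weighted_bounded[OF assms] by blast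
  show ?thesis
  proof (rule Bochner_Integration.integrable_bound)
    show "integrable lborel (\<lambda>t. B * (1 / (1 + t\<^sup>2)))"
      by (intro integrable_mult_right integrable_inverse_square)
    have "continuous_on UNIV (\<lambda>t. 1 / (of_real t - a) - 1 / (of_real t - b))"
      by (intro continuous_intros) (use not_real_diff assms in auto)
    then show "(\<lambda>t. 1 / (of_real t - a) - 1 / (of_real t - b)) \<in> borel_measurable lborel"
      using borel_measurable_continuous_onI by auto
    have "cmod (1 / (of_real t - a) - 1 / (of_real t - b)) \<le> norm (B * (1 / (1 + t\<^sup>2)))" for t
    proof -
      have "cmod (1 / (of_real t - a) - 1 / (of_real t - b)) = cmod (weighted a b t) / (1 + t\<^sup>2)"
        unfolding weighted_divide[symmetric] norm_divide norm_of_real by simp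
      also have "\<dots> \<le> \<bar>B\<bar> / (1 + t\<^sup>2)"
        using order.trans[OF B abs_ge_self] by (intro divide_right_mono) auto
      finally show ?thesis by simp
    qed
    then show "AE t in lborel. cmod (1 / (of_real t - a) - 1 / (of_real t - b)) \<le> norm (B * (1 / (1 + t\<^sup>2)))" by simp
  qed
qed

section \<open>Bounded approximations and the limit of their boundary measures\<close>

lemma reproduces_cauchy_swap:
  assumes "Im z > 0" "Im w < 0"
  shows "reproduces (\<lambda>t. 1 / (of_real t - w) - 1 / (of_real t - z)) (- (2 * of_real pi * \<i>)) z"
  using reproduces_scale[OF reproduces_cauchy[OF assms], of "-1"] by simp

text \<open>For \<open>u \<noteq> 0\<close> this is \<open>1 / (1 / u - \<i> * e)\<close>:
  inversion, a downward shift by \<open>e\<close>, inversion. The closed upper half-plane therefore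
  lands in the disc of diameter \<open>1 / e\<close> that touches the real axis at \<open>0\<close>,
  and \<open>e = 0\<close> gives the identity.\<close>

definition moebius :: "real \<Rightarrow> complex \<Rightarrow> complex" where
  "moebius e u = u / (1 - \<i> * of_real e * u)"

lemma moebius_denom:
  assumes "e > 0" "Im u \<ge> 0"
  shows "1 - \<i> * of_real e * u \<noteq> 0" "cmod (moebius e u) \<le> 1 / e" "Im (moebius e u) \<ge> 0"
proof -
  have re: "Re (1 - \<i> * of_real e * u) = 1 + e * Im u" "Im (1 - \<i> * of_real e * u) = - (e * Re u)" by simp_all
  have pos: "1 + e * Im u > 0" using assms by (simp add: add_pos_nonneg)
  show ne: "1 - \<i> * of_real e * u \<noteq> 0"
  proof
    assume "1 - \<i> * of_real e * u = 0"
    from arg_cong[OF this, of Re] show False using pos by simp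
  qed
  have "0 \<le> e * Im u" using assms by simp
  then have "(e * cmod u)\<^sup>2 \<le> (cmod (1 - \<i> * of_real e * u))\<^sup>2"
    unfolding power_mult_distrib cmod_power2 re by (simp add: power2_eq_square algebra_simps)
  then have "e * cmod u \<le> cmod (1 - \<i> * of_real e * u)"
    by (rule power2_le_imp_le) simp
  then show "cmod (moebius e u) \<le> 1 / e"
    using ne assms by (simp add: moebius_def norm_divide divide_simps mult.commute)
  have "Im (u * cnj (1 - \<i> * of_real e * u)) = Im u + e * (cmod u)\<^sup>2"
    unfolding cmod_power2 by (simp add: power2_eq_square algebra_simps)
  then have "Im (u * cnj (1 - \<i> * of_real e * u)) \<ge> 0" using assms by simp
  then show "Im (moebius e u) \<ge> 0"
    unfolding moebius_def by (simp add: Im_complex_div_ge_0)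
qed

definition bounded_approx :: "(complex ^ 'n \<Rightarrow> complex) \<Rightarrow> real \<Rightarrow> complex ^ 'n \<Rightarrow> complex" where
  "bounded_approx F e z = moebius e (F (z + (\<chi> j. \<i> * of_real e)))"

lemma bounded_herglotz_bounded_approx:
  fixes F :: "complex ^ 'n \<Rightarrow> complex"
  assumes F: "herglotz_nevanlinna F" and e: "e > 0"
  shows "bounded_herglotz (bounded_approx F e) e"
proof -
  define c :: "complex ^ 'n" where "c = (\<chi> j. \<i> * complex_of_real e)"
  have up: "z + c \<in> upper_poly" if "z \<in> halfs e" for z
  proof -
    have "-e < Im (z $ j)" for j using that by (simp add: halfs_def)
    then have "Im (z $ j) + e > 0" for j using add_strict_right_mono[of "-e" "Im (z $ j)" e] by simp
    then show ?thesis by (simp add: upper_poly_def c_def)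
  qed
  have ImF: "Im (F (z + c)) \<ge> 0" if "z \<in> halfs e" for z
    using F up[OF that] by (simp add: herglotz_nevanlinna_def)
  have "mv_holomorphic_on (bounded_approx F e) (halfs e)"
    unfolding mv_holomorphic_on_def
  proof
    fix z :: "complex ^ 'n" assume z: "z \<in> halfs e"
    obtain D where D: "(F has_derivative D) (at (z + c))" "\<And>c v. D (c *s v) = c * D v"
      using F up[OF z] unfolding herglotz_nevanlinna_def mv_holomorphic_on_def by blast
    have "((\<lambda>z. z + c) has_derivative (\<lambda>v. v)) (at z)" by (auto intro!: derivative_eq_intros)
    from has_derivative_compose[OF this D(1)]
    have 1: "((\<lambda>z. F (z + c)) has_derivative D) (at z)" by simp
    define m where "m = deriv (moebius e) (F (z + c))"
    have "moebius e field_differentiable at (F (z + c))"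
      unfolding moebius_def[abs_def] using moebius_denom(1)[OF e ImF[OF z]]
      by (intro derivative_intros) auto
    then have "(moebius e has_derivative (*) m) (at (F (z + c)))"
      unfolding m_def by (simp add: DERIV_deriv_iff_field_differentiable flip: has_field_derivative_def)
    from has_derivative_compose[OF 1 this]
    have "(bounded_approx F e has_derivative (\<lambda>v. m * D v)) (at z)"
      by (simp add: bounded_approx_def[abs_def] c_def)
    then show "\<exists>D. (bounded_approx F e has_derivative D) (at z) \<and> (\<forall>c v. D (c *s v) = c * D v)"
      by (intro exI[of _ "\<lambda>v. m * D v"]) (simp add: D(2))
  qed
  moreover have "cmod (bounded_approx F e z) \<le> 1 / e" "Im (bounded_approx F e z) \<ge> 0" if "z \<in> halfs e" for z
    using moebius_denom(2,3)[OF e ImF[OF that]] by (simp_all add: bounded_approx_def c_def)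
  ultimately show ?thesis using e by (auto simp: bounded_herglotz_def bounded_iff)
qed

lemma bounded_approx_tendsto:
  fixes F :: "complex ^ 'n \<Rightarrow> complex"
  assumes F: "herglotz_nevanlinna F" and z: "z \<in> upper_poly"
  shows "(\<lambda>k. bounded_approx F (1 / real (Suc k)) z) \<longlonglongrightarrow> F z"
proof -
  have e: "(\<lambda>k. 1 / real (Suc k)) \<longlonglongrightarrow> 0" by real_asymp
  have "isCont F z"
    using F z unfolding herglotz_nevanlinna_def mv_holomorphic_on_def by (blast intro: has_derivative_continuous)
  moreover have "(\<lambda>k. z + (\<chi> j. \<i> * complex_of_real (1 / real (Suc k)))) \<longlonglongrightarrow> z + (\<chi> j. \<i> * complex_of_real 0)"
    by (intro tendsto_intros e)
  then have "(\<lambda>k. z + (\<chi> j. \<i> * complex_of_real (1 / real (Suc k)))) \<longlonglongrightarrow> z"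
    by (simp add: zero_vec_def[symmetric])
  ultimately have "(\<lambda>k. F (z + (\<chi> j. \<i> * complex_of_real (1 / real (Suc k))))) \<longlonglongrightarrow> F z"
    by (rule isCont_tendsto_compose)
  then have "(\<lambda>k. bounded_approx F (1 / real (Suc k)) z) \<longlonglongrightarrow> F z / (1 - \<i> * of_real 0 * F z)"
    unfolding bounded_approx_def moebius_def by (intro tendsto_intros e) auto
  then show ?thesis by simp
qed

text \<open>Together with \<open>N_right\<close>, the two poles of \<open>factor_N\<close>:
  \<open>(z, \<i>)\<close>, \<open>(\<i>, - \<i>)\<close> and \<open>(- \<i>, cnj z)\<close>. All
  three factors thereby become multiples of one difference of resolvents.\<close>

definition N_left :: "int \<Rightarrow> complex \<Rightarrow> complex" where
  "N_left r z = (if r = -1 then z else if r = 0 then \<i> else - \<i>)"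

definition N_right :: "int \<Rightarrow> complex \<Rightarrow> complex" where
  "N_right r z = (if r = -1 then \<i> else if r = 0 then - \<i> else cnj z)"

lemma factor_N_eq: "factor_N r z t = 1 / (2 * \<i>) * (1 / (of_real t - N_left r z) - 1 / (of_real t - N_right r z))"
  by (simp add: factor_N_def N_left_def N_right_def)

lemma N_left_right_not_real:
  assumes "Im z > 0" shows "N_left r z \<notin> \<real>" "N_right r z \<notin> \<real>"
  using assms by (auto simp: N_left_def N_right_def complex_is_Real_iff)

text \<open>No mass escapes to infinity: by \<open>growth\<close>, the bound of \<open>tail_boundary_measure\<close> tends to \<open>0\<close>.\<close>

lemma herglotz_boundary_measure_exists:
  fixes F :: "complex ^ 'n \<Rightarrow> complex"
  assumes F: "herglotz_nevanlinna F"
    and growth: "\<And>j. ((\<lambda>y. F (set_comp (\<chi> i. \<i>) j (\<i> * of_real y)) / (\<i> * of_real y)) \<longlongrightarrow> 0) at_top"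
  obtains \<nu> :: "(real ^ 'n) measure" where "finite_measure \<nu>" "sets \<nu> = sets borel"
    "measure \<nu> UNIV = pi ^ CARD('n) * Im (F (\<chi> i. \<i>))"
    "\<And>z. z \<in> upper_poly \<Longrightarrow> (\<integral>t. (\<Prod>l\<in>UNIV. weighted (z $ l) (- \<i>) (t $ l)) \<partial>\<nu>)
       = (2 * of_real pi * \<i>) ^ CARD('n) * (F z - cnj (F (\<chi> i. \<i>))) / (2 * \<i>)"
    "\<And>z \<rho>. z \<in> upper_poly \<Longrightarrow> -1 \<in> range \<rho> \<Longrightarrow> 1 \<in> range \<rho> \<Longrightarrow>
       (\<integral>t. (\<Prod>l\<in>UNIV. weighted (N_left (\<rho> l) (z $ l)) (N_right (\<rho> l) (z $ l)) (t $ l)) \<partial>\<nu>) = 0"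
proof -
  define one :: "complex ^ 'n" where "one = (\<chi> i. \<i>)"
  have one: "one \<in> upper_poly" by (simp add: one_def upper_poly_def)
  define G where "G k = bounded_approx F (1 / real (Suc k))" for k
  have bh: "bounded_herglotz (G k) (1 / real (Suc k))" for k
    unfolding G_def by (rule bounded_herglotz_bounded_approx[OF F]) simp
  have Glim: "(\<lambda>k. G k z) \<longlonglongrightarrow> F z" if "z \<in> upper_poly" for z
    unfolding G_def by (rule bounded_approx_tendsto[OF F that])
  define X where "X k = boundary_measure (G k)" for k
  have sX: "sets (X k) = sets borel" for k
    unfolding X_def by (rule bounded_herglotz.sets_boundary_measure[OF bh])
  have fX: "finite_measure (X k)" for k
    unfolding X_def by (rule bounded_herglotz.finite_boundary_measure[OF bh])
  have massX: "measure (X k) UNIV = pi ^ CARD('n) * Im (G k one)" for k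
    unfolding X_def one_def by (rule bounded_herglotz.measure_boundary_measure_space[OF bh])
  have mass: "(\<lambda>k. measure (X k) UNIV) \<longlonglongrightarrow> pi ^ CARD('n) * Im (F one)"
    unfolding massX by (intro tendsto_intros Glim one)
  have tight: "\<exists>r. \<forall>\<^sub>F k in sequentially. measure (X k) {x. \<bar>x $ j\<bar> > r} < e" if e: "e > 0" for e j
  proof -
    define q where "q = 2 * pi ^ CARD('n)"
    have q: "q > 0" by (simp add: q_def)
    have "((\<lambda>y. q * Re (F (set_comp one j (\<i> * of_real y)) / (\<i> * of_real y))) \<longlongrightarrow> q * Re 0) at_top"
      unfolding one_def by (intro tendsto_intros growth)
    then have "\<forall>\<^sub>F y in at_top. q * Re (F (set_comp one j (\<i> * of_real y)) / (\<i> * of_real y)) < e"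
      using e by (intro order_tendstoD(2)) auto
    then have "\<forall>\<^sub>F y in at_top. q * Re (F (set_comp one j (\<i> * of_real y)) / (\<i> * of_real y)) < e \<and> y \<ge> 1"
      using eventually_ge_at_top[of 1] by eventually_elim auto
    then obtain r where r: "q * Re (F (set_comp one j (\<i> * of_real r)) / (\<i> * of_real r)) < e" "r \<ge> 1"
      by (auto simp: eventually_at_top_linorder)
    have "Re (u / (\<i> * of_real r)) = Im u / r" for u
      using r by (simp add: Re_divide power2_eq_square)
    then have "q * (Im (F (set_comp one j (\<i> * of_real r))) / r) < e" using r by simp
    moreover have "(\<lambda>k. q * (Im (G k (set_comp one j (\<i> * of_real r))) / r)) \<longlonglongrightarrow> q * (Im (F (set_comp one j (\<i> * of_real r))) / r)"
      using r by (intro tendsto_intros Glim set_comp_upper one) auto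
    ultimately have "\<forall>\<^sub>F k in sequentially. q * (Im (G k (set_comp one j (\<i> * of_real r))) / r) < e"
      by (intro order_tendstoD(2))
    then have "\<forall>\<^sub>F k in sequentially. measure (X k) {x. \<bar>x $ j\<bar> > r} < e"
    proof eventually_elim
      case (elim k)
      then show ?case
        using bounded_herglotz.tail_boundary_measure[OF bh r(2), of k j] by (simp add: X_def q_def one_def)
    qed
    then show ?thesis by blast
  qed
  obtain s \<nu> where s: "strict_mono (s :: nat \<Rightarrow> nat)" and \<nu>: "finite_measure \<nu>" "sets \<nu> = sets borel"
    and conv: "\<And>g :: real ^ 'n \<Rightarrow> complex. continuous_on UNIV g \<Longrightarrow> bounded (range g) \<Longrightarrow>
       (\<lambda>n. \<integral>x. g x \<partial>X (s n)) \<longlonglongrightarrow> (\<integral>x. g x \<partial>\<nu>)"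
    using tight_finite_measures_weakly_convergent_subsequence[OF fX sX mass tight] by metis
  have Gs: "(\<lambda>n. G (s n) z) \<longlonglongrightarrow> F z" if "z \<in> upper_poly" for z
    using LIMSEQ_subseq_LIMSEQ[OF Glim[OF that] s] by (simp add: o_def)
  have kernel: "(\<integral>t. (\<Prod>l\<in>UNIV. weighted (a l) (b l) (t $ l)) \<partial>X k)
    = ((\<integral>x. G k (\<chi> i. of_real (x i)) * (\<Prod>i\<in>UNIV. 1 / (of_real (x i) - a i) - 1 / (of_real (x i) - b i)) \<partial>PiM UNIV (\<lambda>_. lborel))
       - cnj (\<integral>x. G k (\<chi> i. of_real (x i)) * (\<Prod>i\<in>UNIV. 1 / (of_real (x i) - cnj (a i)) - 1 / (of_real (x i) - cnj (b i))) \<partial>PiM UNIV (\<lambda>_. lborel))) / (2 * \<i>)"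
    if ab: "\<And>l. a l \<notin> \<real>" "\<And>l. b l \<notin> \<real>" for a b k
  proof -
    have "weighted (a l) (b l) \<in> borel_measurable borel" for l
      by (rule borel_measurable_continuous_onI[OF weighted_continuous[OF ab]])
    from bounded_herglotz.integral_boundary_measure_kernel[OF bh this, of k]
    show ?thesis
      unfolding X_def weighted_divide
      by (simp add: bounded_herglotz.integral_Im_kernel[OF bh, where K = "\<lambda>i t. 1 / (of_real t - a i) - 1 / (of_real t - b i)", OF integrable_resolvent_diff[OF ab]])
  qed
  show ?thesis
  proof (rule that[OF \<nu>])
    have "(\<lambda>n. \<integral>x. (1::complex) \<partial>X (s n)) \<longlonglongrightarrow> (\<integral>x. 1 \<partial>\<nu>)" by (rule conv) (auto simp: bounded_iff)
    moreover have "(\<integral>x. (1::complex) \<partial>X n) = of_real (measure (X n) UNIV)" for n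
      using sets_eq_imp_space_eq[OF sX] by (simp add: scaleR_conv_of_real)
    moreover have "(\<integral>x. (1::complex) \<partial>\<nu>) = of_real (measure \<nu> UNIV)"
      using sets_eq_imp_space_eq[OF \<nu>(2)] by (simp add: scaleR_conv_of_real)
    ultimately have "(\<lambda>n. complex_of_real (measure (X (s n)) UNIV)) \<longlonglongrightarrow> of_real (measure \<nu> UNIV)" by simp
    then have "(\<lambda>n. measure (X (s n)) UNIV) \<longlonglongrightarrow> measure \<nu> UNIV" by (simp add: tendsto_of_real_iff)
    moreover have "(\<lambda>n. measure (X (s n)) UNIV) \<longlonglongrightarrow> pi ^ CARD('n) * Im (F one)"
      using LIMSEQ_subseq_LIMSEQ[OF mass s] by (simp add: o_def)
    ultimately show "measure \<nu> UNIV = pi ^ CARD('n) * Im (F (\<chi> i. \<i>))"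
      unfolding one_def by (rule LIMSEQ_unique)
  next
    fix z :: "complex ^ 'n" assume z: "z \<in> upper_poly"
    then have zl: "Im (z $ l) > 0" for l by (simp add: upper_poly_def)
    then have nr: "z $ l \<notin> \<real>" "- \<i> \<notin> \<real>" for l
      by (metis complex_is_Real_iff less_irrefl) (simp add: complex_is_Real_iff)
    have "(\<integral>t. (\<Prod>l\<in>UNIV. weighted (z $ l) (- \<i>) (t $ l)) \<partial>X k)
      = ((2 * of_real pi * \<i>) ^ CARD('n) * G k z - cnj ((- (2 * of_real pi * \<i>)) ^ CARD('n) * G k one)) / (2 * \<i>)" for k
    proof -
      interpret bounded_herglotz "G k" "1 / real (Suc k)" by (rule bh)
      have r1: "reproduces (\<lambda>t. 1 / (of_real t - z $ l) - 1 / (of_real t - - \<i>)) (2 * of_real pi * \<i>) (z $ l)" for l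
        by (rule reproduces_cauchy) (use zl in auto)
      \<comment> \<open>Conjugation moves the pole \<open>z $ l\<close> down and
        \<open>- \<i>\<close> up. The conjugated kernels thus reproduce at \<open>\<i>\<close>, with
        a minus sign from the order of the poles.\<close>
      have r2: "reproduces (\<lambda>t. 1 / (of_real t - cnj (z $ l)) - 1 / (of_real t - cnj (- \<i>))) (- (2 * of_real pi * \<i>)) \<i>" for l
        using reproduces_cauchy_swap[of \<i> "cnj (z $ l)"] zl by simp
      have zz: "(\<chi> l. z $ l) = z" by (simp add: vec_eq_iff)
      show ?thesis
        unfolding kernel[of "\<lambda>l. z $ l" "\<lambda>_. - \<i>", OF nr] integral_kernel[OF r1] integral_kernel[OF r2] one_def prod_constant zz ..
    qed
    moreover have "(\<lambda>n. ((2 * of_real pi * \<i>) ^ CARD('n) * G (s n) z - cnj ((- (2 * of_real pi * \<i>)) ^ CARD('n) * G (s n) one)) / (2 * \<i>))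
       \<longlonglongrightarrow> ((2 * of_real pi * \<i>) ^ CARD('n) * F z - cnj ((- (2 * of_real pi * \<i>)) ^ CARD('n) * F one)) / (2 * \<i>)"
      by (intro tendsto_intros Gs one z) auto
    moreover have "(\<lambda>n. \<integral>t. (\<Prod>l\<in>UNIV. weighted (z $ l) (- \<i>) (t $ l)) \<partial>X (s n)) \<longlonglongrightarrow> (\<integral>t. (\<Prod>l\<in>UNIV. weighted (z $ l) (- \<i>) (t $ l)) \<partial>\<nu>)"
      by (intro conv weighted_prod nr)
    ultimately have eq: "(\<integral>t. (\<Prod>l\<in>UNIV. weighted (z $ l) (- \<i>) (t $ l)) \<partial>\<nu>)
      = ((2 * of_real pi * \<i>) ^ CARD('n) * F z - cnj ((- (2 * of_real pi * \<i>)) ^ CARD('n) * F one)) / (2 * \<i>)"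
      by (simp only: LIMSEQ_unique)
    have "cnj ((- (2 * of_real pi * \<i>)) ^ CARD('n)) = (2 * of_real pi * \<i>) ^ CARD('n)"
      unfolding complex_cnj_power by simp
    then show "(\<integral>t. (\<Prod>l\<in>UNIV. weighted (z $ l) (- \<i>) (t $ l)) \<partial>\<nu>)
       = (2 * of_real pi * \<i>) ^ CARD('n) * (F z - cnj (F (\<chi> i. \<i>))) / (2 * \<i>)"
      unfolding eq complex_cnj_mult by (simp only: one_def right_diff_distrib)
  next
    fix z :: "complex ^ 'n" and \<rho> :: "'n \<Rightarrow> int"
    assume z: "z \<in> upper_poly" and neg: "-1 \<in> range \<rho>" and pos: "1 \<in> range \<rho>"
    then have zl: "Im (z $ l) > 0" for l by (simp add: upper_poly_def)
    define a b where "a l = N_left (\<rho> l) (z $ l)" and "b l = N_right (\<rho> l) (z $ l)" for l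
    have nr: "a l \<notin> \<real>" "b l \<notin> \<real>" for l unfolding a_def b_def using N_left_right_not_real[OF zl] by auto
    then have nrc: "cnj (a l) \<notin> \<real>" "cnj (b l) \<notin> \<real>" for l by (simp_all add: complex_is_Real_iff)
    from pos obtain p where p: "\<rho> p = 1" by (auto elim!: rangeE)
    from neg obtain m where m: "\<rho> m = -1" by (auto elim!: rangeE)
    have "(\<integral>t. (\<Prod>l\<in>UNIV. weighted (a l) (b l) (t $ l)) \<partial>X k) = 0" for k
    proof -
      interpret bounded_herglotz "G k" "1 / real (Suc k)" by (rule bh)
      \<comment> \<open>At \<open>p\<close> both poles \<open>- \<i>\<close> and
        \<open>cnj (z $ p)\<close> are lower, so the integral of \<open>G\<close> vanishes. At
        \<open>m\<close> the poles \<open>z $ m\<close> and \<open>\<i>\<close> are upper and become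
        lower under conjugation, so the conjugated integral vanishes as well.\<close>
      have r1: "reproduces (\<lambda>t. 1 / (of_real t - a p) - 1 / (of_real t - b p)) 0 \<i>"
        by (rule reproduces_zero) (use p zl in \<open>auto simp: a_def b_def N_left_def N_right_def\<close>)
      have r2: "reproduces (\<lambda>t. 1 / (of_real t - cnj (a m)) - 1 / (of_real t - cnj (b m))) 0 \<i>"
        by (rule reproduces_zero) (use m zl in \<open>auto simp: a_def b_def N_left_def N_right_def\<close>)
      show ?thesis
        unfolding kernel[of a b, OF nr]
        using integral_kernel_zero[where K = "\<lambda>i t. 1 / (of_real t - a i) - 1 / (of_real t - b i)", OF integrable_resolvent_diff[OF nr] r1]
          integral_kernel_zero[where K = "\<lambda>i t. 1 / (of_real t - cnj (a i)) - 1 / (of_real t - cnj (b i))", OF integrable_resolvent_diff[OF nrc] r2]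
        by simp
    qed
    moreover have "(\<lambda>n. \<integral>t. (\<Prod>l\<in>UNIV. weighted (a l) (b l) (t $ l)) \<partial>X (s n)) \<longlonglongrightarrow> (\<integral>t. (\<Prod>l\<in>UNIV. weighted (a l) (b l) (t $ l)) \<partial>\<nu>)"
      by (intro conv weighted_prod nr)
    ultimately show "(\<integral>t. (\<Prod>l\<in>UNIV. weighted (N_left (\<rho> l) (z $ l)) (N_right (\<rho> l) (z $ l)) (t $ l)) \<partial>\<nu>) = 0"
      unfolding a_def b_def by (simp add: LIMSEQ_const_iff)
  qed
qed

section \<open>Integral representation\<close>

definition decay :: "real ^ 'n \<Rightarrow> real" where
  "decay t = (\<Prod>l\<in>UNIV. 1 / (1 + (t $ l)\<^sup>2))"

lemma decay_pos: "decay t > 0"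
  unfolding decay_def by (intro prod_pos) (auto simp: add_pos_nonneg)

lemma continuous_decay: "continuous_on UNIV decay"
proof -
  have "1 + (t $ l)\<^sup>2 \<noteq> (0::real)" for t :: "real ^ 'n" and l
    using zero_le_power2[of "t $ l"] by linarith
  then show ?thesis unfolding decay_def[abs_def] by (intro continuous_intros) auto
qed

lemma measurable_decay: "decay \<in> borel_measurable borel"
  by (rule borel_measurable_continuous_onI[OF continuous_decay])

text \<open>Turns the growth condition on a representing measure into finiteness of the total mass,
  the setting in which the bounded kernels \<open>weighted\<close> are integrated.\<close>

definition decayed :: "(real ^ 'n) measure \<Rightarrow> (real ^ 'n) measure" where
  "decayed \<mu> = density \<mu> (\<lambda>t. ennreal (decay t))"

lemma sets_decayed [simp]: "sets (decayed \<mu>) = sets \<mu>"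
  by (simp add: decayed_def)

lemma measurable_borel_sets: "sets M = sets borel \<Longrightarrow> f \<in> borel_measurable borel \<Longrightarrow> f \<in> borel_measurable M"
  using measurable_cong_sets[of M borel borel borel] by simp

lemma integral_decayed:
  fixes g :: "real ^ 'n \<Rightarrow> complex"
  assumes "sets \<mu> = sets borel" "g \<in> borel_measurable borel"
  shows "(\<integral>t. g t \<partial>decayed \<mu>) = (\<integral>t. of_real (decay t) * g t \<partial>\<mu>)"
  unfolding decayed_def using less_imp_le[OF decay_pos]
  by (subst integral_density) (auto simp: measurable_borel_sets[OF assms(1)] assms(2) measurable_decay scaleR_conv_of_real)

lemma emeasure_decayed:
  assumes "sets \<mu> = sets borel"
  shows "emeasure (decayed \<mu>) UNIV = (\<integral>\<^sup>+t. ennreal (\<Prod>l\<in>UNIV. 1 / (1 + (t $ l)\<^sup>2)) \<partial>\<mu>)"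
  unfolding decayed_def using assms sets_eq_imp_space_eq[OF assms]
  by (subst emeasure_density) (auto intro!: measurable_compose[OF measurable_borel_sets[OF assms measurable_decay]] simp: decay_def)

lemma finite_decayed:
  assumes "herglotz_triple h a b \<mu>"
  shows "sets \<mu> = sets borel" "finite_measure (decayed \<mu>)" "sets (decayed \<mu>) = sets borel"
proof -
  show s: "sets \<mu> = sets borel" using assms by (simp add: herglotz_triple_def)
  then show "sets (decayed \<mu>) = sets borel" by simp
  have "space (decayed \<mu>) = UNIV" using sets_eq_imp_space_eq[OF s] by (simp add: decayed_def)
  then show "finite_measure (decayed \<mu>)"
    using assms emeasure_decayed[OF s] by (intro finite_measureI) (auto simp: herglotz_triple_def)
qed

definition wint :: "(real ^ 'n) measure \<Rightarrow> ('n \<Rightarrow> complex) \<Rightarrow> ('n \<Rightarrow> complex) \<Rightarrow> complex" where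
  "wint \<nu> a b = (\<integral>t. (\<Prod>l\<in>UNIV. weighted (a l) (b l) (t $ l)) \<partial>\<nu>)"

lemma decay_weighted:
  "of_real (decay t) * (\<Prod>l\<in>UNIV. weighted (a l) (b l) (t $ l))
    = (\<Prod>l\<in>UNIV. 1 / (of_real (t $ l) - a l) - 1 / (of_real (t $ l) - b l))"
proof -
  have "of_real (decay t) * (\<Prod>l\<in>UNIV. weighted (a l) (b l) (t $ l))
    = (\<Prod>l\<in>UNIV. of_real (1 / (1 + (t $ l)\<^sup>2)) * weighted (a l) (b l) (t $ l))"
    unfolding decay_def of_real_prod prod.distrib ..
  also have "\<dots> = (\<Prod>l\<in>UNIV. weighted (a l) (b l) (t $ l) / of_real (1 + (t $ l)\<^sup>2))"
    by (intro prod.cong) auto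
  finally show ?thesis by (simp only: weighted_divide)
qed

lemma measurable_weighted_prod:
  fixes a b :: "'n::finite \<Rightarrow> complex"
  assumes "\<And>i. a i \<notin> \<real>" "\<And>i. b i \<notin> \<real>"
  shows "(\<lambda>t :: real ^ 'n. \<Prod>i\<in>I. weighted (a i) (b i) (t $ i)) \<in> borel_measurable borel"
  by (intro borel_measurable_continuous_onI weighted_prod(1) assms)

lemma wint_decayed:
  assumes "sets \<mu> = sets borel" "\<And>l. a l \<notin> \<real>" "\<And>l. b l \<notin> \<real>"
  shows "wint (decayed \<mu>) a b = (\<integral>t. (\<Prod>l\<in>UNIV. 1 / (of_real (t $ l) - a l) - 1 / (of_real (t $ l) - b l)) \<partial>\<mu>)"
  unfolding wint_def by (simp only: integral_decayed[OF assms(1) measurable_weighted_prod[OF assms(2,3)]] decay_weighted)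

lemma weighted_i: "weighted \<i> (- \<i>) t = 2 * \<i>"
proof -
  have "1 / (2 * \<i>) * (1 / (of_real t - \<i>) - 1 / (of_real t + \<i>)) = of_real (1 / (1 + t\<^sup>2))"
    using poisson_kernel_eq[of 1 t] by (simp add: add.commute)
  moreover have "x = 2 * \<i> * y" if "1 / (2 * \<i>) * x = y" for x y using that by (auto simp: field_simps)
  ultimately have "1 / (of_real t - \<i>) - 1 / (of_real t + \<i>) = 2 * \<i> * of_real (1 / (1 + t\<^sup>2))" by blast
  then show ?thesis using of_real_one_plus_square_nonzero[of t] by (simp add: weighted_def)
qed

lemma i_not_real: "\<i> \<notin> \<real>" "- \<i> \<notin> \<real>"
  by (simp_all add: complex_is_Real_iff)

text \<open>Collects \<open>\<i> * 2 / (2 * \<i>)^n\<close> from the kernel and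
  \<open>1 / pi^n\<close> from the representation; the type argument only carries the
  dimension.\<close>

definition herglotz_factor :: "'n::finite itself \<Rightarrow> complex" where
  "herglotz_factor _ = 2 * \<i> / (2 * of_real pi * \<i>) ^ CARD('n)"

text \<open>The second product in \<open>kernel_K\<close> is
  \<open>(2 * \<i>) ^ CARD('n) * decay t\<close>, so it contributes only the total mass. The
  dependence on \<open>z\<close> beyond the linear part sits in a single product of weighted
  resolvent differences.\<close>

lemma herglotz_formula_decayed:
  fixes \<mu> :: "(real ^ 'n) measure"
  assumes s: "sets \<mu> = sets borel" and f: "finite_measure (decayed \<mu>)" and z: "z \<in> offreal_poly"
  shows "herglotz_formula a b \<mu> z = of_real a + (\<Sum>j\<in>UNIV. of_real (b $ j) * z $ j)
    + herglotz_factor TYPE('n) * wint (decayed \<mu>) (\<lambda>l. z $ l) (\<lambda>_. - \<i>)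
    - \<i> * of_real (measure (decayed \<mu>) UNIV / pi ^ CARD('n))"
proof -
  interpret finite_measure "decayed \<mu>" by fact
  have sp: "space (decayed \<mu>) = UNIV" using sets_eq_imp_space_eq[OF s] by (simp add: decayed_def)
  have nr: "z $ l \<notin> \<real>" for l using z by (simp add: offreal_poly_def)
  define W where "W t = (\<Prod>l\<in>UNIV. weighted (z $ l) (- \<i>) (t $ l))" for t :: "real ^ 'n"
  have Wm: "W \<in> borel_measurable borel" unfolding W_def by (intro measurable_weighted_prod nr i_not_real)
  have Wi: "integrable (decayed \<mu>) W" unfolding W_def using s by (intro integrable_weighted_prod nr i_not_real f) simp
  have "kernel_K z t = of_real (decay t) * (\<i> * (2 / (2 * \<i>) ^ CARD('n) * W t - 1))" for t
  proof -
    have "(\<Prod>l\<in>UNIV. 1 / (of_real (t $ l) - \<i>) - 1 / (of_real (t $ l) + \<i>)) = of_real (decay t) * (2 * \<i>) ^ CARD('n)"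
      using decay_weighted[of t "\<lambda>_. \<i>" "\<lambda>_. - \<i>"] by (simp add: weighted_i)
    moreover have "(\<Prod>l\<in>UNIV. 1 / (of_real (t $ l) - z $ l) - 1 / (of_real (t $ l) + \<i>)) = of_real (decay t) * W t"
      using decay_weighted[of t "\<lambda>l. z $ l" "\<lambda>_. - \<i>"] by (simp add: W_def)
    ultimately show ?thesis unfolding kernel_K_def by (simp add: algebra_simps)
  qed
  then have "(\<integral>t. kernel_K z t \<partial>\<mu>) = (\<integral>t. of_real (decay t) * (\<i> * (2 / (2 * \<i>) ^ CARD('n) * W t - 1)) \<partial>\<mu>)"
    by (simp only:)
  also have "\<dots> = (\<integral>t. \<i> * (2 / (2 * \<i>) ^ CARD('n) * W t - 1) \<partial>decayed \<mu>)"
    by (intro integral_decayed[symmetric] s borel_measurable_times borel_measurable_diff borel_measurable_const Wm)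
  also have "\<dots> = \<i> * (2 / (2 * \<i>) ^ CARD('n) * (\<integral>t. W t \<partial>decayed \<mu>) - of_real (measure (decayed \<mu>) UNIV))"
    using Wi by (simp add: sp scaleR_conv_of_real)
  finally have "1 / of_real pi ^ CARD('n) * (\<integral>t. kernel_K z t \<partial>\<mu>)
    = 1 / of_real pi ^ CARD('n) * (\<i> * (2 / (2 * \<i>) ^ CARD('n) * (\<integral>t. W t \<partial>decayed \<mu>) - of_real (measure (decayed \<mu>) UNIV)))" by simp
  also have "\<dots> = herglotz_factor TYPE('n) * (\<integral>t. W t \<partial>decayed \<mu>) - \<i> * of_real (measure (decayed \<mu>) UNIV / pi ^ CARD('n))"
    by (simp add: herglotz_factor_def power_mult_distrib right_diff_distrib mult_ac)
  finally show ?thesis unfolding herglotz_formula_def W_def wint_def by simp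
qed

lemma factor_N_prod_integral:
  fixes \<mu> :: "(real ^ 'n) measure"
  assumes s: "sets \<mu> = sets borel" and z: "z \<in> upper_poly"
  shows "(\<integral>t. (\<Prod>j\<in>UNIV. factor_N (\<rho> j) (z $ j) (t $ j)) \<partial>\<mu>)
    = (1 / (2 * \<i>)) ^ CARD('n) * wint (decayed \<mu>) (\<lambda>l. N_left (\<rho> l) (z $ l)) (\<lambda>l. N_right (\<rho> l) (z $ l))"
proof -
  have zl: "Im (z $ l) > 0" for l using z by (simp add: upper_poly_def)
  show ?thesis
    by (subst wint_decayed[OF s N_left_right_not_real[OF zl]])
       (simp only: factor_N_eq prod.distrib prod_constant integral_mult_right_zero)
qed

lemma offreal_of_upper: "z \<in> upper_poly \<Longrightarrow> z \<in> offreal_poly"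
  by (auto simp: upper_poly_def offreal_poly_def complex_is_Real_iff) (metis less_irrefl)

lemma herglotz_triple_exists:
  fixes h :: "complex ^ 'n \<Rightarrow> complex"
  assumes h: "herglotz_nevanlinna h"
  shows "\<exists>a b \<mu>. herglotz_triple h a b \<mu>"
proof -
  define one :: "complex ^ 'n" where "one = (\<chi> i. \<i>)"
  have one: "one \<in> upper_poly" by (simp add: one_def upper_poly_def)
  obtain b :: "real ^ 'n" where b: "\<And>j. b $ j \<ge> 0"
    and F: "herglotz_nevanlinna (\<lambda>z. h z - (\<Sum>j\<in>UNIV. of_real (b $ j) * z $ j))"
    and growth: "\<And>j z. z \<in> upper_poly \<Longrightarrow>
      ((\<lambda>y. (h (set_comp z j (\<i> * of_real y)) - (\<Sum>k\<in>UNIV. of_real (b $ k) * set_comp z j (\<i> * of_real y) $ k))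
        / (\<i> * of_real y)) \<longlongrightarrow> 0) at_top"
    by (rule herglotz_subtract_linear[OF h]) (rule that; blast)
  define F' where "F' z = h z - (\<Sum>j\<in>UNIV. of_real (b $ j) * z $ j)" for z
  have F': "herglotz_nevanlinna F'" using F by (simp add: F'_def[abs_def])
  have growth': "((\<lambda>y. F' (set_comp (\<chi> i. \<i>) j (\<i> * of_real y)) / (\<i> * of_real y)) \<longlongrightarrow> 0) at_top" for j
    unfolding F'_def using growth[OF one, of j] by (simp only: one_def)
  obtain \<nu> :: "(real ^ 'n) measure" where \<nu>: "finite_measure \<nu>" "sets \<nu> = sets borel"
    and mass: "measure \<nu> UNIV = pi ^ CARD('n) * Im (F' one)"
    and rep: "\<And>z. z \<in> upper_poly \<Longrightarrow> (\<integral>t. (\<Prod>l\<in>UNIV. weighted (z $ l) (- \<i>) (t $ l)) \<partial>\<nu>)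
       = (2 * of_real pi * \<i>) ^ CARD('n) * (F' z - cnj (F' one)) / (2 * \<i>)"
    and mixed: "\<And>z \<rho>. z \<in> upper_poly \<Longrightarrow> -1 \<in> range \<rho> \<Longrightarrow> 1 \<in> range \<rho> \<Longrightarrow>
       (\<integral>t. (\<Prod>l\<in>UNIV. weighted (N_left (\<rho> l) (z $ l)) (N_right (\<rho> l) (z $ l)) (t $ l)) \<partial>\<nu>) = 0"
    by (rule herglotz_boundary_measure_exists[OF F' growth']) (rule that; (simp only: one_def)?; blast)
  \<comment> \<open>The limit measure already contains the weight, so the representing measure is
    obtained by dividing it out.\<close>
  define \<mu> where "\<mu> = density \<nu> (\<lambda>t. ennreal (1 / decay t))"
  have s: "sets \<mu> = sets borel" by (simp add: \<mu>_def \<nu>)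
  have m1: "decay \<in> borel_measurable \<nu>" by (rule measurable_borel_sets[OF \<nu>(2) measurable_decay])
  have "decayed \<mu> = density \<nu> (\<lambda>t. ennreal (1 / decay t) * ennreal (decay t))"
    unfolding decayed_def \<mu>_def using m1 by (intro density_density_eq) auto
  also have "(\<lambda>t. ennreal (1 / decay t) * ennreal (decay t)) = (\<lambda>t :: real ^ 'n. 1)"
  proof
    fix t :: "real ^ 'n"
    have "ennreal (1 / decay t) * ennreal (decay t) = ennreal (1 / decay t * decay t)"
      using decay_pos[of t] by (intro ennreal_mult[symmetric]) auto
    then show "ennreal (1 / decay t) * ennreal (decay t) = 1" using decay_pos[of t] by simp
  qed
  finally have dec: "decayed \<mu> = \<nu>" by (simp add: density_1)
  \<comment> \<open>The Cauchy formula produces \<open>F' z - cnj (F' one)\<close>, and the mass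
    term subtracts \<open>\<i> * Im (F' one)\<close>; the real constant must be
    \<open>Re (F' one)\<close> for the two to cancel.\<close>
  have "herglotz_triple h (Re (F' one)) b \<mu>"
    unfolding herglotz_triple_def
  proof (intro conjI allI ballI b s)
    interpret finite_measure \<nu> by (rule \<nu>)
    show "(\<integral>\<^sup>+t. ennreal (\<Prod>l\<in>UNIV. 1 / (1 + (t $ l)\<^sup>2)) \<partial>\<mu>) < \<infinity>"
      using emeasure_decayed[OF s] emeasure_finite[of UNIV] by (simp add: dec less_top)
  next
    fix z :: "complex ^ 'n" assume z: "z \<in> upper_poly"
    show "(\<Sum>\<rho> | range \<rho> \<subseteq> {-1, 0, 1} \<and> -1 \<in> range \<rho> \<and> 1 \<in> range \<rho>.
           \<integral>t. (\<Prod>j\<in>UNIV. factor_N (\<rho> j) (z $ j) (t $ j)) \<partial>\<mu>) = 0"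
      by (intro sum.neutral ballI) (auto simp: factor_N_prod_integral[OF s z] dec wint_def mixed[OF z])
    have zo: "z \<in> offreal_poly" by (rule offreal_of_upper[OF z])
    have "herglotz_factor TYPE('n) * wint \<nu> (\<lambda>l. z $ l) (\<lambda>_. - \<i>) = F' z - cnj (F' one)"
      by (simp add: wint_def rep[OF z] herglotz_factor_def diff_divide_distrib)
    then have "herglotz_formula (Re (F' one)) b \<mu> z = of_real (Re (F' one)) + (\<Sum>j\<in>UNIV. of_real (b $ j) * z $ j)
      + (F' z - cnj (F' one)) - \<i> * of_real (Im (F' one))"
      using herglotz_formula_decayed[OF s _ zo, of "Re (F' one)" b] \<nu> by (simp add: dec mass)
    also have "\<dots> = (\<Sum>j\<in>UNIV. of_real (b $ j) * z $ j) + F' z"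
      by (simp add: complex_eq_iff)
    also have "\<dots> = h z" by (simp add: F'_def)
    finally show "h z = herglotz_formula (Re (F' one)) b \<mu> z" ..
  qed
  then show ?thesis by blast
qed

section \<open>Separation of the mixed terms\<close>

lemma resolvent_identity:
  fixes a b s :: complex
  assumes "a \<noteq> 0" "b \<noteq> 0"
  shows "s / (a * b) - s / b\<^sup>2 = (b - a) * (s / (a * b\<^sup>2))"
  using assms by (simp add: field_simps power2_eq_square)

text \<open>Differentiation under the integral: by the resolvent identity, the difference quotient
  minus the expected derivative is \<open>w - u\<close> times an integral that stays bounded while
  \<open>Im w \<ge> Im u / 2\<close>.\<close>

lemma cauchy_transform_holomorphic:
  fixes \<nu> :: "(real ^ 'n) measure" and S :: "real ^ 'n \<Rightarrow> complex"
  assumes \<nu>: "finite_measure \<nu>" "sets \<nu> = sets borel"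
    and S: "S \<in> borel_measurable borel" "\<And>t. cmod (S t) \<le> B"
  shows "(\<lambda>u. \<integral>t. S t / (of_real (t $ j) - u) \<partial>\<nu>) holomorphic_on {u. Im u > 0}"
  unfolding holomorphic_on_open[OF open_halfspace_Im_gt]
proof
  interpret finite_measure \<nu> by fact
  have B0: "B \<ge> 0" using S(2)[of 0] norm_ge_zero[of "S 0"] by linarith
  fix u :: complex assume "u \<in> {u. Im u > 0}"
  then have u: "Im u > 0" by simp
  have le: "Im v \<le> cmod (of_real x - v)" for v x using Im_le_norm_diff[of v x] by linarith
  have ne: "of_real x - v \<noteq> 0" if "Im v > 0" for v x using le[of v x] that by auto
  have tm: "(\<lambda>t :: real ^ 'n. complex_of_real (t $ j)) \<in> borel_measurable borel"
    by (intro borel_measurable_continuous_onI continuous_intros)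
  \<comment> \<open>The exponents \<open>k = 0\<close>, \<open>1\<close> and \<open>2\<close> give
    the transform, its derivative and the remainder.\<close>
  have int: "integrable \<nu> (\<lambda>t. S t / ((of_real (t $ j) - v) * (of_real (t $ j) - w) ^ k))"
    if v: "Im v > 0" and w: "Im w > 0" for v w k
  proof (rule integrable_const_bound[where B = "B / (Im v * Im w ^ k)"])
    show "AE t in \<nu>. cmod (S t / ((of_real (t $ j) - v) * (of_real (t $ j) - w) ^ k)) \<le> B / (Im v * Im w ^ k)"
      unfolding norm_divide norm_mult norm_power
      using v w by (intro AE_I2 frac_le mult_mono power_mono le S B0 mult_pos_pos zero_less_power zero_le_power mult_nonneg_nonneg) auto
    show "(\<lambda>t. S t / ((of_real (t $ j) - v) * (of_real (t $ j) - w) ^ k)) \<in> borel_measurable \<nu>"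
      by (intro measurable_borel_sets[OF \<nu>(2)] borel_measurable_divide S borel_measurable_times borel_measurable_power
          borel_measurable_diff tm borel_measurable_const)
  qed
  define Q where "Q v = (\<integral>t. S t / (of_real (t $ j) - v) \<partial>\<nu>)" for v
  define D where "D = (\<integral>t. S t / (of_real (t $ j) - u)\<^sup>2 \<partial>\<nu>)"
  define C where "C = B / (Im u / 2 * (Im u)\<^sup>2) * measure \<nu> (space \<nu>)"
  have est: "cmod ((Q w - Q u) / (w - u) - D) \<le> cmod (w - u) * C" if w: "cmod (w - u) < Im u / 2" "w \<noteq> u" for w
  proof -
    have "\<bar>Im w - Im u\<bar> < Im u / 2" using w abs_Im_le_cmod[of "w - u"] by simp
    then have imw: "Im w \<ge> Im u / 2" "Im w > 0" using u by linarith+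
    have "Q w - Q u = (\<integral>t. S t / (of_real (t $ j) - w) - S t / (of_real (t $ j) - u) \<partial>\<nu>)"
      unfolding Q_def using int[OF imw(2) u, of 0] int[OF u u, of 0] by simp
    then have "(Q w - Q u) / (w - u) - D =
      (\<integral>t. (S t / (of_real (t $ j) - w) - S t / (of_real (t $ j) - u)) / (w - u) - S t / (of_real (t $ j) - u)\<^sup>2 \<partial>\<nu>)"
      unfolding D_def using int[OF imw(2) u, of 0] int[OF u u, of 0] int[OF u u, of 1] by (simp add: power2_eq_square)
    also have "\<dots> = (\<integral>t. (w - u) * (S t / ((of_real (t $ j) - w) * (of_real (t $ j) - u)\<^sup>2)) \<partial>\<nu>)"
    proof (rule Bochner_Integration.integral_cong[OF refl])
      fix t :: "real ^ 'n"
      have "(s / (x - w) - s / (x - u)) / (w - u) - s / (x - u)\<^sup>2 = (w - u) * (s / ((x - w) * (x - u)\<^sup>2))"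
        if x: "x - w \<noteq> 0" "x - u \<noteq> 0" for s x
      proof -
        have "s / (x - w) - s / (x - u) = s * (w - u) / ((x - w) * (x - u))"
          using x by (simp add: diff_frac_eq right_diff_distrib)
        then have "(s / (x - w) - s / (x - u)) / (w - u) = s / ((x - w) * (x - u))" using w by simp
        also have "\<dots> - s / (x - u)\<^sup>2 = ((x - u) - (x - w)) * (s / ((x - w) * (x - u)\<^sup>2))"
          using resolvent_identity[OF x] .
        also have "(x - u) - (x - w) = w - u" by simp
        finally show ?thesis .
      qed
      then show "(S t / (of_real (t $ j) - w) - S t / (of_real (t $ j) - u)) / (w - u) - S t / (of_real (t $ j) - u)\<^sup>2
        = (w - u) * (S t / ((of_real (t $ j) - w) * (of_real (t $ j) - u)\<^sup>2))"
        using ne imw u by blast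
    qed
    also have "\<dots> = (w - u) * (\<integral>t. S t / ((of_real (t $ j) - w) * (of_real (t $ j) - u)\<^sup>2) \<partial>\<nu>)"
      by (rule integral_mult_right_zero)
    finally have eq: "(Q w - Q u) / (w - u) - D = (w - u) * (\<integral>t. S t / ((of_real (t $ j) - w) * (of_real (t $ j) - u)\<^sup>2) \<partial>\<nu>)" .
    have "cmod (\<integral>t. S t / ((of_real (t $ j) - w) * (of_real (t $ j) - u)\<^sup>2) \<partial>\<nu>) \<le> (\<integral>t. B / (Im u / 2 * (Im u)\<^sup>2) \<partial>\<nu>)"
    proof (rule order.trans[OF integral_norm_bound integral_mono])
      show "integrable \<nu> (\<lambda>t. cmod (S t / ((of_real (t $ j) - w) * (of_real (t $ j) - u)\<^sup>2)))"
        by (intro integrable_norm int imw u)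
      show "cmod (S t / ((of_real (t $ j) - w) * (of_real (t $ j) - u)\<^sup>2)) \<le> B / (Im u / 2 * (Im u)\<^sup>2)" for t
        unfolding norm_divide norm_mult norm_power
        using u imw order.trans[OF imw(1) le[of w]]
        by (intro frac_le mult_mono power_mono le S B0 mult_pos_pos zero_less_power zero_le_power mult_nonneg_nonneg) auto
    qed auto
    also have "\<dots> = C" by (simp add: C_def)
    finally show ?thesis unfolding eq norm_mult by (intro mult_left_mono) auto
  qed
  have "((\<lambda>w. (Q w - Q u) / (w - u) - D) \<longlongrightarrow> 0) (at u)"
  proof (rule Lim_null_comparison)
    show "\<forall>\<^sub>F w in at u. cmod ((Q w - Q u) / (w - u) - D) \<le> cmod (w - u) * C"
      unfolding eventually_at using u est by (intro exI[of _ "Im u / 2"]) (auto simp: dist_norm)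
    have "((\<lambda>w. cmod (w - u) * C) \<longlongrightarrow> cmod (u - u) * C) (at u)" by (intro tendsto_intros)
    then show "((\<lambda>w. cmod (w - u) * C) \<longlongrightarrow> 0) (at u)" by simp
  qed
  then have "(Q has_field_derivative D) (at u)"
    unfolding has_field_derivative_iff by (simp add: LIM_zero_iff)
  then show "\<exists>f'. ((\<lambda>u. \<integral>t. S t / (of_real (t $ j) - u) \<partial>\<nu>) has_field_derivative f') (at u)"
    unfolding Q_def by blast
qed

text \<open>By \<open>weighted_eq\<close>, the integrand depends on \<open>u\<close> only through
  \<open>u - \<i>\<close> and the resolvent at \<open>u\<close>. The bounded rest \<open>R\<close>
  is absorbed into the density of a Cauchy transform.\<close>

lemma weighted_transform_holomorphic:
  fixes \<nu> :: "(real ^ 'n) measure" and S :: "real ^ 'n \<Rightarrow> complex"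
  assumes \<nu>: "finite_measure \<nu>" "sets \<nu> = sets borel"
    and S: "S \<in> borel_measurable borel" "\<And>t. cmod (S t) \<le> B"
  shows "(\<lambda>u. \<integral>t. weighted u \<i> (t $ j) * S t \<partial>\<nu>) holomorphic_on {u. Im u > 0}"
proof -
  interpret finite_measure \<nu> by fact
  define c where "c t = 1 + (\<i> + \<i>) / (of_real t - \<i>)" for t :: real
  have ne: "complex_of_real t - \<i> \<noteq> 0" for t by (auto simp: complex_eq_iff)
  have cc: "continuous_on UNIV c" unfolding c_def by (intro continuous_intros) (use ne in auto)
  have cb: "cmod (c t) \<le> 3" for t
  proof -
    have "1 \<le> cmod (of_real t - \<i>)" using Im_le_norm_diff[of \<i> t] by simp
    then have "cmod ((\<i> + \<i>) / (of_real t - \<i>)) \<le> 2"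
      unfolding norm_divide by (simp add: divide_simps)
    then show ?thesis unfolding c_def using norm_triangle_ineq[of 1 "(\<i> + \<i>) / (of_real t - \<i>)"] by simp
  qed
  have cm: "(\<lambda>t :: real ^ 'n. c (t $ j)) \<in> borel_measurable borel"
    by (intro borel_measurable_continuous_onI continuous_on_compose2[OF cc] continuous_intros) auto
  define R where "R t = c (t $ j) * S t" for t
  have Rm: "R \<in> borel_measurable borel" unfolding R_def by (intro borel_measurable_times cm S)
  have Rb: "cmod (R t) \<le> 3 * B" for t
    unfolding R_def norm_mult by (intro mult_mono cb S) auto
  have Ri: "integrable \<nu> R"
    by (rule integrable_const_bound[where B = "3 * B"]) (use Rb measurable_borel_sets[OF \<nu>(2) Rm] in auto)
  have "(\<integral>t. weighted u \<i> (t $ j) * S t \<partial>\<nu>) = (u - \<i>) * ((\<integral>t. R t \<partial>\<nu>) + (u - \<i>) * (\<integral>t. R t / (of_real (t $ j) - u) \<partial>\<nu>))"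
    if u: "u \<in> {u. Im u > 0}" for u
  proof -
    have un: "u \<notin> \<real>" using u by (auto simp: complex_is_Real_iff)
    have "integrable \<nu> (\<lambda>t. R t / (of_real (t $ j) - u))"
    proof (rule integrable_const_bound[where B = "3 * B / Im u"])
      have le: "Im u \<le> cmod (of_real x - u)" for x using Im_le_norm_diff[of u x] by linarith
      have B0: "3 * B \<ge> 0" using Rb[of 0] norm_ge_zero[of "R 0"] by linarith
      show "AE t in \<nu>. cmod (R t / (of_real (t $ j) - u)) \<le> 3 * B / Im u"
        unfolding norm_divide using u by (intro AE_I2 frac_le Rb le B0) auto
      show "(\<lambda>t. R t / (of_real (t $ j) - u)) \<in> borel_measurable \<nu>"
        by (intro measurable_borel_sets[OF \<nu>(2)] borel_measurable_divide Rm borel_measurable_diff borel_measurable_const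
            borel_measurable_continuous_onI[of "\<lambda>t :: real ^ 'n. complex_of_real (t $ j)"] continuous_intros)
    qed
    then have i2: "integrable \<nu> (\<lambda>t. (u - \<i>) * (R t / (of_real (t $ j) - u)))"
      by (rule integrable_mult_right)
    have "(u - \<i>) * ((\<integral>t. R t \<partial>\<nu>) + (u - \<i>) * (\<integral>t. R t / (of_real (t $ j) - u) \<partial>\<nu>))
      = (\<integral>t. (u - \<i>) * (R t + (u - \<i>) * (R t / (of_real (t $ j) - u))) \<partial>\<nu>)"
      by (simp only: integral_mult_right_zero Bochner_Integration.integral_add[OF Ri i2])
    also have "\<dots> = (\<integral>t. weighted u \<i> (t $ j) * S t \<partial>\<nu>)"
    proof (rule Bochner_Integration.integral_cong[OF refl])
      fix t :: "real ^ 'n"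
      have "(u - \<i>) * (y * s + (u - \<i>) * (y * s / x)) = (u - \<i>) * (1 + (u - \<i>) / x) * y * s" for x y s
        by (simp add: algebra_simps)
      then show "(u - \<i>) * (R t + (u - \<i>) * (R t / (of_real (t $ j) - u))) = weighted u \<i> (t $ j) * S t"
        unfolding weighted_eq[OF un i_not_real(1)] R_def c_def .
    qed
    finally show ?thesis ..
  qed
  then show ?thesis
    by (subst holomorphic_cong[OF refl])
       (auto intro!: holomorphic_intros cauchy_transform_holomorphic[OF \<nu> Rm Rb])
qed

text \<open>Since \<open>A = - B\<close> is holomorphic and antiholomorphic,
  \<open>A + cnj A\<close> and \<open>\<i> * (A - cnj A)\<close> are holomorphic and real-valued,
  hence constant. The value at \<open>\<i>\<close> fixes both constants.\<close>

lemma holomorphic_plus_antiholomorphic_zero: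
  assumes "A holomorphic_on {u. Im u > 0}" "(\<lambda>u. cnj (B u)) holomorphic_on {u. Im u > 0}"
    and sum: "\<And>u. Im u > 0 \<Longrightarrow> A u + B u = 0" and "A \<i> = 0" and u: "Im u > 0"
  shows "A u = 0"
proof -
  have c: "cnj (B v) = - cnj (A v)" if "Im v > 0" for v
    using sum[OF that] by (metis add_eq_0_iff complex_cnj_minus)
  have "A u + - cnj (B u) = A \<i> + - cnj (B \<i>)"
    by (rule real_valued_holomorphic_constant[of "\<lambda>u. A u + - cnj (B u)", OF _ open_halfspace_Im_gt connected_upper])
       (use assms in \<open>auto intro!: holomorphic_intros simp: c complex_is_Real_iff\<close>)
  moreover have "\<i> * (A u + cnj (B u)) = \<i> * (A \<i> + cnj (B \<i>))"
    by (rule real_valued_holomorphic_constant[of "\<lambda>u. \<i> * (A u + cnj (B u))", OF _ open_halfspace_Im_gt connected_upper])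
       (use assms in \<open>auto intro!: holomorphic_intros simp: c complex_is_Real_iff\<close>)
  ultimately show ?thesis using assms c[OF u] c[of \<i>] by simp
qed

lemma weighted_same [simp]: "weighted a a t = 0"
  by (simp add: weighted_def)

lemma cnj_weighted: "cnj (weighted a b t) = weighted (cnj a) (cnj b) t"
  by (simp add: weighted_def)

lemma weighted_swap: "weighted a b t = - weighted b a t"
  by (simp add: weighted_def right_diff_distrib)

lemma weighted_add: "weighted a b t + weighted b c t = weighted a c t"
  by (simp add: weighted_def right_diff_distrib)

context
  fixes \<nu> :: "(real ^ 'n) measure"
  assumes \<nu>: "finite_measure \<nu>" "sets \<nu> = sets borel"
begin

text \<open>A summand of the Nevanlinna condition, written for the weighted finite measure and
  without the common factor \<open>(1 / (2 * \<i>)) ^ CARD('n)\<close>.\<close>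

definition term_N :: "('n \<Rightarrow> int) \<Rightarrow> complex ^ 'n \<Rightarrow> complex" where
  "term_N \<rho> z = wint \<nu> (\<lambda>l. N_left (\<rho> l) (z $ l)) (\<lambda>l. N_right (\<rho> l) (z $ l))"

text \<open>At \<open>\<i>\<close> the two poles of the \<open>j\<close>-th factor coincide:
  \<open>z $ j = \<i>\<close> for \<open>\<rho> j = -1\<close>, and
  \<open>- \<i> = cnj (z $ j)\<close> for \<open>\<rho> j = 1\<close>.\<close>

lemma term_N_i:
  fixes z :: "complex ^ 'n"
  assumes "\<rho> j = -1 \<or> \<rho> j = 1" "z $ j = \<i>" shows "term_N \<rho> z = 0"
proof -
  have "weighted (N_left (\<rho> j) (z $ j)) (N_right (\<rho> j) (z $ j)) s = 0" for s
    using assms by (auto simp: N_left_def N_right_def)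
  then have "(\<Prod>l\<in>UNIV. weighted (N_left (\<rho> l) (z $ l)) (N_right (\<rho> l) (z $ l)) (t $ l)) = 0" for t :: "real ^ 'n"
    by (intro prod_zero) auto
  then show ?thesis unfolding term_N_def wint_def by (simp only: Bochner_Integration.integral_zero)
qed

lemma term_N_indep: "\<rho> j = 0 \<Longrightarrow> term_N \<rho> (set_comp z j u) = term_N \<rho> z"
  unfolding term_N_def wint_def
  by (intro Bochner_Integration.integral_cong prod.cong refl) (auto simp: N_left_def N_right_def)

lemma term_N_split:
  "term_N \<rho> (set_comp z j u) = (\<integral>t. weighted (N_left (\<rho> j) u) (N_right (\<rho> j) u) (t $ j) *
     (\<Prod>l\<in>UNIV - {j}. weighted (N_left (\<rho> l) (z $ l)) (N_right (\<rho> l) (z $ l)) (t $ l)) \<partial>\<nu>)"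
proof -
  have "(\<Prod>l\<in>UNIV. weighted (N_left (\<rho> l) (set_comp z j u $ l)) (N_right (\<rho> l) (set_comp z j u $ l)) (t $ l))
    = weighted (N_left (\<rho> j) u) (N_right (\<rho> j) u) (t $ j) *
     (\<Prod>l\<in>UNIV - {j}. weighted (N_left (\<rho> l) (z $ l)) (N_right (\<rho> l) (z $ l)) (t $ l))" for t :: "real ^ 'n"
    by (subst prod.remove[of UNIV j]) (auto intro!: prod.cong)
  then show ?thesis by (simp add: term_N_def wint_def)
qed

lemma term_N_holomorphic:
  fixes z :: "complex ^ 'n"
  assumes z: "z \<in> upper_poly"
  shows "\<rho> j = -1 \<Longrightarrow> (\<lambda>u. term_N \<rho> (set_comp z j u)) holomorphic_on {u. Im u > 0}"
    and "\<rho> j = 1 \<Longrightarrow> (\<lambda>u. cnj (term_N \<rho> (set_comp z j u))) holomorphic_on {u. Im u > 0}"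
proof -
  have zl: "Im (z $ l) > 0" for l using z by (simp add: upper_poly_def)
  define S where "S t = (\<Prod>l\<in>UNIV - {j}. weighted (N_left (\<rho> l) (z $ l)) (N_right (\<rho> l) (z $ l)) (t $ l))" for t :: "real ^ 'n"
  note nr = N_left_right_not_real[OF zl]
  have Sm: "S \<in> borel_measurable borel" unfolding S_def by (intro measurable_weighted_prod nr)
  have "bounded (range S)" unfolding S_def by (intro weighted_prod(2) nr)
  then obtain B where "\<forall>x\<in>range S. cmod x \<le> B" unfolding bounded_iff ..
  then have Sb: "cmod (S t) \<le> B" for t by simp
  have Sm': "(\<lambda>t. cnj (S t)) \<in> borel_measurable borel"
    unfolding S_def cnj_prod cnj_weighted
    by (intro measurable_weighted_prod) (use nr in \<open>auto simp: complex_is_Real_iff\<close>)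
  show "(\<lambda>u. term_N \<rho> (set_comp z j u)) holomorphic_on {u. Im u > 0}" if "\<rho> j = -1"
    using weighted_transform_holomorphic[OF \<nu> Sm Sb, of j] that
    by (simp add: term_N_split N_left_def N_right_def S_def)
  show "(\<lambda>u. cnj (term_N \<rho> (set_comp z j u))) holomorphic_on {u. Im u > 0}" if \<rho>: "\<rho> j = 1"
  proof -
    have "cnj (term_N \<rho> (set_comp z j u)) = - (\<integral>t. weighted u \<i> (t $ j) * cnj (S t) \<partial>\<nu>)" for u
    proof -
      have "cnj (term_N \<rho> (set_comp z j u)) = (\<integral>t. cnj (weighted (- \<i>) (cnj u) (t $ j) * S t) \<partial>\<nu>)"
        unfolding Bochner_Integration.integral_cnj using \<rho> by (simp add: term_N_split N_left_def N_right_def S_def)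
      also have "\<dots> = (\<integral>t. - (weighted u \<i> (t $ j) * cnj (S t)) \<partial>\<nu>)"
        by (intro Bochner_Integration.integral_cong) (auto simp: cnj_weighted weighted_swap[of \<i> u])
      finally show ?thesis by simp
    qed
    then show ?thesis
      using weighted_transform_holomorphic[OF \<nu> Sm', of B j] Sb by (auto intro!: holomorphic_intros)
  qed
qed

text \<open>In each variable the terms with \<open>\<rho> j = -1\<close> are holomorphic, those with \<open>\<rho> j = 1\<close> antiholomorphic,
  both vanish at \<open>\<i>\<close>, and those with \<open>\<rho> j = 0\<close> are constant; so a vanishing sum splits
  according to the value of \<open>\<rho> j\<close>, one variable after the other.\<close>

lemma term_N_zero:
  fixes z :: "complex ^ 'n"
  assumes sum: "\<And>z. z \<in> upper_poly \<Longrightarrow>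
      (\<Sum>\<rho> | range \<rho> \<subseteq> {-1, 0, 1} \<and> -1 \<in> range \<rho> \<and> 1 \<in> range \<rho>. term_N \<rho> z) = 0"
    and \<sigma>: "range \<sigma> \<subseteq> {-1, 0, 1}" "-1 \<in> range \<sigma>" "1 \<in> range \<sigma>" and z: "z \<in> upper_poly"
  shows "term_N \<sigma> z = 0"
proof -
  define M :: "('n \<Rightarrow> int) set" where "M = {\<rho>. range \<rho> \<subseteq> {-1, 0, 1} \<and> -1 \<in> range \<rho> \<and> 1 \<in> range \<rho>}"
  have "finite {\<rho> :: 'n \<Rightarrow> int. range \<rho> \<subseteq> {-1, 0, 1}}"
    using finite_set_of_finite_funs[of "UNIV :: 'n set" "{-1, 0, 1 :: int}" undefined]
    by (simp add: image_subset_iff)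
  then have finM: "finite M" by (rule rev_finite_subset) (auto simp: M_def)
  \<comment> \<open>Induction on the set \<open>J\<close> of coordinates in which
    \<open>\<rho>\<close> is prescribed: \<open>J = {}\<close> is the hypothesis, and
    \<open>J = UNIV\<close> isolates one term.\<close>
  have "(\<Sum>\<rho> | \<rho> \<in> M \<and> (\<forall>l\<in>J. \<rho> l = \<tau> l). term_N \<rho> z) = 0"
    if "z \<in> upper_poly" "range \<tau> \<subseteq> {-1, 0, 1}" for J \<tau> z
    using finite[of J] that
  proof (induction J arbitrary: \<tau> z rule: finite_induct)
    case empty
    then show ?case using sum by (simp add: M_def)
  next
    case (insert j J)
    define Q where "Q c z = (\<Sum>\<rho> | \<rho> \<in> M \<and> (\<forall>l\<in>J. \<rho> l = \<tau> l) \<and> \<rho> j = c. term_N \<rho> z)" for c z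
    have tot: "Q (-1) w + Q 0 w + Q 1 w = 0" if w: "w \<in> upper_poly" for w
    proof -
      let ?A = "{\<rho>. \<rho> \<in> M \<and> (\<forall>l\<in>J. \<rho> l = \<tau> l)}"
      have finA: "finite ?A" by (rule rev_finite_subset[OF finM]) auto
      have "(\<Sum>\<rho>\<in>?A. term_N \<rho> w) = (\<Sum>c\<in>{-1, 0, 1}. \<Sum>\<rho> | \<rho> \<in> ?A \<and> \<rho> j = c. term_N \<rho> w)"
        by (rule sum.group[symmetric, OF finA]) (auto simp: M_def)
      also have "\<dots> = Q (-1) w + Q 0 w + Q 1 w"
        by (simp add: Q_def add.assoc conj_assoc)
      finally show ?thesis using insert.IH[OF w insert.prems(2)] by simp
    qed
    have Qi: "Q c w = 0" if "c = -1 \<or> c = 1" "w $ j = \<i>" for c w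
      unfolding Q_def by (intro sum.neutral ballI term_N_i[of _ j]) (use that in auto)
    have Q0: "Q 0 w = 0" if w: "w \<in> upper_poly" for w
    proof -
      have "Q 0 w = Q 0 (set_comp w j \<i>)" unfolding Q_def by (intro sum.cong) (auto simp: term_N_indep)
      also have "\<dots> = 0" using tot[OF set_comp_upper[OF w, of \<i> j]] Qi[of "-1" "set_comp w j \<i>"] Qi[of 1 "set_comp w j \<i>"] by simp
      finally show ?thesis .
    qed
    have Qm: "Q (-1) w = 0" if w: "w \<in> upper_poly" for w
    proof -
      have "Q (-1) (set_comp w j (w $ j)) = 0"
      proof (rule holomorphic_plus_antiholomorphic_zero[where A = "\<lambda>u. Q (-1) (set_comp w j u)" and B = "\<lambda>u. Q 1 (set_comp w j u)"])
        show "(\<lambda>u. Q (-1) (set_comp w j u)) holomorphic_on {u. Im u > 0}"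
          unfolding Q_def by (intro holomorphic_on_sum term_N_holomorphic(1)[OF w]) auto
        show "(\<lambda>u. cnj (Q 1 (set_comp w j u))) holomorphic_on {u. Im u > 0}"
          unfolding Q_def cnj_sum by (intro holomorphic_on_sum term_N_holomorphic(2)[OF w]) auto
        show "Q (-1) (set_comp w j u) + Q 1 (set_comp w j u) = 0" if "Im u > 0" for u
          using tot[OF set_comp_upper[OF w that, of j]] Q0[OF set_comp_upper[OF w that, of j]] by simp
        show "Q (-1) (set_comp w j \<i>) = 0" by (rule Qi) auto
        show "Im (w $ j) > 0" using w by (simp add: upper_poly_def)
      qed
      then show ?thesis by simp
    qed
    have "Q (\<tau> j) z = 0"
      using insert.prems tot[of z] Q0[of z] Qm[of z] by (auto simp: image_subset_iff) (metis add.right_neutral add_0)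
    then show ?case by (simp add: Q_def conj_assoc conj_commute)
  qed
  from this[OF z \<sigma>(1), of UNIV]
  have "(\<Sum>\<rho> | \<rho> \<in> M \<and> \<rho> = \<sigma>. term_N \<rho> z) = 0" by (simp add: fun_eq_iff)
  moreover have "{\<rho>. \<rho> \<in> M \<and> \<rho> = \<sigma>} = {\<sigma>}" using \<sigma> by (auto simp: M_def)
  ultimately show ?thesis by simp
qed

end

section \<open>Variable non-dependence and symmetry\<close>

lemma Psi_nth [simp]: "Psi B z w $ j = (if j \<in> B then cnj (w $ j) else z $ j)"
  by (simp add: Psi_def)

lemma offreal_Im: "z \<in> offreal_poly \<longleftrightarrow> (\<forall>j. Im (z $ j) \<noteq> 0)" for z :: "complex ^ 'n"
  by (simp add: offreal_poly_def complex_is_Real_iff)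

lemma Psi_offreal: "z \<in> offreal_poly \<Longrightarrow> Psi B (\<chi> j. \<i>) z \<in> offreal_poly"
  by (simp add: offreal_Im)

text \<open>At an upper index the kernel splits at the pole \<open>\<i>\<close> into a factor of
  type \<open>-1\<close> and one of type \<open>0\<close>; at a lower index it is minus a factor of
  type \<open>1\<close> at the conjugate point. Expanding the product, every choice of a nonempty
  set \<open>X\<close> of type \<open>-1\<close> indices is a mixed term and vanishes, since some
  index is lower.\<close>

lemma wint_lower:
  fixes \<nu> :: "(real ^ 'n) measure" and z :: "complex ^ 'n"
  assumes \<nu>: "finite_measure \<nu>" "sets \<nu> = sets borel"
    and mixed: "\<And>\<sigma> z. range \<sigma> \<subseteq> {-1, 0, 1} \<Longrightarrow> -1 \<in> range \<sigma> \<Longrightarrow> 1 \<in> range \<sigma> \<Longrightarrow> z \<in> upper_poly \<Longrightarrow> term_N \<nu> \<sigma> z = 0"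
    and z: "z \<in> offreal_poly" and L: "lower_indices z \<noteq> {}"
  shows "wint \<nu> (\<lambda>l. z $ l) (\<lambda>_. - \<i>) = (-1) ^ card (lower_indices z) *
    term_N \<nu> (\<lambda>l. if l \<in> lower_indices z then 1 else 0) (\<chi> l. if l \<in> lower_indices z then cnj (z $ l) else z $ l)"
proof -
  define L where "L = lower_indices z"
  define U where "U = UNIV - L"
  define z' where "z' = (\<chi> l. if l \<in> L then cnj (z $ l) else z $ l)"
  define \<rho> :: "'n set \<Rightarrow> 'n \<Rightarrow> int" where "\<rho> X l = (if l \<in> X then -1 else if l \<in> L then 1 else 0)" for X l
  define E where "E X t = (\<Prod>l\<in>UNIV. weighted (N_left (\<rho> X l) (z' $ l)) (N_right (\<rho> X l) (z' $ l)) (t $ l))" for X and t :: "real ^ 'n"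
  have z': "z' \<in> upper_poly"
    using z by (auto simp: upper_poly_def z'_def L_def lower_indices_def offreal_Im linorder_neq_iff)
  then have zl: "Im (z' $ l) > 0" for l by (simp add: upper_poly_def)
  have Eint: "integrable \<nu> (E X)" for X
    unfolding E_def by (intro integrable_weighted_prod N_left_right_not_real zl \<nu>)
  have "(\<Prod>l\<in>UNIV. weighted (z $ l) (- \<i>) (t $ l)) = (\<Sum>X\<in>Pow U. (-1) ^ card L * E X t)" for t
  proof -
    have "(\<Prod>l\<in>UNIV. weighted (z $ l) (- \<i>) (t $ l)) =
      (\<Prod>l\<in>U. weighted (z $ l) (- \<i>) (t $ l)) * (\<Prod>l\<in>L. weighted (z $ l) (- \<i>) (t $ l))"
      by (subst prod.union_disjoint[symmetric]) (auto simp: U_def)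
    also have "(\<Prod>l\<in>U. weighted (z $ l) (- \<i>) (t $ l)) = (\<Prod>l\<in>U. weighted (z $ l) \<i> (t $ l) + weighted \<i> (- \<i>) (t $ l))"
      by (simp add: weighted_add)
    also have "\<dots> = (\<Sum>X\<in>Pow U. (\<Prod>l\<in>X. weighted (z $ l) \<i> (t $ l)) * (\<Prod>l\<in>U - X. weighted \<i> (- \<i>) (t $ l)))"
      by (rule prod_add) simp
    also have "\<dots> * (\<Prod>l\<in>L. weighted (z $ l) (- \<i>) (t $ l)) = (\<Sum>X\<in>Pow U. (-1) ^ card L * E X t)"
      unfolding sum_distrib_right
    proof (rule sum.cong[OF refl])
      fix X assume X: "X \<in> Pow U"
      define e where "e l = weighted (N_left (\<rho> X l) (z' $ l)) (N_right (\<rho> X l) (z' $ l)) (t $ l)" for l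
      have "E X t = (\<Prod>l\<in>U. e l) * (\<Prod>l\<in>L. e l)"
        unfolding E_def e_def by (subst prod.union_disjoint[symmetric]) (auto simp: U_def)
      also have "(\<Prod>l\<in>U. e l) = (\<Prod>l\<in>X. e l) * (\<Prod>l\<in>U - X. e l)"
        using X by (subst prod.subset_diff[of X U]) (auto simp: mult.commute)
      also have "(\<Prod>l\<in>X. e l) = (\<Prod>l\<in>X. weighted (z $ l) \<i> (t $ l))"
        using X by (intro prod.cong) (auto simp: e_def \<rho>_def N_left_def N_right_def z'_def U_def)
      also have "(\<Prod>l\<in>U - X. e l) = (\<Prod>l\<in>U - X. weighted \<i> (- \<i>) (t $ l))"
        by (intro prod.cong) (auto simp: e_def \<rho>_def N_left_def N_right_def U_def)
      also have "(\<Prod>l\<in>L. e l) = (\<Prod>l\<in>L. - 1 * weighted (z $ l) (- \<i>) (t $ l))"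
        using X by (intro prod.cong) (auto simp: e_def \<rho>_def N_left_def N_right_def z'_def U_def weighted_swap[of "- \<i>"])
      also have "\<dots> = (-1) ^ card L * (\<Prod>l\<in>L. weighted (z $ l) (- \<i>) (t $ l))"
        by (simp only: prod.distrib prod_constant)
      finally have "E X t = (-1) ^ card L * ((\<Prod>l\<in>X. weighted (z $ l) \<i> (t $ l)) * (\<Prod>l\<in>U - X. weighted \<i> (- \<i>) (t $ l))
         * (\<Prod>l\<in>L. weighted (z $ l) (- \<i>) (t $ l)))"
        by (simp only: mult_ac)
      moreover have "(-1) ^ card L * ((-1) ^ card L * x) = x" for x :: complex
        by (simp flip: mult.assoc power_mult_distrib)
      ultimately show "(\<Prod>l\<in>X. weighted (z $ l) \<i> (t $ l)) * (\<Prod>l\<in>U - X. weighted \<i> (- \<i>) (t $ l))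
         * (\<Prod>l\<in>L. weighted (z $ l) (- \<i>) (t $ l)) = (-1) ^ card L * E X t" by simp
    qed
    finally show ?thesis .
  qed
  then have "wint \<nu> (\<lambda>l. z $ l) (\<lambda>_. - \<i>) = (\<integral>t. (\<Sum>X\<in>Pow U. (-1) ^ card L * E X t) \<partial>\<nu>)"
    unfolding wint_def by (simp only:)
  also have "\<dots> = (\<Sum>X\<in>Pow U. \<integral>t. (-1) ^ card L * E X t \<partial>\<nu>)"
    by (intro Bochner_Integration.integral_sum integrable_mult_right Eint)
  also have "\<dots> = (\<Sum>X\<in>Pow U. (-1) ^ card L * term_N \<nu> (\<rho> X) z')"
    by (simp only: integral_mult_right_zero term_N_def[OF \<nu>] wint_def E_def)
  also have "\<dots> = (\<Sum>X\<in>{{}}. (-1) ^ card L * term_N \<nu> (\<rho> X) z')"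
  proof (rule sum.mono_neutral_right)
    show "\<forall>X\<in>Pow U - {{}}. (-1) ^ card L * term_N \<nu> (\<rho> X) z' = 0"
    proof
      fix X assume X: "X \<in> Pow U - {{}}"
      then obtain p where p: "p \<in> X" by blast
      obtain q where q: "q \<in> L" using L by (auto simp: L_def)
      have "q \<notin> X" using q X by (auto simp: U_def)
      have "-1 \<in> range (\<rho> X)" using p by (intro image_eqI[of _ _ p]) (auto simp: \<rho>_def)
      moreover have "1 \<in> range (\<rho> X)" using q \<open>q \<notin> X\<close> by (intro image_eqI[of _ _ q]) (auto simp: \<rho>_def)
      moreover have "range (\<rho> X) \<subseteq> {-1, 0, 1}" by (auto simp: \<rho>_def)
      ultimately show "(-1) ^ card L * term_N \<nu> (\<rho> X) z' = 0" using mixed z' by simp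
    qed
  qed auto
  also have "\<dots> = (-1) ^ card L * term_N \<nu> (\<rho> {}) z'" by simp
  finally show ?thesis by (simp add: \<rho>_def[abs_def] L_def z'_def)
qed

text \<open>The only term that survives in \<open>wint_lower\<close> has type \<open>0\<close> at
  the upper indices, and such a factor does not contain its variable.\<close>

lemma wint_var_nondep:
  fixes \<nu> :: "(real ^ 'n) measure"
  assumes \<nu>: "finite_measure \<nu>" "sets \<nu> = sets borel"
    and mixed: "\<And>\<sigma> z. range \<sigma> \<subseteq> {-1, 0, 1} \<Longrightarrow> -1 \<in> range \<sigma> \<Longrightarrow> 1 \<in> range \<sigma> \<Longrightarrow> z \<in> upper_poly \<Longrightarrow> term_N \<nu> \<sigma> z = 0"
  shows "var_nondep (\<lambda>z. wint \<nu> (\<lambda>l. z $ l) (\<lambda>_. - \<i>))"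
  unfolding var_nondep_def
proof (intro ballI impI)
  fix z w :: "complex ^ 'n"
  assume z: "z \<in> offreal_poly" and w: "w \<in> offreal_poly" and eq: "lower_indices z = lower_indices w"
    and ne: "lower_indices z \<noteq> {}" and same: "\<forall>j\<in>lower_indices z. z $ j = w $ j"
  have "term_N \<nu> (\<lambda>l. if l \<in> lower_indices z then 1 else 0) (\<chi> l. if l \<in> lower_indices z then cnj (z $ l) else z $ l)
    = term_N \<nu> (\<lambda>l. if l \<in> lower_indices w then 1 else 0) (\<chi> l. if l \<in> lower_indices w then cnj (w $ l) else w $ l)"
    unfolding term_N_def[OF \<nu>] wint_def using same eq
    by (intro Bochner_Integration.integral_cong prod.cong refl) (auto simp: N_left_def N_right_def)
  then show "wint \<nu> (\<lambda>l. z $ l) (\<lambda>_. - \<i>) = wint \<nu> (\<lambda>l. w $ l) (\<lambda>_. - \<i>)"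
    using wint_lower[OF \<nu> mixed z ne] wint_lower[OF \<nu> mixed w] ne eq by simp
qed

lemma alternating_sum_Pow: "(\<Sum>B\<in>Pow (UNIV :: 'n::finite set). (-1) ^ card B) = (0 :: complex)"
  using prod_add[of "UNIV :: 'n set" "\<lambda>_. - 1 :: complex" "\<lambda>_. 1"] by (simp add: zero_power)

text \<open>The conjugate of the \<open>l\<close>-th component of \<open>Psi B\<close> is
  \<open>z $ l\<close> on \<open>B\<close> and \<open>- \<i>\<close> off it. The alternating sum is
  thus the expansion of a product over \<open>l\<close>, each factor of which adds up to
  \<open>- weighted (z $ l) (- \<i>)\<close>.\<close>

lemma wint_alternating:
  fixes \<nu> :: "(real ^ 'n) measure" and z :: "complex ^ 'n"
  assumes \<nu>: "finite_measure \<nu>" "sets \<nu> = sets borel" and z: "z \<in> offreal_poly"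
  shows "(\<Sum>B\<in>Pow UNIV. (-1) ^ card B * cnj (wint \<nu> (\<lambda>l. Psi B (\<chi> j. \<i>) z $ l) (\<lambda>_. - \<i>)))
    = (-1) ^ CARD('n) * wint \<nu> (\<lambda>l. z $ l) (\<lambda>_. - \<i>)"
proof -
  define e where "e B t = (\<Prod>l\<in>UNIV. weighted (cnj (Psi B (\<chi> j. \<i>) z $ l)) \<i> (t $ l))" for B and t :: "real ^ 'n"
  have nr: "cnj (Psi B (\<chi> j. \<i>) z $ l) \<notin> \<real>" for B l
    using Psi_offreal[OF z, of B] by (simp only: offreal_Im complex_is_Real_iff) simp
  have ei: "integrable \<nu> (e B)" for B
    unfolding e_def by (intro integrable_weighted_prod nr i_not_real \<nu>)
  have "cnj (wint \<nu> (\<lambda>l. Psi B (\<chi> j. \<i>) z $ l) (\<lambda>_. - \<i>)) = (\<integral>t. e B t \<partial>\<nu>)" for B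
    unfolding wint_def Bochner_Integration.integral_cnj[symmetric] e_def
    by (simp only: cnj_prod cnj_weighted complex_cnj_minus complex_cnj_i minus_minus)
  then have "(\<Sum>B\<in>Pow UNIV. (-1) ^ card B * cnj (wint \<nu> (\<lambda>l. Psi B (\<chi> j. \<i>) z $ l) (\<lambda>_. - \<i>)))
    = (\<Sum>B\<in>Pow UNIV. \<integral>t. (-1) ^ card B * e B t \<partial>\<nu>)"
    by (simp only: integral_mult_right_zero)
  also have "\<dots> = (\<integral>t. (\<Sum>B\<in>Pow UNIV. (-1) ^ card B * e B t) \<partial>\<nu>)"
    by (intro Bochner_Integration.integral_sum[symmetric] integrable_mult_right ei)
  also have "\<dots> = (\<integral>t. (-1) ^ CARD('n) * (\<Prod>l\<in>UNIV. weighted (z $ l) (- \<i>) (t $ l)) \<partial>\<nu>)"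
  proof (rule Bochner_Integration.integral_cong[OF refl])
    fix t :: "real ^ 'n"
    have "(\<Prod>l\<in>UNIV. - 1 * weighted (z $ l) \<i> (t $ l) + weighted (- \<i>) \<i> (t $ l)) =
      (\<Sum>B\<in>Pow UNIV. (\<Prod>l\<in>B. - 1 * weighted (z $ l) \<i> (t $ l)) * (\<Prod>l\<in>UNIV - B. weighted (- \<i>) \<i> (t $ l)))"
      by (rule prod_add) simp
    also have "\<dots> = (\<Sum>B\<in>Pow UNIV. (-1) ^ card B * e B t)"
    proof (rule sum.cong[OF refl])
      fix B :: "'n set"
      have "e B t = (\<Prod>l\<in>B. weighted (cnj (Psi B (\<chi> j. \<i>) z $ l)) \<i> (t $ l)) * (\<Prod>l\<in>UNIV - B. weighted (cnj (Psi B (\<chi> j. \<i>) z $ l)) \<i> (t $ l))"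
        unfolding e_def by (subst prod.subset_diff[of B UNIV]) (auto simp: mult.commute)
      also have "(\<Prod>l\<in>B. weighted (cnj (Psi B (\<chi> j. \<i>) z $ l)) \<i> (t $ l)) = (\<Prod>l\<in>B. weighted (z $ l) \<i> (t $ l))"
        by (intro prod.cong) auto
      also have "(\<Prod>l\<in>UNIV - B. weighted (cnj (Psi B (\<chi> j. \<i>) z $ l)) \<i> (t $ l)) = (\<Prod>l\<in>UNIV - B. weighted (- \<i>) \<i> (t $ l))"
        by (intro prod.cong) auto
      finally show "(\<Prod>l\<in>B. - 1 * weighted (z $ l) \<i> (t $ l)) * (\<Prod>l\<in>UNIV - B. weighted (- \<i>) \<i> (t $ l)) = (-1) ^ card B * e B t"
        by (simp only: prod.distrib prod_constant mult.assoc)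
    qed
    finally have "(\<Sum>B\<in>Pow UNIV. (-1) ^ card B * e B t) =
      (\<Prod>l\<in>UNIV. - 1 * weighted (z $ l) \<i> (t $ l) + weighted (- \<i>) \<i> (t $ l))" ..
    also have "\<dots> = (\<Prod>l\<in>UNIV. - 1 * weighted (z $ l) (- \<i>) (t $ l))"
    proof (rule prod.cong[OF refl])
      fix l
      have "weighted (z $ l) \<i> (t $ l) - weighted (- \<i>) \<i> (t $ l) = weighted (z $ l) (- \<i>) (t $ l)"
        using weighted_add[of "z $ l" \<i> "t $ l" "- \<i>"] weighted_swap[of "- \<i>" \<i> "t $ l"] by simp
      then show "- 1 * weighted (z $ l) \<i> (t $ l) + weighted (- \<i>) \<i> (t $ l) = - 1 * weighted (z $ l) (- \<i>) (t $ l)"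
        by (simp flip: \<open>weighted (z $ l) \<i> (t $ l) - weighted (- \<i>) \<i> (t $ l) = weighted (z $ l) (- \<i>) (t $ l)\<close>)
    qed
    also have "\<dots> = (-1) ^ CARD('n) * (\<Prod>l\<in>UNIV. weighted (z $ l) (- \<i>) (t $ l))"
      by (simp only: prod.distrib prod_constant)
    finally show "(\<Sum>B\<in>Pow UNIV. (-1) ^ card B * e B t) = (-1) ^ CARD('n) * (\<Prod>l\<in>UNIV. weighted (z $ l) (- \<i>) (t $ l))" .
  qed
  finally show ?thesis by (simp only: integral_mult_right_zero wint_def)
qed

definition reflection_sym :: "(complex ^ 'n \<Rightarrow> complex) \<Rightarrow> bool" where
  "reflection_sym F \<longleftrightarrow> (\<forall>z\<in>offreal_poly.
     F z = (\<Sum>B | B \<noteq> {}. (-1) ^ (card B + 1) * cnj (F (Psi B (\<chi> j. \<i>) z))))"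

lemma sum_nonempty:
  fixes f :: "'n::finite set \<Rightarrow> complex"
  shows "(\<Sum>B | B \<noteq> {}. f B) = (\<Sum>B\<in>Pow UNIV. f B) - f {}"
proof -
  have "{B :: 'n set. B \<noteq> {}} = Pow UNIV - {{}}" by auto
  then show ?thesis by (simp add: sum_diff1)
qed

text \<open>Over all subsets the alternating sum of the constants is \<open>0\<close>, and
  \<open>wint_alternating\<close> turns the rest into \<open>- A * P z\<close>. The empty set,
  absent from the symmetry formula, contributes \<open>cnj (F (\<chi> j. \<i>))\<close>, which is
  exactly the constant part of \<open>F\<close>.\<close>

lemma wint_reflection_sym:
  fixes \<nu> :: "(real ^ 'n) measure" and a :: real
  assumes \<nu>: "finite_measure \<nu>" "sets \<nu> = sets borel"
  shows "reflection_sym (\<lambda>z :: complex ^ 'n. of_real a + herglotz_factor TYPE('n) * wint \<nu> (\<lambda>l. z $ l) (\<lambda>_. - \<i>)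
    - \<i> * of_real (measure \<nu> UNIV / pi ^ CARD('n)))"
  unfolding reflection_sym_def
proof
  fix z :: "complex ^ 'n" assume z: "z \<in> offreal_poly"
  define A where "A = herglotz_factor TYPE('n)"
  define m where "m = measure \<nu> UNIV / pi ^ CARD('n)"
  define P where "P z = wint \<nu> (\<lambda>l. z $ l) (\<lambda>_. - \<i>)" for z :: "complex ^ 'n"
  define F where "F z = of_real a + A * P z - \<i> * of_real m" for z
  have sp: "space \<nu> = UNIV" using sets_eq_imp_space_eq[OF \<nu>(2)] by simp
  have "P (\<chi> j. \<i>) = (2 * \<i>) ^ CARD('n) * of_real (measure \<nu> UNIV)"
    by (simp add: P_def wint_def weighted_i sp scaleR_conv_of_real mult.commute)
  then have Pi: "A * P (\<chi> j. \<i>) = 2 * \<i> * of_real m"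
    by (simp add: A_def herglotz_factor_def m_def power_mult_distrib)
  \<comment> \<open>Conjugation changes the sign of \<open>\<i>\<close> once in the numerator and
    \<open>CARD('n)\<close> times in the denominator.\<close>
  have cA: "cnj A * (-1) ^ CARD('n) = - A"
  proof -
    have "cnj A = - (2 * \<i>) / ((-1) * (2 * of_real pi * \<i>)) ^ CARD('n)"
      by (simp add: A_def herglotz_factor_def)
    also have "\<dots> = - A / (-1) ^ CARD('n)"
      unfolding power_mult_distrib[of "-1"] by (simp add: A_def herglotz_factor_def)
    finally show ?thesis by simp
  qed
  have "(\<Sum>B | B \<noteq> {}. (-1) ^ (card B + 1) * cnj (F (Psi B (\<chi> j. \<i>) z)))
    = cnj (F (Psi {} (\<chi> j. \<i>) z)) - (\<Sum>B\<in>Pow UNIV. (-1) ^ card B * cnj (F (Psi B (\<chi> j. \<i>) z)))"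
    unfolding sum_nonempty by (simp add: sum_negf)
  also have "(\<Sum>B\<in>Pow UNIV. (-1) ^ card B * cnj (F (Psi B (\<chi> j. \<i>) z))) =
    (of_real a + \<i> * of_real m) * (\<Sum>B\<in>Pow (UNIV :: 'n set). (-1) ^ card B)
    + cnj A * (\<Sum>B\<in>Pow UNIV. (-1) ^ card B * cnj (P (Psi B (\<chi> j. \<i>) z)))"
    unfolding sum_distrib_left sum.distrib[symmetric] by (intro sum.cong) (auto simp: F_def algebra_simps)
  also have "\<dots> = cnj A * (-1) ^ CARD('n) * P z"
    by (simp only: alternating_sum_Pow P_def wint_alternating[OF \<nu> z] mult_zero_right add_0 mult.assoc)
  also have "\<dots> = - A * P z" by (simp only: cA)
  also have "Psi {} (\<chi> j. \<i>) z = (\<chi> j. \<i>)" by (simp add: vec_eq_iff)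
  also have "cnj (F (\<chi> j. \<i>)) = of_real a - \<i> * of_real m"
    unfolding F_def Pi by simp
  finally have "(\<Sum>B | B \<noteq> {}. (-1) ^ (card B + 1) * cnj (F (Psi B (\<chi> j. \<i>) z))) = F z"
    by (simp add: F_def)
  then show "of_real a + herglotz_factor TYPE('n) * wint \<nu> (\<lambda>l. z $ l) (\<lambda>_. - \<i>) - \<i> * of_real (measure \<nu> UNIV / pi ^ CARD('n))
    = (\<Sum>B | B \<noteq> {}. (-1) ^ (card B + 1) * cnj (of_real a + herglotz_factor TYPE('n) *
       wint \<nu> (\<lambda>l. Psi B (\<chi> j. \<i>) z $ l) (\<lambda>_. - \<i>) - \<i> * of_real (measure \<nu> UNIV / pi ^ CARD('n))))"
    by (simp only: F_def P_def A_def m_def)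
qed

text \<open>Two bounds for one dominated convergence argument: the constant dominates, and the other
  gives pointwise decay in \<open>y\<close>.\<close>

lemma weighted_vertical:
  assumes "y \<ge> 1"
  shows "cmod (weighted (\<i> * of_real y) (- \<i>) s / (\<i> * of_real y)) \<le> 2"
    and "cmod (weighted (\<i> * of_real y) (- \<i>) s / (\<i> * of_real y)) \<le> 2 * cmod (of_real s - \<i>) / y"
proof -
  have nr: "\<i> * of_real y \<notin> \<real>" using assms by (simp add: complex_is_Real_iff)
  have ne: "of_real s - \<i> * of_real y \<noteq> 0" using assms by (auto simp: complex_eq_iff)
  have "1 + (\<i> * of_real y - \<i>) / (of_real s - \<i> * of_real y) = (of_real s - \<i>) / (of_real s - \<i> * of_real y)"
    using ne by (simp add: field_simps)
  then have "weighted (\<i> * of_real y) (- \<i>) s = \<i> * of_real (y + 1) * ((of_real s - \<i>) / (of_real s - \<i> * of_real y))"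
    unfolding weighted_eq[OF nr i_not_real(2)] by (simp add: algebra_simps)
  then have eq: "cmod (weighted (\<i> * of_real y) (- \<i>) s / (\<i> * of_real y))
      = (y + 1) / y * (cmod (of_real s - \<i>) / cmod (of_real s - \<i> * of_real y))"
    using assms by (simp only: norm_divide norm_mult norm_of_real) simp
  have le2: "(y + 1) / y \<le> 2" using assms by (simp add: divide_simps)
  have "(cmod (of_real s - \<i>))\<^sup>2 \<le> (cmod (of_real s - \<i> * of_real y))\<^sup>2"
    using assms by (simp add: cmod_power2)
  then have le: "cmod (of_real s - \<i>) \<le> cmod (of_real s - \<i> * of_real y)" by (rule power2_le_imp_le) simp
  have pos: "cmod (of_real s - \<i> * of_real y) > 0" using ne by simp
  have "(y + 1) / y * (cmod (of_real s - \<i>) / cmod (of_real s - \<i> * of_real y)) \<le> 2 * 1"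
    using le pos assms by (intro mult_mono le2) (auto simp: divide_simps)
  then show "cmod (weighted (\<i> * of_real y) (- \<i>) s / (\<i> * of_real y)) \<le> 2" unfolding eq by simp
  have "y \<le> cmod (of_real s - \<i> * of_real y)" using Im_le_norm_diff[of "\<i> * of_real y" s] assms by simp
  then have "(y + 1) / y * (cmod (of_real s - \<i>) / cmod (of_real s - \<i> * of_real y)) \<le> 2 * (cmod (of_real s - \<i>) / y)"
    using assms by (intro mult_mono le2 divide_left_mono mult_pos_pos pos) auto
  then show "cmod (weighted (\<i> * of_real y) (- \<i>) s / (\<i> * of_real y)) \<le> 2 * cmod (of_real s - \<i>) / y" unfolding eq by simp
qed

text \<open>The integral part of a representation does not grow linearly along an imaginary axis;
  this lets the coefficients \<open>b\<close> be read off from the represented function.\<close>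

lemma wint_growth:
  fixes \<nu> :: "(real ^ 'n) measure"
  assumes \<nu>: "finite_measure \<nu>" "sets \<nu> = sets borel"
  shows "(\<lambda>n. wint \<nu> (\<lambda>l. set_comp (\<chi> k. \<i>) j (\<i> * of_real (real (Suc n))) $ l) (\<lambda>_. - \<i>) / (\<i> * of_real (real (Suc n)))) \<longlonglongrightarrow> 0"
proof -
  interpret finite_measure \<nu> by fact
  define y where "y n = real (Suc n)" for n
  define q where "q n s = weighted (\<i> * of_real (y n)) (- \<i>) s / (\<i> * of_real (y n))" for n s
  define c where "c = (2 * \<i>) ^ card (UNIV - {j})"
  have y1: "y n \<ge> 1" for n by (simp add: y_def)
  have "wint \<nu> (\<lambda>l. set_comp (\<chi> k. \<i>) j (\<i> * of_real (y n)) $ l) (\<lambda>_. - \<i>) / (\<i> * of_real (y n)) = (\<integral>t. q n (t $ j) * c \<partial>\<nu>)" for n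
  proof -
    have "(\<Prod>l\<in>UNIV. weighted (set_comp (\<chi> k. \<i>) j (\<i> * of_real (y n)) $ l) (- \<i>) (t $ l)) = (\<i> * of_real (y n)) * (q n (t $ j) * c)"
      for t :: "real ^ 'n"
    proof -
      have "(\<Prod>l\<in>UNIV - {j}. weighted (set_comp (\<chi> k. \<i>) j (\<i> * of_real (y n)) $ l) (- \<i>) (t $ l)) = (\<Prod>l\<in>UNIV - {j}. 2 * \<i>)"
        by (intro prod.cong) (auto simp: weighted_i)
      then show ?thesis using y1[of n]
        by (subst prod.remove[of UNIV j]) (auto simp: q_def c_def)
    qed
    then have "wint \<nu> (\<lambda>l. set_comp (\<chi> k. \<i>) j (\<i> * of_real (y n)) $ l) (\<lambda>_. - \<i>) = (\<i> * of_real (y n)) * (\<integral>t. q n (t $ j) * c \<partial>\<nu>)"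
      unfolding wint_def by (simp only: integral_mult_right_zero)
    then show ?thesis using y1[of n] by simp
  qed
  moreover have "(\<lambda>n. \<integral>t. q n (t $ j) * c \<partial>\<nu>) \<longlonglongrightarrow> (\<integral>t. 0 \<partial>\<nu>)"
  proof (rule integral_dominated_convergence[where w = "\<lambda>_. 2 * cmod c"])
    show "(\<lambda>t. q n (t $ j) * c) \<in> borel_measurable \<nu>" for n
    proof -
      have "continuous_on UNIV (\<lambda>s. q n s)" unfolding q_def
        using y1[of n] by (intro continuous_intros weighted_continuous) (auto simp: complex_is_Real_iff)
      then show ?thesis
        by (intro measurable_borel_sets[OF \<nu>(2)] borel_measurable_continuous_onI continuous_intros)
           (auto intro!: continuous_on_compose2[of UNIV "q n"] continuous_intros)
    qed
    show "AE t in \<nu>. norm (q n (t $ j) * c) \<le> 2 * cmod c" for n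
      unfolding norm_mult q_def using weighted_vertical(1)[OF y1] by (intro AE_I2 mult_right_mono) auto
    show "AE t in \<nu>. (\<lambda>n. q n (t $ j) * c) \<longlonglongrightarrow> 0"
    proof (rule AE_I2)
      fix t :: "real ^ 'n"
      have "(\<lambda>n. q n (t $ j)) \<longlonglongrightarrow> 0"
      proof (rule Lim_null_comparison)
        show "\<forall>\<^sub>F n in sequentially. norm (q n (t $ j)) \<le> 2 * cmod (of_real (t $ j) - \<i>) / y n"
          unfolding q_def using weighted_vertical(2)[OF y1] by (intro always_eventually allI)
        show "(\<lambda>n. 2 * cmod (of_real (t $ j) - \<i>) / y n) \<longlonglongrightarrow> 0"
          unfolding y_def by real_asymp
      qed
      then show "(\<lambda>n. q n (t $ j) * c) \<longlonglongrightarrow> 0" by (rule tendsto_mult_left_zero)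
    qed
  qed auto
  ultimately show ?thesis by (simp add: y_def)
qed

text \<open>After replacing the upper components of \<open>z\<close> by \<open>\<i>\<close>, the terms of the symmetry formula with \<open>B\<close> contained
  in the lower index set only involve points of the upper poly-half-plane, and the remaining terms cancel in pairs that
  differ by a fixed lower index.\<close>

lemma reflection_sym_unique:
  fixes F1 F2 :: "complex ^ 'n \<Rightarrow> complex"
  assumes sym: "reflection_sym F1" "reflection_sym F2" and dep: "var_nondep F1" "var_nondep F2"
    and upper: "\<And>z. z \<in> upper_poly \<Longrightarrow> F1 z = F2 z" and z: "z \<in> offreal_poly"
  shows "F1 z = F2 z"
proof (cases "lower_indices z = {}")
  case True
  then have "z \<in> upper_poly" using z by (auto simp: lower_indices_def upper_poly_def offreal_Im linorder_neq_iff)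
  then show ?thesis by (rule upper)
next
  case False
  define L where "L = lower_indices z"
  obtain p where p: "p \<in> L" using False by (auto simp: L_def)
  define D where "D z = F1 z - F2 z" for z
  have D: "D v = D w" if "v \<in> offreal_poly" "w \<in> offreal_poly" "lower_indices v = lower_indices w"
    "lower_indices v \<noteq> {}" "\<And>j. j \<in> lower_indices v \<Longrightarrow> v $ j = w $ j" for v w
    unfolding D_def
    using dep(1)[unfolded var_nondep_def, rule_format, OF that] dep(2)[unfolded var_nondep_def, rule_format, OF that] by simp
  have Dsym: "D w = (\<Sum>B | B \<noteq> {}. (-1) ^ (card B + 1) * cnj (D (Psi B (\<chi> j. \<i>) w)))" if "w \<in> offreal_poly" for w
  proof -
    have "D w = (\<Sum>B | B \<noteq> {}. (-1) ^ (card B + 1) * cnj (F1 (Psi B (\<chi> j. \<i>) w)))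
      - (\<Sum>B | B \<noteq> {}. (-1) ^ (card B + 1) * cnj (F2 (Psi B (\<chi> j. \<i>) w)))"
      unfolding D_def
      using sym(1)[unfolded reflection_sym_def, rule_format, OF that] sym(2)[unfolded reflection_sym_def, rule_format, OF that]
      by (simp only:)
    then show ?thesis unfolding D_def by (simp only: sum_subtractf[symmetric] right_diff_distrib complex_cnj_diff)
  qed
  \<comment> \<open>The non-dependence property allows the upper components to be set to
    \<open>\<i>\<close>; then every lower component of a reflected point is \<open>- \<i>\<close>,
    whatever \<open>z\<close> is.\<close>
  define w where "w = (\<chi> j. if j \<in> L then z $ j else \<i>)"
  have wo: "w \<in> offreal_poly" using z by (simp add: offreal_Im w_def)
  have wL: "lower_indices w = L" by (auto simp: L_def w_def lower_indices_def)
  have low: "Im (z $ j) < 0 \<longleftrightarrow> j \<in> L" for j by (simp add: L_def lower_indices_def)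
  define v where "v B = Psi B (\<chi> j. \<i>) w" for B
  have vo: "v B \<in> offreal_poly" for B unfolding v_def by (rule Psi_offreal[OF wo])
  have "Im (v B $ j) < 0 \<longleftrightarrow> j \<in> B \<and> j \<notin> L" for B j
    using low[of j] by (auto simp: v_def w_def)
  then have vlow: "lower_indices (v B) = B - L" for B by (auto simp: lower_indices_def)
  have vval: "v B $ j = - \<i>" if "j \<in> B - L" for B j
    using that by (simp add: v_def w_def)
  define g where "g B = (-1) ^ (card B + 1) * cnj (D (v B))" for B
  define T where "T = {B. \<not> B \<subseteq> L}"
  \<comment> \<open>Toggling the lower index \<open>p\<close> preserves \<open>B - L\<close>, and
    with it the lower components of \<open>v B\<close>, so \<open>D (v B)\<close> stays the same
    while the sign of its term flips.\<close>
  define \<tau> where "\<tau> B = (if p \<in> B then B - {p} else insert p B)" for B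
  have "D w = (\<Sum>B | B \<noteq> {}. g B)" unfolding Dsym[OF wo] g_def v_def ..
  also have "\<dots> = (\<Sum>B\<in>T. g B)"
  proof (rule sum.mono_neutral_right)
    show "\<forall>B\<in>{B. B \<noteq> {}} - T. g B = 0"
    proof
      fix B assume "B \<in> {B. B \<noteq> {}} - T"
      then have "lower_indices (v B) = {}" unfolding vlow by (auto simp: T_def)
      then have "v B \<in> upper_poly" using vo[of B] by (auto simp: lower_indices_def upper_poly_def offreal_Im linorder_neq_iff)
      then show "g B = 0" using upper by (simp add: g_def D_def)
    qed
  qed (auto simp: T_def)
  also have "\<dots> = 0"
  proof -
    have g\<tau>: "g (\<tau> B) = - g B" if B: "B \<in> T" for B
    proof -
      have "\<tau> B - L = B - L" using p by (auto simp: \<tau>_def)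
      then have "D (v (\<tau> B)) = D (v B)"
        using B vval[of _ "\<tau> B"] vval[of _ B] by (intro D vo) (auto simp: vlow T_def)
      moreover have "(-1::complex) ^ (card (\<tau> B) + 1) = - ((-1) ^ (card B + 1))"
      proof (cases "p \<in> B")
        case True
        then have "card B = Suc (card (B - {p}))" by (intro card.remove finite)
        then show ?thesis using True by (simp add: \<tau>_def)
      qed (simp add: \<tau>_def)
      ultimately show ?thesis by (simp add: g_def)
    qed
    have "(\<Sum>B\<in>T. g B) = (\<Sum>B\<in>T. g (\<tau> B))"
      by (rule sum.reindex_bij_witness[of _ \<tau> \<tau>]) (use p in \<open>auto simp: T_def \<tau>_def insert_absorb split: if_splits\<close>)
    also have "\<dots> = - (\<Sum>B\<in>T. g B)" using g\<tau> by (simp add: sum_negf)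
    finally show ?thesis by simp
  qed
  finally have "D w = 0" .
  moreover have "D z = D w"
  proof (rule D[OF z wo])
    show "lower_indices z = lower_indices w" by (simp add: wL L_def)
    show "z $ j = w $ j" if "j \<in> lower_indices z" for j using that by (simp add: w_def L_def)
  qed (rule False)
  ultimately show ?thesis by (simp add: D_def)
qed

section \<open>Arbitrary representing triples and the given function\<close>

lemma herglotz_triple_term_N:
  fixes h :: "complex ^ 'n \<Rightarrow> complex"
  assumes T: "herglotz_triple h a b \<mu>"
    and \<sigma>: "range \<sigma> \<subseteq> {-1, 0, 1}" "-1 \<in> range \<sigma>" "1 \<in> range \<sigma>" and z: "z \<in> upper_poly"
  shows "term_N (decayed \<mu>) \<sigma> z = 0"
proof (rule term_N_zero[OF finite_decayed(2,3)[OF T] _ \<sigma> z])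
  note fin = finite_decayed[OF T]
  fix z :: "complex ^ 'n" assume z: "z \<in> upper_poly"
  have "0 = (\<Sum>\<rho> | range \<rho> \<subseteq> {-1, 0, 1} \<and> -1 \<in> range \<rho> \<and> 1 \<in> range \<rho>.
           \<integral>t. (\<Prod>j\<in>UNIV. factor_N (\<rho> j) (z $ j) (t $ j)) \<partial>\<mu>)"
    using T z by (simp add: herglotz_triple_def)
  also have "\<dots> = (1 / (2 * \<i>)) ^ CARD('n) * (\<Sum>\<rho> | range \<rho> \<subseteq> {-1, 0, 1} \<and> -1 \<in> range \<rho> \<and> 1 \<in> range \<rho>. term_N (decayed \<mu>) \<rho> z)"
    by (simp only: factor_N_prod_integral[OF fin(1) z] term_N_def[OF fin(2,3)] sum_distrib_left)
  finally show "(\<Sum>\<rho> | range \<rho> \<subseteq> {-1, 0, 1} \<and> -1 \<in> range \<rho> \<and> 1 \<in> range \<rho>. term_N (decayed \<mu>) \<rho> z) = 0"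
    by simp
qed

text \<open>Gathers what both directions of the theorem need from a triple. The last limit, compared
  with the growth assumed of \<open>f\<close>, identifies \<open>b\<close> with
  \<open>d\<close>.\<close>

lemma herglotz_formula_properties:
  fixes h :: "complex ^ 'n \<Rightarrow> complex" and \<mu> :: "(real ^ 'n) measure"
  assumes T: "herglotz_triple h a b \<mu>"
  obtains F where
    "\<And>z. z \<in> offreal_poly \<Longrightarrow> herglotz_formula a b \<mu> z = F z + (\<Sum>j\<in>UNIV. of_real (b $ j) * z $ j)"
    "reflection_sym F" "var_nondep F"
    "\<And>j. (\<lambda>n. herglotz_formula a b \<mu> (set_comp (\<chi> k. \<i>) j (\<i> * of_real (real (Suc n)))) / (\<i> * of_real (real (Suc n))))
      \<longlonglongrightarrow> of_real (b $ j)"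
proof -
  note fin = finite_decayed[OF T]
  define F where "F z = of_real a + herglotz_factor TYPE('n) * wint (decayed \<mu>) (\<lambda>l. z $ l) (\<lambda>_. - \<i>)
    - \<i> * of_real (measure (decayed \<mu>) UNIV / pi ^ CARD('n))" for z :: "complex ^ 'n"
  show ?thesis
  proof (rule that[of F])
    show form: "herglotz_formula a b \<mu> z = F z + (\<Sum>j\<in>UNIV. of_real (b $ j) * z $ j)" if "z \<in> offreal_poly" for z
      unfolding herglotz_formula_decayed[OF fin(1,2) that] F_def by simp
    show "reflection_sym F" unfolding F_def by (rule wint_reflection_sym[OF fin(2,3)])
    have "var_nondep (\<lambda>z. wint (decayed \<mu>) (\<lambda>l. z $ l) (\<lambda>_. - \<i>))"
      by (rule wint_var_nondep[OF fin(2,3)]) (rule herglotz_triple_term_N[OF T])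
    then show "var_nondep F" unfolding var_nondep_def F_def by metis
    fix j :: 'n
    define u where "u n = set_comp (\<chi> k. \<i>) j (\<i> * of_real (real (Suc n)))" for n
    define y where "y n = \<i> * complex_of_real (real (Suc n))" for n
    have uo: "u n \<in> offreal_poly" for n by (auto simp: offreal_Im u_def)
    have inf: "filterlim (\<lambda>n. complex_of_real (real (Suc n))) at_infinity sequentially"
      by (intro filterlim_compose[OF filterlim_of_real_at_infinity] filterlim_compose[OF filterlim_real_sequentially] filterlim_Suc)
    have c0: "(\<lambda>n. c / y n) \<longlonglongrightarrow> 0" for c
    proof -
      have "(\<lambda>n. c / \<i> / complex_of_real (real (Suc n))) \<longlonglongrightarrow> 0"
        by (rule tendsto_divide_0[OF tendsto_const inf])
      then show ?thesis unfolding y_def by (simp only: divide_divide_eq_left)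
    qed
    have y0: "y n \<noteq> 0" for n by (simp add: y_def del: of_nat_Suc)
    have "(\<lambda>n. of_real (b $ k) * u n $ k / y n) \<longlonglongrightarrow> (if k = j then of_real (b $ j) else 0)" for k
    proof -
      have "u n $ k = (if k = j then y n else \<i>)" for n by (simp add: u_def y_def)
      then show ?thesis using c0[of "of_real (b $ k) * \<i>"] y0 by simp
    qed
    then have "(\<lambda>n. \<Sum>k\<in>UNIV. of_real (b $ k) * u n $ k / y n) \<longlonglongrightarrow> (\<Sum>k\<in>UNIV. if k = j then of_real (b $ j) else 0)"
      by (intro tendsto_sum)
    then have lin: "(\<lambda>n. (\<Sum>k\<in>UNIV. of_real (b $ k) * u n $ k) / y n) \<longlonglongrightarrow> of_real (b $ j)"
      by (simp add: sum_divide_distrib)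
    have W: "(\<lambda>n. wint (decayed \<mu>) (\<lambda>l. u n $ l) (\<lambda>_. - \<i>) / y n) \<longlonglongrightarrow> 0"
      unfolding u_def y_def by (rule wint_growth[OF fin(2,3)])
    have "(\<lambda>n. of_real a / y n + herglotz_factor TYPE('n) * (wint (decayed \<mu>) (\<lambda>l. u n $ l) (\<lambda>_. - \<i>) / y n)
       - \<i> * of_real (measure (decayed \<mu>) UNIV / pi ^ CARD('n)) / y n + (\<Sum>k\<in>UNIV. of_real (b $ k) * u n $ k) / y n)
       \<longlonglongrightarrow> 0 + herglotz_factor TYPE('n) * 0 - 0 + of_real (b $ j)"
      by (intro tendsto_add tendsto_diff tendsto_mult tendsto_const c0 W lin)
    moreover have "herglotz_formula a b \<mu> (u n) / y n = of_real a / y n + herglotz_factor TYPE('n) * (wint (decayed \<mu>) (\<lambda>l. u n $ l) (\<lambda>_. - \<i>) / y n)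
       - \<i> * of_real (measure (decayed \<mu>) UNIV / pi ^ CARD('n)) / y n + (\<Sum>k\<in>UNIV. of_real (b $ k) * u n $ k) / y n" for n
      unfolding form[OF uo] F_def by (simp only: add_divide_distrib diff_divide_distrib times_divide_eq_right)
    ultimately have "(\<lambda>n. herglotz_formula a b \<mu> (u n) / y n) \<longlonglongrightarrow> of_real (b $ j)" by simp
    then show "(\<lambda>n. herglotz_formula a b \<mu> (set_comp (\<chi> k. \<i>) j (\<i> * of_real (real (Suc n)))) / (\<i> * of_real (real (Suc n))))
      \<longlonglongrightarrow> of_real (b $ j)" by (simp only: u_def y_def)
  qed
qed

text \<open>Existence of a triple guarantees that the choice in \<open>herglotz_sym\<close> is
  itself a representing triple.\<close>

lemma herglotz_sym_triple:
  assumes "herglotz_nevanlinna h"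
  obtains a b \<mu> where "herglotz_triple h a b \<mu>" "herglotz_sym h = herglotz_formula a b \<mu>"
proof -
  define p where "p = (SOME (a, b, \<mu>). herglotz_triple h a b \<mu>)"
  obtain a b \<mu> where "herglotz_triple h a b \<mu>" using herglotz_triple_exists[OF assms] by blast
  then have "(\<lambda>(a, b, \<mu>). herglotz_triple h a b \<mu>) (a, b, \<mu>)" by simp
  then have "case p of (a, b, \<mu>) \<Rightarrow> herglotz_triple h a b \<mu>"
    unfolding p_def by (rule someI)
  then show ?thesis
    using that by (cases p) (auto simp: herglotz_sym_def p_def[symmetric])
qed

lemma nontang_upper_lim_vertical:
  assumes "nontang_upper_lim g L"
  shows "(\<lambda>n. g (\<i> * of_real (real (Suc n)))) \<longlonglongrightarrow> L"
proof -
  \<comment> \<open>For the angle \<open>pi / 2\<close> the Stoltz domain is just the positive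
    imaginary axis.\<close>
  have lim: "(g \<longlongrightarrow> L) (inf at_infinity (principal (upper_stoltz (pi / 2))))"
    using assms by (simp add: nontang_upper_lim_def)
  have "filterlim (\<lambda>n. complex_of_real (real (Suc n))) at_infinity sequentially"
    by (intro filterlim_compose[OF filterlim_of_real_at_infinity] filterlim_compose[OF filterlim_real_sequentially] filterlim_Suc)
  then have "filterlim (\<lambda>n. \<i> * complex_of_real (real (Suc n))) at_infinity sequentially"
    by (rule tendsto_mult_filterlim_at_infinity[OF tendsto_const, rotated]) simp
  moreover have "\<i> * complex_of_real (real (Suc n)) \<in> upper_stoltz (pi / 2)" for n
    using Arg_times_of_real2[of "real (Suc n)" \<i>] by (simp add: upper_stoltz_def del: of_nat_Suc)
  ultimately have "filterlim (\<lambda>n. \<i> * complex_of_real (real (Suc n))) (inf at_infinity (principal (upper_stoltz (pi / 2)))) sequentially"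
    by (simp add: filterlim_inf filterlim_principal)
  from filterlim_compose[OF lim this] show ?thesis .
qed

lemma var_nondep_cong:
  fixes F G :: "complex ^ 'n \<Rightarrow> complex"
  assumes "\<And>z. z \<in> offreal_poly \<Longrightarrow> F z = G z" "var_nondep G"
  shows "var_nondep F"
  unfolding var_nondep_def
proof (intro ballI impI)
  fix z w :: "complex ^ 'n" assume zw: "z \<in> offreal_poly" "w \<in> offreal_poly" "lower_indices z = lower_indices w" "lower_indices z \<noteq> {}"
    "\<forall>j\<in>lower_indices z. z $ j = w $ j"
  have "G z = G w" using assms(2)[unfolded var_nondep_def] zw by blast
  then show "F z = F w" using assms(1) zw by simp
qed

theorem corollary3p4:
  fixes f :: "complex ^ 'n \<Rightarrow> complex" and d :: "real ^ 'n"
  assumes "mv_holomorphic_on f offreal_poly"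
    and "\<forall>j. d $ j \<ge> 0"
    and "\<forall>j. \<forall>z\<in>offreal_poly.
           nontang_upper_lim (\<lambda>w. f (set_comp z j w) / w) (of_real (d $ j)) \<and>
           nontang_lower_lim (\<lambda>w. f (set_comp z j w) / w) (of_real (d $ j))"
  shows "(\<exists>h :: complex ^ 'n \<Rightarrow> complex.
            herglotz_nevanlinna h \<and> (\<forall>z\<in>offreal_poly. f z = herglotz_sym h z)) \<longleftrightarrow>
         (let F = (\<lambda>z. f z - (\<Sum>j\<in>UNIV. of_real (d $ j) * z $ j)) in
            (\<forall>z\<in>upper_poly. Im (f z) \<ge> 0) \<and>
            (\<forall>z\<in>offreal_poly.
               F z = (\<Sum>B | B \<noteq> {}. (-1) ^ (card B + 1) * cnj (F (Psi B (\<chi> j. \<i>) z)))) \<and>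
            var_nondep F)"
proof -
  define F where "F = (\<lambda>z. f z - (\<Sum>j\<in>UNIV. of_real (d $ j) * z $ j))"
  have one: "(\<chi> k. \<i>) \<in> (upper_poly :: (complex ^ 'n) set)" by (simp add: upper_poly_def)
  have growth: "(\<lambda>n. f (set_comp (\<chi> k. \<i>) j (\<i> * of_real (real (Suc n)))) / (\<i> * of_real (real (Suc n)))) \<longlonglongrightarrow> of_real (d $ j)" for j
    using assms(3) offreal_of_upper[OF one] by (intro nontang_upper_lim_vertical) blast
  \<comment> \<open>Both limits are taken along the \<open>j\<close>-th imaginary axis with all
    other components equal to \<open>\<i>\<close>, that is, inside \<open>upper_poly\<close>;
    agreement with the formula there suffices.\<close>
  have d_eq: "b = d" if T: "herglotz_triple h a b \<mu>" and eq: "\<And>z. z \<in> upper_poly \<Longrightarrow> f z = herglotz_formula a b \<mu> z" for h a b \<mu>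
  proof -
    have "b $ j = d $ j" for j
    proof -
      have "set_comp (\<chi> k. \<i>) j (\<i> * of_real (real (Suc n))) \<in> (upper_poly :: (complex ^ 'n) set)" for n
        using one by (intro set_comp_upper) auto
      moreover have "(\<lambda>n. herglotz_formula a b \<mu> (set_comp (\<chi> k. \<i>) j (\<i> * of_real (real (Suc n)))) / (\<i> * of_real (real (Suc n)))) \<longlonglongrightarrow> of_real (b $ j)"
        by (rule herglotz_formula_properties[OF T]) blast
      ultimately have "(\<lambda>n. f (set_comp (\<chi> k. \<i>) j (\<i> * of_real (real (Suc n)))) / (\<i> * of_real (real (Suc n)))) \<longlonglongrightarrow> of_real (b $ j)"
        by (simp only: eq)
      from LIMSEQ_unique[OF this growth] show ?thesis by simp
    qed
    then show ?thesis by (simp add: vec_eq_iff)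
  qed
  have "(\<exists>h :: complex ^ 'n \<Rightarrow> complex. herglotz_nevanlinna h \<and> (\<forall>z\<in>offreal_poly. f z = herglotz_sym h z)) \<longleftrightarrow>
     (\<forall>z\<in>upper_poly. Im (f z) \<ge> 0) \<and> reflection_sym F \<and> var_nondep F" (is "?L = ?R")
  proof
    assume ?L
    then obtain h :: "complex ^ 'n \<Rightarrow> complex" where h: "herglotz_nevanlinna h" and f: "\<And>z. z \<in> offreal_poly \<Longrightarrow> f z = herglotz_sym h z"
      by blast
    obtain a b \<mu> where T: "herglotz_triple h a b \<mu>" and sym: "herglotz_sym h = herglotz_formula a b \<mu>"
      by (rule herglotz_sym_triple[OF h]) (rule that; assumption)
    have fh: "f z = herglotz_formula a b \<mu> z" if "z \<in> offreal_poly" for z using f[OF that] sym by simp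
    have b: "b = d" by (rule d_eq[OF T fh[OF offreal_of_upper]])
    have fu: "f z = h z" if "z \<in> upper_poly" for z
      using fh[OF offreal_of_upper[OF that]] T that by (simp add: herglotz_triple_def)
    obtain F' where F': "\<And>z. z \<in> offreal_poly \<Longrightarrow> herglotz_formula a b \<mu> z = F' z + (\<Sum>j\<in>UNIV. of_real (b $ j) * z $ j)"
      and sym: "reflection_sym F'" and dep: "var_nondep F'"
      by (rule herglotz_formula_properties[OF T]) (rule that; blast)
    have FF: "F z = F' z" if "z \<in> offreal_poly" for z
      using fh[OF that] F'[OF that] by (simp add: F_def b)
    have "reflection_sym F"
      using sym unfolding reflection_sym_def by (simp add: FF FF[OF Psi_offreal])
    moreover have "var_nondep F"
      by (rule var_nondep_cong[OF FF dep])
    moreover have "\<forall>z\<in>upper_poly. Im (f z) \<ge> 0" using h fu by (simp add: herglotz_nevanlinna_def)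
    ultimately show ?R by blast
  next
    assume R: ?R
    \<comment> \<open>The witness is \<open>f\<close> itself, since being a Herglotz-Nevanlinna
      function and having a triple concern its values on \<open>upper_poly\<close> only. What
      remains is that \<open>f\<close> continues to \<open>offreal_poly\<close> in the same way as
      its formula.\<close>
    have h: "herglotz_nevanlinna f"
      using R assms(1) offreal_of_upper by (auto simp: herglotz_nevanlinna_def mv_holomorphic_on_def)
    obtain a b \<mu> where T: "herglotz_triple f a b \<mu>" and sym: "herglotz_sym f = herglotz_formula a b \<mu>"
      by (rule herglotz_sym_triple[OF h]) (rule that; assumption)
    have fu: "f z = herglotz_formula a b \<mu> z" if "z \<in> upper_poly" for z
      using T that by (simp add: herglotz_triple_def)
    have b: "b = d" by (rule d_eq[OF T fu])
    obtain F' where F': "\<And>z. z \<in> offreal_poly \<Longrightarrow> herglotz_formula a b \<mu> z = F' z + (\<Sum>j\<in>UNIV. of_real (b $ j) * z $ j)"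
      and sym': "reflection_sym F'" and dep': "var_nondep F'"
      by (rule herglotz_formula_properties[OF T]) (rule that; blast)
    have FFu: "F z = F' z" if "z \<in> upper_poly" for z
      using fu[OF that] F'[OF offreal_of_upper[OF that]] by (simp add: F_def b)
    have symF: "reflection_sym F" and depF: "var_nondep F" using R by blast+
    have FF: "F z = F' z" if "z \<in> offreal_poly" for z
      by (rule reflection_sym_unique[OF symF sym' depF dep' FFu that])
    have "f z = herglotz_sym f z" if "z \<in> offreal_poly" for z
      using FF[OF that] F'[OF that] by (simp add: sym F_def b algebra_simps)
    then show ?L using h by blast
  qed
  then show ?thesis unfolding Let_def F_def reflection_sym_def .
qed

end
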